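(* Under the standing setting and Assumptions (Compact), (Irreducible) and (Killing), let $\alpha(dx)=\varphi^*(x)\mu(dx)$ and $\alpha^*(dx)=\varphi(x)\mu(dx)$, and let $\gamma>0$ be a constant such that $\|e^{\lambda_1t}Q_tf-M^{-1}\varphi\int_E\varphi^*f\,d\mu\|_{L^2_\mu}\le e^{-\gamma t}(1+M^{-1})\|f\|_{L^2_\mu}$ for all $f\in L^2(E,\mu)$ and all sufficiently large $t$. Then for every $f\in L^2(E,\mu)$ there exist $T>0$ and $C_f>0$ such that \[\Big\|\,\mathbb E_{\cdot}[f(Z_t)\mid t<\tau]-\alpha(f)\Big\|_{L^1(E,\alpha^* )}\le C_fe^{-\gamma t}\qquad\text{for all }t\ge T.\]
   Context: Let $H$ be a separable real Hilbert space and $(Z_t)_{t\ge0}$ a continuous time-homogeneous Markov process on $H$ with laws $(\mathbb P_x)_{x\in H}$ ($Z_0=x$ $\mathbb P_x$-a.s.), expectation $\mathbb E_x$, and Markov semigroup $P_tf(x)=\mathbb E_x[f(Z_t)]$; $\nu(f)=\int f\,d\nu$. Assumption (Compact): there is an invariant probability measure $\mu$ of $(P_t)$ such that for every $t>0$, $P_t$ extends to a compact operator on $L^2(H,\mu)$. Assumption (Irreducible): $P_t1_F(x)>0$ for all $x\in H$, $t>0$, and measurable $F\subset H$ with $\mu(F)>0$. Fix a bounded connected set $E\subset H$ contained in the support of $\mu$; $L^p(E,\mu)$ is the closure of bounded measurable functions on $E$ in the norm $\|f\|_{L^p_\mu}^p=\int_E|f|^pd\mu$. Let $\tau=\inf\{t>0:Z_t\in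 H\setminus E\}$ and $Q_tf(x)=\mathbb E_x[f(Z_t)1_{\{t<\tau\}}]$, $x\in E$. Assumption (Killing): for all $x\in E$ and $t>0$, $\mathbb P_x[\tau<\infty]=1$ and $\mathbb P_x[t<\tau]>0$. Spectral objects: $(Q_t)$ is a strongly continuous semigroup of compact positive operators on $L^2(E,\mu)$ with generator $\mathcal L_E$, and $s(\mathcal L_E)=\sup\operatorname{spec}\mathcal L_E$ is a simple eigenvalue. Put $\lambda_1=-s(\mathcal L_E)$. Let $\varphi>0$ be an eigenfunction of $\mathcal L_E$ with eigenvalue $-\lambda_1$ and $\varphi^*>0$ an eigenfunction of the adjoint (so $Q_t^*\varphi^*=e^{-\lambda_1t}\varphi^*$), normalized by $\int_E\varphi\,d\mu=\int_E\varphi^*\,d\mu=1$; set $M=\int_E\varphi\varphi^*\,d\mu$. *)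

theory Defs
  imports "HOL-Probability.Probability"
begin

text \<open>Setting. The state space is a type 'h of class real_inner + complete_space +
second_countable_topology, i.e. a separable real Hilbert space. A process is given by
a path space measurable space (Omega, S), a family of probability measures P x on it
(the laws P_x), and the coordinate map Z :: real => 'w => 'h (time t >= 0).\<close>

definition nat_filtration :: "'w set \<Rightarrow> (real \<Rightarrow> 'w \<Rightarrow> 'h::topological_space) \<Rightarrow> real \<Rightarrow> 'w measure" where
  "nat_filtration \<Omega> Z s = sigma \<Omega> {Z r -` B \<inter> \<Omega> | r B. 0 \<le> r \<and> r \<le> s \<and> B \<in> sets borel}"

definition markov_sg :: "('h \<Rightarrow> 'w measure) \<Rightarrow> (real \<Rightarrow> 'w \<Rightarrow> 'h) \<Rightarrow> real \<Rightarrow> ('h \<Rightarrow> real) \<Rightarrow> 'h \<Rightarrow> real" where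
  "markov_sg P Z t f x = (\<integral>\<omega>. f (Z t \<omega>) \<partial>P x)"

definition cont_markov_process ::
  "'w set \<Rightarrow> 'w set set \<Rightarrow> ('h::topological_space \<Rightarrow> 'w measure) \<Rightarrow> (real \<Rightarrow> 'w \<Rightarrow> 'h) \<Rightarrow> bool" where
  "cont_markov_process \<Omega> S P Z \<longleftrightarrow>
     (\<forall>x. prob_space (P x) \<and> space (P x) = \<Omega> \<and> sets (P x) = S) \<and>
     (\<forall>t\<ge>0. \<forall>x. Z t \<in> measurable (P x) borel) \<and>
     (\<forall>\<omega>\<in>\<Omega>. continuous_on {0..} (\<lambda>t. Z t \<omega>)) \<and>
     (\<forall>x. AE \<omega> in P x. Z 0 \<omega> = x) \<and>
     (\<forall>A\<in>S. (\<lambda>x. emeasure (P x) A) \<in> borel_measurable borel) \<and>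
     (\<forall>x s t f. 0 \<le> s \<longrightarrow> 0 \<le> t \<longrightarrow> f \<in> borel_measurable borel \<longrightarrow> bounded (range f) \<longrightarrow>
        (AE \<omega> in P x. real_cond_exp (P x) (nat_filtration \<Omega> Z s) (\<lambda>\<omega>. f (Z (s + t) \<omega>)) \<omega>
                       = markov_sg P Z t f (Z s \<omega>)))"

definition invariant_prob :: "('h::topological_space \<Rightarrow> 'w measure) \<Rightarrow> (real \<Rightarrow> 'w \<Rightarrow> 'h) \<Rightarrow> 'h measure \<Rightarrow> bool" where
  "invariant_prob P Z \<mu> \<longleftrightarrow> prob_space \<mu> \<and> sets \<mu> = sets borel \<and>
     (\<forall>t\<ge>0. \<forall>f. f \<in> borel_measurable borel \<longrightarrow> bounded (range f) \<longrightarrow>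
        (\<integral>x. markov_sg P Z t f x \<partial>\<mu>) = (\<integral>x. f x \<partial>\<mu>))"

text \<open>(Compact): for every t > 0, P_t extends to a compact operator on L^2(mu). Written out:
the image under P_t of any sequence of bounded measurable functions in the unit ball of
L^2(mu) (a dense subset of the unit ball) has an L^2(mu)-Cauchy subsequence.\<close>
definition compact_on_L2 :: "('h::topological_space \<Rightarrow> 'w measure) \<Rightarrow> (real \<Rightarrow> 'w \<Rightarrow> 'h) \<Rightarrow> 'h measure \<Rightarrow> bool" where
  "compact_on_L2 P Z \<mu> \<longleftrightarrow>
     (\<forall>t>0. \<forall>f.
        (\<forall>n. f n \<in> borel_measurable borel \<and> bounded (range (f n)) \<and>
             (\<integral>\<^sup>+x. ennreal ((f n x)\<^sup>2) \<partial>\<mu>) \<le> 1) \<longrightarrow>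
        (\<exists>r::nat \<Rightarrow> nat. strict_mono r \<and>
           (\<forall>e>0. \<exists>N. \<forall>m\<ge>N. \<forall>n\<ge>N.
              (\<integral>\<^sup>+x. ennreal ((markov_sg P Z t (f (r m)) x - markov_sg P Z t (f (r n)) x)\<^sup>2) \<partial>\<mu>)
                < ennreal e)))"

definition irreducible_proc :: "('h::topological_space \<Rightarrow> 'w measure) \<Rightarrow> (real \<Rightarrow> 'w \<Rightarrow> 'h) \<Rightarrow> 'h measure \<Rightarrow> bool" where
  "irreducible_proc P Z \<mu> \<longleftrightarrow>
     (\<forall>x t F. t > 0 \<longrightarrow> F \<in> sets borel \<longrightarrow> measure \<mu> F > 0 \<longrightarrow>
        markov_sg P Z t (indicator F) x > 0)"

definition measure_support :: "'h::metric_space measure \<Rightarrow> 'h set" where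
  "measure_support \<mu> = {x. \<forall>r>0. emeasure \<mu> (ball x r) > 0}"

definition exit_time :: "(real \<Rightarrow> 'w \<Rightarrow> 'h) \<Rightarrow> 'h set \<Rightarrow> 'w \<Rightarrow> ereal" where
  "exit_time Z E \<omega> = (INF t\<in>{t. 0 < t \<and> Z t \<omega> \<notin> E}. ereal t)"

definition killed_sg :: "('h \<Rightarrow> 'w measure) \<Rightarrow> (real \<Rightarrow> 'w \<Rightarrow> 'h) \<Rightarrow> 'h set \<Rightarrow> real \<Rightarrow> ('h \<Rightarrow> real) \<Rightarrow> 'h \<Rightarrow> real" where
  "killed_sg P Z E t f x = (\<integral>\<omega>. f (Z t \<omega>) * indicator {\<omega>. ereal t < exit_time Z E \<omega>} \<omega> \<partial>P x)"

text \<open>Conditional expectation E_x[f(Z_t) | t < tau] = Q_t f(x) / Q_t 1(x).\<close>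
definition cond_surv :: "('h \<Rightarrow> 'w measure) \<Rightarrow> (real \<Rightarrow> 'w \<Rightarrow> 'h) \<Rightarrow> 'h set \<Rightarrow> real \<Rightarrow> ('h \<Rightarrow> real) \<Rightarrow> 'h \<Rightarrow> real" where
  "cond_surv P Z E t f x = killed_sg P Z E t f x / killed_sg P Z E t (\<lambda>_. 1) x"

definition killing_cond :: "('h \<Rightarrow> 'w measure) \<Rightarrow> (real \<Rightarrow> 'w \<Rightarrow> 'h) \<Rightarrow> 'h set \<Rightarrow> bool" where
  "killing_cond P Z E \<longleftrightarrow>
     (\<forall>x\<in>E. measure (P x) {\<omega>\<in>space (P x). exit_time Z E \<omega> < \<infinity>} = 1 \<and>
            (\<forall>t>0. measure (P x) {\<omega>\<in>space (P x). ereal t < exit_time Z E \<omega>} > 0))"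

definition in_L2 :: "'h::topological_space measure \<Rightarrow> 'h set \<Rightarrow> ('h \<Rightarrow> real) \<Rightarrow> bool" where
  "in_L2 \<mu> E f \<longleftrightarrow> f \<in> borel_measurable borel \<and> (\<integral>\<^sup>+x. indicator E x * ennreal ((f x)\<^sup>2) \<partial>\<mu>) < \<infinity>"

end

theory Submission
  imports Defs "HOL-Real_Asymp.Real_Asymp"
begin

text \<open>
  Write b for the rescaled survival probability exp (lam1 t) Q_t 1, which tends to phi / M in L2.
  Where b is at least phi / (2 M), dividing by b is harmless and the spectral gap gives the rate.
  On the remaining set B_t one has to control z = (phi - 2 M b)^+ against the conditional
  expectation of abs f + abs c, although f and phi are merely square integrable.

  Since phi = exp (lam1) Q_1 phi and b_{t+1} \<ge> exp (lam1) Q_1 b_t, the function z_{t+1} is at most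
  exp (lam1) Q_1 z_t on B_{t+1} and vanishes elsewhere. The measure of B_t tends to 0 and P_1 is
  compact, so the norm of the indicator of B_{t+1} times P_1 tends to 0: thus z decays in L2
  faster than any exponential. This beats the crude bounds, with factors of the form
  exp (C t), that invariance of mu and the Cauchy-Schwarz inequality give for the conditional
  expectations of z and abs f + abs c.

  The inequality Q_1 (Q_t 1) \<le> Q_{t+1} 1 needs care: E is only a Borel set, so survival up to
  time t is not an event of the sigma algebra generated by the process. By Choquet capacitability the
  probability of hitting the complement of E is the supremum of those of hitting closed subsets,
  and for these the Markov property applies.
\<close>

section \<open>Analytic sets and hitting events\<close>

text \<open>The obstacle is the division by q = Q_t 1, for which no useful lower bound at a point is
  known. On the bad set the product of z with T = Q_t (abs f + abs c) / q must be integrated, but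
  the Cauchy-Schwarz inequality controls T^2 only with the weight q: q T^2 is at most Q_t ((abs f +
  abs c)^2), whose integral is bounded by invariance. So z has to be compared with q. The
  eigenfunction equation, used a second time over the whole interval of length t, gives phi <= e (K
  e q + Q_t z) with e = exp (lam1 t) and K = 2 M. Hence z is at most K e^2 q plus e Q_t z: the first
  part carries the weight q, and in the second Q_t z brings its own factor sqrt q by Cauchy-Schwarz.
  On the bad set the losses are powers of e and of G = exp (gamma t) that multiply integrals of z^2,
  which is why z must decay faster than a prescribed exponential. The factor 2 in K leaves a margin:
  where b < phi / (2 M), b differs from its limit phi / M by more than phi / (2 M), so Chebyshev's
  inequality applies.\<close>

text \<open>Each point of the set comes with a code in the Baire space
  \<open>nat \<Rightarrow> nat\<close>. Codes are what capacitability needs: their coordinates can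
  be bounded one after the other at little cost, and bounding all of them gives compactness.\<close>

definition analytic_set :: "'a::topological_space set \<Rightarrow> bool" where
  "analytic_set A \<longleftrightarrow> (\<exists>C::('a \<times> (nat \<Rightarrow> nat)) set. closed C \<and> A = fst ` C)"

lemma analytic_set_closed:
  assumes "closed A" shows "analytic_set A"
  unfolding analytic_set_def
  by (rule exI[of _ "A \<times> UNIV"]) (auto intro: closed_Times assms)

text \<open>The entry \<open>s 0\<close> of a code names one of the sets, and the tail of the code
  witnesses membership in it. Written as an intersection over \<open>n\<close> of implications,
  \<open>D\<close> is closed because \<open>s 0\<close> takes values in a discrete space.\<close>

lemma analytic_set_UN:
  fixes A :: "nat \<Rightarrow> 'a::topological_space set"
  assumes "\<And>n. analytic_set (A n)" shows "analytic_set (\<Union>n. A n)"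
proof -
  obtain C :: "nat \<Rightarrow> ('a \<times> (nat \<Rightarrow> nat)) set" where C: "\<And>n. closed (C n)" "\<And>n. A n = fst ` C n"
    using assms unfolding analytic_set_def by metis
  define D where "D = (\<Inter>n. {p::'a \<times> (nat \<Rightarrow> nat). snd p 0 \<noteq> n} \<union> {p. (fst p, \<lambda>i. snd p (Suc i)) \<in> C n})"
  have *: "closed {p::'a \<times> (nat \<Rightarrow> nat). snd p 0 \<noteq> n}" for n
  proof -
    have "continuous_on UNIV (\<lambda>p::'a \<times> (nat \<Rightarrow> nat). snd p 0)"
      by (rule continuous_on_product_then_coordinatewise) (intro continuous_intros)
    then have "closed ((\<lambda>p::'a \<times> (nat \<Rightarrow> nat). snd p 0) -` (-{n}))"
      by (rule closed_vimage[rotated]) (unfold closed_def, rule discrete_topology_class.open_discrete)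
    then show ?thesis by (simp add: vimage_def)
  qed
  have **: "closed {p::'a \<times> (nat \<Rightarrow> nat). (fst p, \<lambda>i. snd p (Suc i)) \<in> C n}" for n
  proof -
    have "continuous_on UNIV (\<lambda>p::'a \<times> (nat \<Rightarrow> nat). (fst p, \<lambda>i. snd p (Suc i)))"
      by (intro continuous_intros continuous_on_coordinatewise_then_product 
            continuous_on_product_then_coordinatewise[where f=snd])
    from closed_vimage[OF C(1) this] show ?thesis by (simp add: vimage_def)
  qed
  have "closed D" unfolding D_def by (intro closed_INT ballI closed_Un * **)
  moreover have "(\<Union>n. A n) = fst ` D"
  proof safe
    fix x n assume "x \<in> A n"
    then obtain s where "(x, s) \<in> C n" using C(2) by auto
    then have "(x, case_nat n s) \<in> D" by (auto simp: D_def)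
    then show "x \<in> fst ` D" by force
  next
    fix x s assume "(x, s) \<in> D"
    then have "(x, \<lambda>i. s (Suc i)) \<in> C (s 0)" by (auto simp: D_def)
    then have "x \<in> A (s 0)" using C(2)[of "s 0"] by force
    then show "fst (x, s) \<in> (\<Union>n. A n)" by auto
  qed
  ultimately show ?thesis unfolding analytic_set_def by blast
qed

text \<open>Here one code must carry witnesses for all \<open>A n\<close> at once;
  \<open>prod_encode\<close> interleaves countably many sequences, the one for \<open>A n\<close>
  being read off at the positions \<open>prod_encode (n, i)\<close>.\<close>

lemma analytic_set_INT:
  fixes A :: "nat \<Rightarrow> 'a::topological_space set"
  assumes "\<And>n. analytic_set (A n)" shows "analytic_set (\<Inter>n. A n)"
proof -
  obtain C :: "nat \<Rightarrow> ('a \<times> (nat \<Rightarrow> nat)) set" where C: "\<And>n. closed (C n)" "\<And>n. A n = fst ` C n"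
    using assms unfolding analytic_set_def by metis
  define D where "D = (\<Inter>n. {p::'a \<times> (nat \<Rightarrow> nat). (fst p, \<lambda>i. snd p (prod_encode (n, i))) \<in> C n})"
  have *: "closed {p::'a \<times> (nat \<Rightarrow> nat). (fst p, \<lambda>i. snd p (prod_encode (n, i))) \<in> C n}" for n
  proof -
    have "continuous_on UNIV (\<lambda>p::'a \<times> (nat \<Rightarrow> nat). (fst p, \<lambda>i. snd p (prod_encode (n, i))))"
      by (intro continuous_intros continuous_on_coordinatewise_then_product 
            continuous_on_product_then_coordinatewise[where f=snd])
    from closed_vimage[OF C(1) this] show ?thesis by (simp add: vimage_def)
  qed
  have "closed D" unfolding D_def by (intro closed_INT ballI *)
  moreover have "(\<Inter>n. A n) = fst ` D"
  proof (intro equalityI subsetI)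
    fix x assume "x \<in> (\<Inter>n. A n)"
    then have "\<forall>n. \<exists>s. (x, s) \<in> C n" using C(2) by force
    then obtain s where s: "\<And>n. (x, s n) \<in> C n" by metis
    then have "(x, \<lambda>k. s (fst (prod_decode k)) (snd (prod_decode k))) \<in> D" by (auto simp: D_def)
    then show "x \<in> fst ` D" by force
  next
    fix x assume "x \<in> fst ` D"
    then obtain s where "(x, s) \<in> D" by auto
    then have "(x, \<lambda>i. s (prod_encode (n, i))) \<in> C n" for n by (auto simp: D_def)
    then show "x \<in> (\<Inter>n. A n)" using C(2) by force
  qed
  ultimately show ?thesis unfolding analytic_set_def by blast
qed

text \<open>An open set is the countable union of the closed sets of points at distance at least
  \<open>1 / real (Suc n)\<close> from its complement. The whole space is treated apart because
  \<open>infdist\<close> to the empty set is 0 by convention.\<close>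

lemma analytic_set_open:
  fixes U :: "'a::metric_space set"
  assumes "open U" shows "analytic_set U"
proof (cases "U = UNIV")
  case True then show ?thesis by (simp add: analytic_set_closed)
next
  case False
  have "U = (\<Union>n. {x. infdist x (-U) \<ge> 1 / real (Suc n)})"
  proof safe
    fix x assume "x \<in> U"
    then have "infdist x (-U) > 0"
      using False assms infdist_pos_not_in_closed[of "-U" x] by auto
    then obtain n where "1 / real (Suc n) < infdist x (-U)"
      using nat_approx_posE by blast
    then show "x \<in> (\<Union>n. {x. infdist x (-U) \<ge> 1 / real (Suc n)})" by (auto intro!: exI[of _ n] less_imp_le)
  next
    fix x n assume *: "1 / real (Suc n) \<le> infdist x (-U)"
    show "x \<in> U"
    proof (rule ccontr)
      assume "x \<notin> U"
      then have "infdist x (-U) = 0" by simp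
      then show False using * by simp
    qed
  qed
  also have "analytic_set \<dots>"
    by (intro analytic_set_UN analytic_set_closed closed_Collect_le continuous_intros)
  finally show ?thesis .
qed

text \<open>Analytic sets need not have analytic complements, so the induction over Borel sets
  carries a set and its complement together; the case of a union then calls for one union and one
  intersection.\<close>

lemma analytic_set_borel:
  fixes A :: "'a::metric_space set"
  assumes "A \<in> sets borel" shows "analytic_set A"
proof -
  have "A \<in> sigma_sets UNIV {S. open S}" using assms by (simp add: borel_def)
  then have "analytic_set A \<and> analytic_set (- A)"
  proof induction
    case (Union a)
    have "- (\<Union>i. a i) = (\<Inter>i. - a i)" by auto
    then show ?case using Union analytic_set_UN[of a] analytic_set_INT[of "\<lambda>i. - a i"] by auto
  qed (auto intro: analytic_set_open analytic_set_closed simp: Compl_eq_Diff_UNIV[symmetric])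
  then show ?thesis ..
qed

section \<open>Compactness of bounded codes\<close>

lemma compact_bounded_sequences: "compact {s::nat \<Rightarrow> nat. \<forall>i. s i \<le> u i}"
proof -
  have "compactin (product_topology (\<lambda>i. euclidean) UNIV) (PiE UNIV (\<lambda>i. {..u i}))"
    by (subst compactin_PiE) (auto intro: finite_imp_compact)
  moreover have "PiE UNIV (\<lambda>i. {..u i}) = {s. \<forall>i. s i \<le> u i}" by (auto simp: PiE_def Pi_def)
  ultimately show ?thesis by (simp add: euclidean_product_topology)
qed

lemma tendsto_fun_iff:
  "(f \<longlongrightarrow> l) F \<longleftrightarrow> (\<forall>i. ((\<lambda>n. f n i) \<longlongrightarrow> l i) F)"
  using limitin_componentwise[of "\<lambda>_. euclidean" UNIV f l F]
  by (simp add: euclidean_product_topology)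

text \<open>Taking closures adds nothing in the limit: a point of the intersection is approached by
  points of \<open>C\<close> whose codes are, coordinate by coordinate, eventually bounded by
  \<open>u\<close>; a subsequence of the codes converges, and \<open>C\<close> is closed.\<close>

lemma INT_closure_bounded_projections_subset:
  fixes C :: "('a::metric_space \<times> (nat \<Rightarrow> nat)) set"
  assumes "closed C"
  shows "(\<Inter>n. closure (fst ` {p\<in>C. \<forall>i<n. snd p i \<le> u i})) \<subseteq> fst ` C"
proof
  fix x assume x: "x \<in> (\<Inter>n. closure (fst ` {p\<in>C. \<forall>i<n. snd p i \<le> u i}))"
  have "\<exists>p. p \<in> C \<and> (\<forall>i<n. snd p i \<le> u i) \<and> dist (fst p) x < 1 / Suc n" for n
  proof -
    have "x \<in> closure (fst ` {p\<in>C. \<forall>i<n. snd p i \<le> u i})" using x by blast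
    then obtain y where "y \<in> fst ` {p\<in>C. \<forall>i<n. snd p i \<le> u i}" "dist y x < 1 / Suc n"
      unfolding closure_approachable by (meson of_nat_0_less_iff zero_less_Suc zero_less_divide_1_iff)
    then show ?thesis by blast
  qed
  then obtain p where p: "\<And>n. p n \<in> C" "\<And>n i. i < n \<Longrightarrow> snd (p n) i \<le> u i" "\<And>n. dist (fst (p n)) x < 1 / Suc n"
    by metis
  \<comment> \<open>The code of \<open>p n\<close> is bounded by \<open>u\<close> below index
    \<open>n\<close> only. Truncation puts it into the compact box and leaves coordinate
    \<open>i\<close> unchanged for all \<open>n > i\<close>, so the limit is not affected.\<close>
  define s where "s n i = min (snd (p n) i) (u i)" for n i
  have "seq_compact {s::nat \<Rightarrow> nat. \<forall>i. s i \<le> u i}"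
    by (rule compact_imp_seq_compact[OF compact_bounded_sequences])
  moreover have "\<forall>n. s n \<in> {s. \<forall>i. s i \<le> u i}" by (auto simp: s_def)
  ultimately obtain l r where lr: "strict_mono (r::nat\<Rightarrow>nat)" "(s \<circ> r) \<longlonglongrightarrow> l"
    unfolding seq_compact_def by meson
  have "(\<lambda>n. snd (p (r n))) \<longlonglongrightarrow> l"
    unfolding tendsto_fun_iff
  proof
    fix i
    have "(\<lambda>n. s (r n) i) \<longlonglongrightarrow> l i"
      using lr(2) by (simp add: tendsto_fun_iff o_def)
    moreover have "\<forall>\<^sub>F n in sequentially. s (r n) i = snd (p (r n)) i"
      using eventually_gt_at_top[of i]
    proof eventually_elim
      case (elim n)
      then have "i < r n" using seq_suble[OF lr(1), of n] by linarith
      then show ?case using p(2) by (simp add: s_def min_absorb1)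
    qed
    ultimately show "(\<lambda>n. snd (p (r n)) i) \<longlonglongrightarrow> l i" by (rule Lim_transform_eventually)
  qed
  moreover have "(\<lambda>n. fst (p (r n))) \<longlonglongrightarrow> x"
  proof -
    have "(\<lambda>n. fst (p n)) \<longlonglongrightarrow> x"
    proof (rule metric_LIMSEQ_I)
      fix e :: real assume "e > 0"
      then obtain N where N: "1 / real (Suc N) < e" using nat_approx_posE by blast
      show "\<exists>no. \<forall>n\<ge>no. dist (fst (p n)) x < e"
      proof (intro exI allI impI)
        fix n assume "N \<le> n"
        then have "1 / real (Suc n) \<le> 1 / real (Suc N)" by (simp add: frac_le)
        then show "dist (fst (p n)) x < e" using p(3)[of n] N by linarith
      qed
    qed
    from LIMSEQ_subseq_LIMSEQ[OF this lr(1)] show ?thesis by (simp add: o_def)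
  qed
  ultimately have "(\<lambda>n. (fst (p (r n)), snd (p (r n)))) \<longlonglongrightarrow> (x, l)" by (intro tendsto_Pair)
  then have "(x, l) \<in> C" using closed_sequentially[OF assms, of "\<lambda>n. p (r n)" "(x, l)"] p(1) by simp
  then show "x \<in> fst ` C" by force
qed

section \<open>Hitting events of continuous paths\<close>

text \<open>Reduces uncountably many times to rational ones: a continuous path on a compact interval
  that avoids a closed set keeps a positive distance from it, and a lower bound on a dense set of
  times extends by continuity. \<open>F \<noteq> {}\<close> guards against the value 0 of
  \<open>infdist\<close> for the empty set; \<open>a < b\<close> makes the rationals dense in the
  interval.\<close>

lemma avoids_closed_iff:
  fixes w :: "real \<Rightarrow> 'h::metric_space"
  assumes cont: "continuous_on {a..b} w" and F: "closed F" "F \<noteq> {}" and ab: "a < b"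
  shows "(\<forall>r\<in>{a..b}. w r \<notin> F) \<longleftrightarrow> (\<exists>k. \<forall>r\<in>\<rat> \<inter> {a..b}. 1 / real (Suc k) \<le> infdist (w r) F)"
proof -
  let ?g = "\<lambda>r. infdist (w r) F"
  have g: "continuous_on {a..b} ?g" by (intro continuous_intros cont)
  show ?thesis
  proof
    assume no: "\<forall>r\<in>{a..b}. w r \<notin> F"
    obtain m where m: "m \<in> {a..b}" "\<forall>r\<in>{a..b}. ?g m \<le> ?g r"
      using continuous_attains_inf[OF compact_Icc _ g] ab by auto
    have "?g m > 0" using no m(1) F by (intro infdist_pos_not_in_closed) auto
    then obtain k where k: "1 / real (Suc k) < ?g m" using nat_approx_posE by blast
    have "1 / real (Suc k) \<le> ?g r" if "r \<in> \<rat> \<inter> {a..b}" for r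
      using m(2) that k by (meson IntD2 less_imp_le order_trans)
    then show "\<exists>k. \<forall>r\<in>\<rat> \<inter> {a..b}. 1 / real (Suc k) \<le> ?g r" by blast
  next
    assume "\<exists>k. \<forall>r\<in>\<rat> \<inter> {a..b}. 1 / real (Suc k) \<le> ?g r"
    then obtain k where k: "\<forall>r\<in>\<rat> \<inter> {a..b}. 1 / real (Suc k) \<le> ?g r" ..
    show "\<forall>r\<in>{a..b}. w r \<notin> F"
    proof
      fix r assume r: "r \<in> {a..b}"
      show "w r \<notin> F"
      proof
        assume "w r \<in> F"
        then have g0: "?g r = 0" by simp
        have "\<exists>d>0. \<forall>s\<in>{a..b}. dist s r < d \<longrightarrow> dist (?g s) (?g r) < 1 / real (Suc k)"
          using g[unfolded continuous_on_iff, rule_format, OF r, of "1 / real (Suc k)"] by simp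
        then obtain d where d: "d > 0" "\<And>s. s \<in> {a..b} \<Longrightarrow> dist s r < d \<Longrightarrow> dist (?g s) (?g r) < 1 / real (Suc k)"
          by blast
        have "max a (r - d) < min b (r + d)" using r d(1) ab by auto
        then obtain q where q: "q \<in> \<rat>" "max a (r - d) < q" "q < min b (r + d)"
          using Rats_dense_in_real by blast
        have "dist (?g q) (?g r) < 1 / real (Suc k)"
          using q by (intro d(2)) (auto simp: dist_real_def)
        then have "?g q < 1 / real (Suc k)" using g0 by (simp add: dist_real_def)
        moreover have "q \<in> \<rat> \<inter> {a..b}" using q by auto
        ultimately show False using k by (meson not_le)
      qed
    qed
  qed
qed

lemma hit_closed_measurable:
  fixes X :: "real \<Rightarrow> 'w \<Rightarrow> 'h::metric_space"
  assumes X: "\<And>r. r \<in> {a..b} \<Longrightarrow> X r \<in> borel_measurable M"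
    and cont: "\<And>\<omega>. \<omega> \<in> space M \<Longrightarrow> continuous_on {a..b} (\<lambda>r. X r \<omega>)"
    and F: "closed F" and ab: "a < b"
  shows "{\<omega>\<in>space M. \<exists>r\<in>{a..b}. X r \<omega> \<in> F} \<in> sets M"
proof (cases "F = {}")
  case False
  have "{\<omega>\<in>space M. \<exists>r\<in>{a..b}. X r \<omega> \<in> F}
      = space M - (\<Union>k. space M \<inter> (\<Inter>r\<in>\<rat> \<inter> {a..b}. {\<omega>\<in>space M. 1 / real (Suc k) \<le> infdist (X r \<omega>) F}))"
    (is "?L = ?R")
  proof (intro set_eqI)
    fix \<omega>
    show "\<omega> \<in> ?L \<longleftrightarrow> \<omega> \<in> ?R"
    proof (cases "\<omega> \<in> space M")
      case True
      then show ?thesis using avoids_closed_iff[OF cont[OF True] F False ab] by auto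
    qed auto
  qed
  also have "\<dots> \<in> sets M"
  proof (intro sets.Diff sets.top sets.countable_UN sets.Int image_subsetI)
    fix k
    have "countable (\<rat> \<inter> {a..b})" by (intro countable_Int1 countable_rat)
    moreover have "{\<omega>\<in>space M. 1 / real (Suc k) \<le> infdist (X r \<omega>) F} \<in> sets M" if "r \<in> \<rat> \<inter> {a..b}" for r
    proof -
      have "(\<lambda>x. infdist x F) \<in> borel_measurable borel"
        by (intro borel_measurable_continuous_onI continuous_intros)
      from measurable_compose[OF X this] that 
      have [measurable]: "(\<lambda>\<omega>. infdist (X r \<omega>) F) \<in> borel_measurable M" by auto
      show ?thesis by measurable
    qed
    moreover have "\<rat> \<inter> {a..b} \<noteq> {}"
      using Rats_dense_in_real[OF ab] by (auto simp: less_imp_le)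
    ultimately show "(\<Inter>r\<in>\<rat> \<inter> {a..b}. {\<omega>\<in>space M. 1 / real (Suc k) \<le> infdist (X r \<omega>) F}) \<in> sets M"
      by (intro sets.countable_INT') auto
  qed
  finally show ?thesis .
qed simp

text \<open>Choquet's capacitability argument for the capacity sending a set to the outer probability
  that the path hits it. Compactness of the time window, rather than of the sets, makes this
  capacity continuous along decreasing sequences of closed sets.\<close>

lemma hit_capacitable:
  fixes X :: "real \<Rightarrow> 'w \<Rightarrow> 'h::metric_space"
  assumes M: "finite_measure M"
    and X: "\<And>r. 0 \<le> r \<Longrightarrow> X r \<in> borel_measurable M"
    and cont: "\<And>\<omega>. \<omega> \<in> space M \<Longrightarrow> continuous_on {0..} (\<lambda>r. X r \<omega>)"
    and A: "A \<in> sets borel" and u: "0 < u"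
    and c: "c < outer_measure_of M {\<omega>\<in>space M. \<exists>r\<in>{0<..<u}. X r \<omega> \<in> A}"
  obtains F a b where "closed F" "F \<subseteq> A" "0 < a" "a < b" "b < u"
    "c \<le> emeasure M {\<omega>\<in>space M. \<exists>r\<in>{a..b}. X r \<omega> \<in> F}"
proof -
  interpret finite_measure M by fact
  obtain C :: "('h \<times> (nat \<Rightarrow> nat)) set" where C: "closed C" "A = fst ` C"
    using analytic_set_borel[OF A] unfolding analytic_set_def by blast
  define hit where "hit J B = {\<omega>\<in>space M. \<exists>r\<in>J. X r \<omega> \<in> B}" for J B
  have hit_mono: "J \<subseteq> J' \<Longrightarrow> B \<subseteq> B' \<Longrightarrow> hit J B \<subseteq> hit J' B'" for J J' B B'
    unfolding hit_def by blast
  \<comment> \<open>Compact intervals exhausting the open time window. The offset 3 keeps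
    \<open>u / (real n + 3)\<close> at most \<open>u / 3\<close>, so that even \<open>J 0\<close> is
    a nondegenerate interval.\<close>
  define J where "J n = {u / (real n + 3)..u - u / (real n + 3)}" for n
  have incJ: "incseq (\<lambda>n. hit (J n) A)"
  proof (intro incseq_SucI hit_mono order_refl)
    fix n
    have "u / (real (Suc n) + 3) \<le> u / (real n + 3)" using u by (intro divide_left_mono) auto
    then show "J n \<subseteq> J (Suc n)" unfolding J_def by auto
  qed
  have UJ: "(\<Union>n. J n) = {0<..<u}"
  proof (intro equalityI subsetI)
    fix r assume "r \<in> (\<Union>n. J n)"
    then obtain n where "u / (real n + 3) \<le> r" "r \<le> u - u / (real n + 3)" by (auto simp: J_def)
    moreover have "0 < u / (real n + 3)" using u by simp
    ultimately show "r \<in> {0<..<u}" by auto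
  next
    fix r assume r: "r \<in> {0<..<u}"
    then have "0 < min r (u - r) / u" using u by auto
    then obtain n where n: "1 / real (Suc n) < min r (u - r) / u" using nat_approx_posE by blast
    have "u / (real n + 3) \<le> u / real (Suc n)" using u by (intro divide_left_mono) auto
    also have "\<dots> < min r (u - r)" using n u by (simp add: field_simps)
    finally show "r \<in> (\<Union>n. J n)" by (auto simp: J_def intro!: exI[of _ n])
  qed
  \<comment> \<open>Hitting events of the sets met here need not be measurable. The outer measure is
    still continuous along increasing sequences of arbitrary sets.\<close>
  have "(SUP n. outer_measure_of M (hit (J n) A)) = outer_measure_of M (\<Union>n. hit (J n) A)"
    using incJ by (intro SUP_outer_measure_of_incseq) (auto simp: hit_def)
  moreover have "(\<Union>n. hit (J n) A) = hit (\<Union>n. J n) A" by (auto simp: hit_def)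
  moreover have "c < outer_measure_of M (hit (\<Union>n. J n) A)" using c by (simp only: UJ hit_def)
  ultimately have "c < (SUP n. outer_measure_of M (hit (J n) A))" by simp
  then obtain n0 where n0: "c < outer_measure_of M (hit (J n0) A)"
    by (auto simp: less_SUP_iff)
  define a b where "a = u / (real n0 + 3)" and "b = u - u / (real n0 + 3)"
  have "0 < a" unfolding a_def using u by simp
  moreover have "a \<le> u / 3" unfolding a_def using u by (intro divide_left_mono) auto
  ultimately have ab: "0 < a" "a < b" "b < u" unfolding b_def a_def[symmetric] using u by auto
  have J0: "J n0 = {a..b}" by (simp add: J_def a_def b_def)
  let ?h = "hit {a..b}"
  have mh: "?h B \<in> sets M" if "closed B" for B
    unfolding hit_def
  proof (rule hit_closed_measurable[OF _ _ that ab(2)])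
    show "X r \<in> borel_measurable M" if "r \<in> {a..b}" for r using X that ab by auto
    show "continuous_on {a..b} (\<lambda>r. X r \<omega>)" if "\<omega> \<in> space M" for \<omega>
      by (rule continuous_on_subset[OF cont[OF that]]) (use ab in auto)
  qed
  define pr where "pr n v = fst ` {p\<in>C. \<forall>i<n. snd p i \<le> v i}" for n and v :: "nat \<Rightarrow> nat"
  have pr_dec: "pr (Suc n) v \<subseteq> pr n v" for n v unfolding pr_def by (intro image_mono) auto
  \<comment> \<open>Letting the bound on coordinate \<open>n\<close> grow exhausts
    \<open>pr n v\<close>, so some finite bound already keeps the outer measure above
    \<open>c\<close>.\<close>
  have step: "\<exists>v'. c < outer_measure_of M (?h (pr (Suc n) v')) \<and> (\<forall>i<n. v' i = v i)"
    if "c < outer_measure_of M (?h (pr n v))" for n v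
  proof -
    have 1: "(\<Union>m. ?h (pr (Suc n) (v(n := m)))) = ?h (pr n v)"
    proof -
      have "(\<Union>m. pr (Suc n) (v(n := m))) = pr n v"
      proof (intro equalityI subsetI)
        fix x assume "x \<in> pr n v"
        then obtain p where p: "p \<in> C" "\<forall>i<n. snd p i \<le> v i" "x = fst p" by (auto simp: pr_def)
        then have "x \<in> pr (Suc n) (v(n := snd p n))" by (auto simp: pr_def less_Suc_eq)
        then show "x \<in> (\<Union>m. pr (Suc n) (v(n := m)))" by blast
      next
        fix x assume "x \<in> (\<Union>m. pr (Suc n) (v(n := m)))"
        then obtain m p where p: "p \<in> C" "\<forall>i<Suc n. snd p i \<le> (v(n := m)) i" "x = fst p" by (auto simp: pr_def)
        then have "\<forall>i<n. snd p i \<le> v i" by (auto simp: less_Suc_eq fun_upd_def split: if_splits)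
        then show "x \<in> pr n v" using p unfolding pr_def by blast
      qed
      moreover have "(\<Union>m. ?h (B m)) = ?h (\<Union>m. B m)" for B :: "nat \<Rightarrow> 'h set"
        unfolding hit_def by auto
      ultimately show ?thesis by simp
    qed
    have "incseq (\<lambda>m. ?h (pr (Suc n) (v(n := m))))"
      unfolding pr_def by (intro incseq_SucI hit_mono order_refl image_mono) (auto simp: less_Suc_eq)
    then have "(SUP m. outer_measure_of M (?h (pr (Suc n) (v(n := m))))) = outer_measure_of M (?h (pr n v))"
      unfolding 1[symmetric] by (intro SUP_outer_measure_of_incseq) (auto simp: hit_def)
    then have "c < (SUP m. outer_measure_of M (?h (pr (Suc n) (v(n := m)))))" using that by simp
    then obtain m where "c < outer_measure_of M (?h (pr (Suc n) (v(n := m))))"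
      by (auto simp: less_SUP_iff)
    then show ?thesis by (intro exI[of _ "v(n := m)"]) auto
  qed
  have base: "c < outer_measure_of M (?h (pr 0 (\<lambda>_. 0)))"
    using n0 C(2) by (simp add: J0 pr_def)
  have "\<exists>v. \<forall>n. c < outer_measure_of M (?h (pr n (v n))) \<and> (\<forall>i<n. v (Suc n) i = v n i)"
  proof (rule dependent_nat_choice[where P="\<lambda>n x. c < outer_measure_of M (?h (pr n x))"
        and Q="\<lambda>n x y. \<forall>i<n. y i = x i"])
    show "\<exists>x. c < outer_measure_of M (?h (pr 0 x))" using base by blast
  qed (rule step)
  then obtain v where v_all: "\<forall>n. c < outer_measure_of M (?h (pr n (v n))) \<and> (\<forall>i<n. v (Suc n) i = v n i)" ..
  then have v: "\<And>n. c < outer_measure_of M (?h (pr n (v n)))" "\<And>n i. i < n \<Longrightarrow> v (Suc n) i = v n i"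
    by simp_all
  \<comment> \<open>Coordinate \<open>i\<close> is chosen at stage \<open>Suc i\<close> and never
    changed later, so this diagonal agrees with \<open>v n\<close> at all indices below
    \<open>n\<close>.\<close>
  define w where "w i = v (Suc i) i" for i
  have vk: "v (Suc i + k) i = w i" for i k
  proof (induction k)
    case (Suc k)
    have "v (Suc (Suc i + k)) i = v (Suc i + k) i" by (rule v(2)) linarith
    then show ?case using Suc.IH by (metis add_Suc_right)
  qed (simp add: w_def)
  then have vw: "v n i = w i" if "i < n" for n i
  proof -
    from that have "Suc i \<le> n" by simp
    then obtain k where "n = Suc i + k" unfolding le_iff_add ..
    then show ?thesis using vk[of i k] by (simp only:)
  qed
  have "{p\<in>C. \<forall>i<n. snd p i \<le> v n i} = {p\<in>C. \<forall>i<n. snd p i \<le> w i}" for n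
    by (intro Collect_cong conj_cong refl all_cong) (simp only: vw)
  then have pv: "pr n (v n) = pr n w" for n by (simp only: pr_def)
  have w: "c < outer_measure_of M (?h (pr n w))" for n using v(1)[of n] by (simp only: pv)
  define F where "F = (\<Inter>n. closure (pr n w))"
  have "closed F" unfolding F_def by auto
  have FA: "F \<subseteq> A" unfolding F_def pr_def C(2) by (rule INT_closure_bounded_projections_subset[OF C(1)])
  have dec: "decseq (\<lambda>n. closure (pr n w))"
    by (intro decseq_SucI closure_mono pr_dec)
  have hF: "?h F = (\<Inter>n. ?h (closure (pr n w)))"
  proof (intro equalityI subsetI)
    fix \<omega> assume w': "\<omega> \<in> (\<Inter>n. ?h (closure (pr n w)))"
    then have sp: "\<omega> \<in> space M" by (auto simp: hit_def)
    \<comment> \<open>The times at which the path is in the \<open>n\<close>-th closure form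
      nonempty nested compact sets. At a common element the path lies in all closures, that is, in
      \<open>F\<close>.\<close>
    define R where "R n = {r\<in>{a..b}. X r \<omega> \<in> closure (pr n w)}" for n
    have "continuous_on {a..b} (\<lambda>r. X r \<omega>)"
      by (rule continuous_on_subset[OF cont[OF sp]]) (use ab in auto)
    then have "closed ({a..b} \<inter> (\<lambda>r. X r \<omega>) -` closure (pr n w))" for n
      by (intro continuous_closed_preimage) auto
    then have "compact ({a..b} \<inter> ({a..b} \<inter> (\<lambda>r. X r \<omega>) -` closure (pr n w)))" for n
      by (intro compact_Int_closed) auto
    moreover have "{a..b} \<inter> ({a..b} \<inter> (\<lambda>r. X r \<omega>) -` closure (pr n w)) = R n" for n
      by (auto simp: R_def)
    ultimately have "compact (R n)" for n by simp
    moreover have "R n \<noteq> {}" for n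
    proof -
      from w' have "\<omega> \<in> ?h (closure (pr n w))" by (rule INT_E) auto
      then show ?thesis unfolding hit_def R_def by blast
    qed
    moreover have "R n \<subseteq> R m" if "m \<le> n" for m n
      using decseqD[OF dec that] by (auto simp: R_def)
    ultimately have "\<Inter>(range R) \<noteq> {}" by (rule compact_nest)
    then obtain r where r: "\<forall>n. r \<in> R n" by auto
    then have "r \<in> {a..b}" "X r \<omega> \<in> F" unfolding R_def F_def by auto
    then show "\<omega> \<in> ?h F" using sp unfolding hit_def by blast
  next
    fix \<omega> assume "\<omega> \<in> ?h F"
    moreover have "?h F \<subseteq> ?h (closure (pr n w))" for n
      unfolding F_def by (intro hit_mono order_refl INT_lower) auto
    ultimately show "\<omega> \<in> (\<Inter>n. ?h (closure (pr n w)))" by blast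
  qed
  have "c \<le> (INF n. emeasure M (?h (closure (pr n w))))"
  proof (rule INF_greatest)
    fix n
    have "c < outer_measure_of M (?h (pr n w))" by (rule w)
    also have "\<dots> \<le> outer_measure_of M (?h (closure (pr n w)))"
      by (rule outer_measure_of_mono[OF hit_mono[OF order_refl closure_subset]])
    also have "\<dots> = emeasure M (?h (closure (pr n w)))" by (rule outer_measure_of_eq[OF mh[OF closed_closure]])
    finally show "c \<le> emeasure M (?h (closure (pr n w)))" by simp
  qed
  also have "\<dots> = emeasure M (?h F)"
    unfolding hF
  proof (rule INF_emeasure_decseq)
    show "decseq (\<lambda>n. ?h (closure (pr n w)))"
      by (rule decseq_SucI) (rule hit_mono[OF order_refl decseq_SucD[OF dec]])
    show "range (\<lambda>n. ?h (closure (pr n w))) \<subseteq> sets M" by (intro image_subsetI mh closed_closure)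
  qed simp
  finally have "c \<le> emeasure M (?h F)" .
  then show ?thesis unfolding hit_def by (rule that[OF \<open>closed F\<close> FA ab])
qed

section \<open>The Markov property for path events\<close>

text \<open>A pi-system generating the product sigma-algebra on all functions of time, continuous or
  not.\<close>

definition path_cylinders :: "(real \<Rightarrow> 'h::topological_space) set set" where
  "path_cylinders = {{w. \<forall>r\<in>I. w r \<in> B r} | I B. finite I \<and> I \<subseteq> {0..} \<and> (\<forall>r. B r \<in> sets borel)}"

lemma path_cylindersI:
  "finite I \<Longrightarrow> I \<subseteq> {0..} \<Longrightarrow> (\<And>r. B r \<in> sets borel) \<Longrightarrow> {w. \<forall>r\<in>I. w r \<in> B r} \<in> path_cylinders"
  unfolding path_cylinders_def by blast

lemma Int_stable_path_cylinders: "Int_stable path_cylinders"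
proof (rule Int_stableI)
  fix a b :: "(real \<Rightarrow> 'h::topological_space) set" assume "a \<in> path_cylinders" "b \<in> path_cylinders"
  then obtain I B J C where I: "a = {w. \<forall>r\<in>I. w r \<in> B r}" "finite I" "I \<subseteq> {0..}" "\<And>r. B r \<in> sets borel"
    and J: "b = {w. \<forall>r\<in>J. w r \<in> C r}" "finite J" "J \<subseteq> {0..}" "\<And>r. C r \<in> sets borel"
    unfolding path_cylinders_def by blast
  let ?D = "\<lambda>r. (if r \<in> I then B r else UNIV) \<inter> (if r \<in> J then C r else UNIV)"
  have "{w. \<forall>r\<in>I \<union> J. w r \<in> ?D r} \<in> path_cylinders"
    using I J by (intro path_cylindersI) auto
  also have "{w. \<forall>r\<in>I \<union> J. w r \<in> ?D r} = a \<inter> b" unfolding I(1) J(1) by auto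
  finally show "a \<inter> b \<in> path_cylinders" .
qed

lemma path_coordinate_in_sigma:
  assumes "0 \<le> r" "B \<in> sets borel"
  shows "{w. w r \<in> B} \<in> sigma_sets UNIV path_cylinders"
proof -
  have "{w. \<forall>r'\<in>{r}. w r' \<in> B} \<in> path_cylinders" using assms by (intro path_cylindersI) auto
  then show ?thesis by (auto intro: sigma_sets.Basic)
qed

locale markov_process =
  fixes \<Omega> :: "'w set" and S :: "'w set set"
    and P :: "'h::{real_inner, complete_space, second_countable_topology} \<Rightarrow> 'w measure"
    and Z :: "real \<Rightarrow> 'w \<Rightarrow> 'h"
  assumes proc: "cont_markov_process \<Omega> S P Z"
begin

lemma prob_space_P: "prob_space (P x)"
  and space_P [simp]: "space (P x) = \<Omega>"
  and sets_P [simp]: "sets (P x) = S"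
  and Z_measurable: "0 \<le> t \<Longrightarrow> Z t \<in> borel_measurable (P x)"
  and Z_continuous: "\<omega> \<in> \<Omega> \<Longrightarrow> continuous_on {0..} (\<lambda>t. Z t \<omega>)"
  and Z_0: "AE \<omega> in P x. Z 0 \<omega> = x"
  and P_kernel: "A \<in> S \<Longrightarrow> (\<lambda>x. emeasure (P x) A) \<in> borel_measurable borel"
  using proc unfolding cont_markov_process_def by blast+

text \<open>All \<open>P x\<close> share one sigma-algebra, and \<open>P 0\<close> serves as its
  representative. As a measurable kernel, \<open>P\<close> turns measurable functions of the path
  into measurable functions of the starting point.\<close>

lemma P_subprob: "P \<in> borel \<rightarrow>\<^sub>M subprob_algebra (P 0)"
  by (rule measurable_subprob_algebra)
     (auto simp: P_kernel prob_space_P prob_space_imp_subprob_space)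

text \<open>The counterpart of \<open>markov_sg\<close> for nonnegative extended functions: no
  integrability has to be checked, and monotone convergence is available.\<close>

definition markov_op :: "real \<Rightarrow> ('h \<Rightarrow> ennreal) \<Rightarrow> 'h \<Rightarrow> ennreal" where
  "markov_op t f x = (\<integral>\<^sup>+\<omega>. f (Z t \<omega>) \<partial>P x)"

lemma nn_integral_P_measurable:
  assumes "g \<in> borel_measurable (P 0)"
  shows "(\<lambda>x. \<integral>\<^sup>+\<omega>. g \<omega> \<partial>P x) \<in> borel_measurable borel"
  using measurable_compose[OF P_subprob nn_integral_measurable_subprob_algebra[OF assms]] .

lemma integral_P_measurable:
  fixes g :: "'w \<Rightarrow> real"
  assumes "g \<in> borel_measurable (P 0)"
  shows "(\<lambda>x. \<integral>\<omega>. g \<omega> \<partial>P x) \<in> borel_measurable borel"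
  using measurable_compose[OF P_subprob integral_measurable_subprob_algebra[OF assms]] .

lemma markov_op_measurable:
  assumes "0 \<le> t" "f \<in> borel_measurable borel"
  shows "markov_op t f \<in> borel_measurable borel"
  unfolding markov_op_def using measurable_compose[OF Z_measurable[OF assms(1)] assms(2)]
  by (rule nn_integral_P_measurable)

abbreviation \<F> :: "real \<Rightarrow> 'w measure" where "\<F> \<equiv> nat_filtration \<Omega> Z"

lemma space_filtration [simp]: "space (\<F> s) = \<Omega>"
  unfolding nat_filtration_def by (intro space_measure_of) auto

lemma sets_filtration:
  "sets (\<F> s) = sigma_sets \<Omega> {Z r -` B \<inter> \<Omega> | r B. 0 \<le> r \<and> r \<le> s \<and> B \<in> sets borel}"
  unfolding nat_filtration_def by (intro sets_measure_of) auto

lemma Z_measurable_filtration: "0 \<le> r \<Longrightarrow> r \<le> s \<Longrightarrow> Z r \<in> borel_measurable (\<F> s)"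
  by (rule measurableI) (auto simp: sets_filtration intro!: sigma_sets.Basic)

lemma filtration_mono: "s \<le> t \<Longrightarrow> sets (\<F> s) \<subseteq> sets (\<F> t)"
  unfolding sets_filtration by (intro sigma_sets_mono') force

lemma filtration_subset: "sets (\<F> s) \<subseteq> S"
proof -
  have "sigma_sets (space (P 0)) {Z r -` B \<inter> \<Omega> | r B. 0 \<le> r \<and> r \<le> s \<and> B \<in> sets borel} \<subseteq> sets (P 0)"
  proof (intro sets.sigma_sets_subset subsetI)
    fix A assume "A \<in> {Z r -` B \<inter> \<Omega> | r B. 0 \<le> r \<and> r \<le> s \<and> B \<in> sets borel}"
    then show "A \<in> sets (P 0)" using measurable_sets[OF Z_measurable[of _ 0]] by auto
  qed
  then show ?thesis by (simp add: sets_filtration)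
qed

lemma subalgebra_filtration: "subalgebra (P x) (\<F> s)"
  unfolding subalgebra_def using filtration_subset by simp

text \<open>The process is specified through conditional expectations of bounded real functions.
  Integration over \<open>A\<close> removes the exceptional null sets, and the
  \<open>ennreal\<close> form is the one that monotone limits extend.\<close>

lemma markov_indicator:
  assumes s: "0 \<le> s" and t: "0 \<le> t" and B: "B \<in> sets borel" and A: "A \<in> sets (\<F> s)"
  shows "(\<integral>\<^sup>+\<omega>. indicator A \<omega> * indicator B (Z (s + t) \<omega>) \<partial>P x)
       = (\<integral>\<^sup>+\<omega>. indicator A \<omega> * markov_op t (indicator B) (Z s \<omega>) \<partial>P x)"
proof -
  interpret prob_space "P x" by (rule prob_space_P)
  interpret finite_measure_subalgebra "P x" "\<F> s"
    by unfold_locales (rule subalgebra_filtration)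
  have AS: "A \<in> sets (P x)" using A filtration_subset by auto
  let ?f = "indicator B :: 'h \<Rightarrow> real"
  have f: "?f \<in> borel_measurable borel" "bounded (range ?f)"
    using B by (auto simp: bounded_iff indicator_def intro!: exI[of _ 1])
  have [measurable]: "Z (s + t) \<in> borel_measurable (P x)" "Z s \<in> borel_measurable (P x)"
    using s t by (auto intro!: Z_measurable)
  have mt: "markov_sg P Z t ?f \<in> borel_measurable borel"
    unfolding markov_sg_def
    by (rule integral_P_measurable) (use Z_measurable[OF t, of 0] f in measurable)
  have ms: "(\<lambda>\<omega>. markov_sg P Z t ?f (Z s \<omega>)) \<in> borel_measurable (P x)"
    using measurable_compose[OF _ mt, of "Z s"] by simp
  have fm: "(\<lambda>\<omega>. ?f (Z (s + t) \<omega>)) \<in> borel_measurable (P x)"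
    using measurable_compose[OF _ f(1), of "Z (s + t)"] by simp
  have eq: "ennreal (markov_sg P Z t ?f y) = markov_op t (indicator B) y" for y
  proof -
    interpret y: prob_space "P y" by (rule prob_space_P)
    have "integrable (P y) (\<lambda>\<omega>. ?f (Z t \<omega>))"
      using measurable_compose[OF Z_measurable[OF t] f(1)]
      by (intro y.integrable_const_bound[where B=1]) auto
    then have "ennreal (\<integral>\<omega>. ?f (Z t \<omega>) \<partial>P y) = (\<integral>\<^sup>+\<omega>. ennreal (?f (Z t \<omega>)) \<partial>P y)"
      by (intro nn_integral_eq_integral[symmetric]) auto
    then show ?thesis unfolding markov_sg_def markov_op_def by (simp add: ennreal_indicator)
  qed
  have nn: "0 \<le> markov_sg P Z t ?f y" for y unfolding markov_sg_def by (intro integral_nonneg_AE) auto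
  have le1: "markov_sg P Z t ?f y \<le> 1" for y
  proof -
    interpret y: prob_space "P y" by (rule prob_space_P)
    have "markov_op t (indicator B) y \<le> (\<integral>\<^sup>+\<omega>. 1 \<partial>P y)"
      unfolding markov_op_def by (intro nn_integral_mono) (auto simp: indicator_def)
    also have "\<dots> = 1" by (simp add: y.emeasure_space_1[simplified])
    finally have "ennreal (markov_sg P Z t ?f y) \<le> ennreal 1" unfolding eq by simp
    then show ?thesis by (subst (asm) ennreal_le_iff) auto
  qed
  have int1: "integrable (P x) (\<lambda>\<omega>. indicator A \<omega> * ?f (Z (s + t) \<omega>))"
  proof (rule integrable_const_bound[where B=1])
    show "(\<lambda>\<omega>. indicator A \<omega> * ?f (Z (s + t) \<omega>)) \<in> borel_measurable (P x)"
      using AS by (intro borel_measurable_times fm borel_measurable_indicator)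
  qed (auto simp: indicator_def)
  have "(\<integral>\<omega>. indicator A \<omega> * ?f (Z (s + t) \<omega>) \<partial>P x)
      = (\<integral>\<omega>. indicator A \<omega> * real_cond_exp (P x) (\<F> s) (\<lambda>\<omega>. ?f (Z (s + t) \<omega>)) \<omega> \<partial>P x)"
    by (rule real_cond_exp_intg(2)[symmetric]) (use int1 fm A in auto)
  also have "\<dots> = (\<integral>\<omega>. indicator A \<omega> * markov_sg P Z t ?f (Z s \<omega>) \<partial>P x)"
  proof (rule integral_cong_AE)
    have "AE \<omega> in P x. real_cond_exp (P x) (\<F> s) (\<lambda>\<omega>. ?f (Z (s + t) \<omega>)) \<omega> = markov_sg P Z t ?f (Z s \<omega>)"
      using proc f s t unfolding cont_markov_process_def by blast
    then show "AE \<omega> in P x. indicator A \<omega> * real_cond_exp (P x) (\<F> s) (\<lambda>\<omega>. ?f (Z (s + t) \<omega>)) \<omega>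
        = indicator A \<omega> * markov_sg P Z t ?f (Z s \<omega>)" by eventually_elim simp
  qed (use AS in \<open>auto intro!: borel_measurable_times borel_measurable_indicator ms borel_measurable_cond_exp2 simp del: borel_measurable_indicator_iff sets_P\<close>)
  finally have *: "(\<integral>\<omega>. indicator A \<omega> * ?f (Z (s + t) \<omega>) \<partial>P x) = (\<integral>\<omega>. indicator A \<omega> * markov_sg P Z t ?f (Z s \<omega>) \<partial>P x)" .
  have "(\<integral>\<^sup>+\<omega>. indicator A \<omega> * indicator B (Z (s + t) \<omega>) \<partial>P x) = (\<integral>\<^sup>+\<omega>. ennreal (indicator A \<omega> * ?f (Z (s + t) \<omega>)) \<partial>P x)"
    by (simp add: ennreal_mult ennreal_indicator)
  also have "\<dots> = ennreal (\<integral>\<omega>. indicator A \<omega> * ?f (Z (s + t) \<omega>) \<partial>P x)"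
    by (rule nn_integral_eq_integral[OF int1]) auto
  also have "\<dots> = ennreal (\<integral>\<omega>. indicator A \<omega> * markov_sg P Z t ?f (Z s \<omega>) \<partial>P x)" unfolding * ..
  also have "\<dots> = (\<integral>\<^sup>+\<omega>. ennreal (indicator A \<omega> * markov_sg P Z t ?f (Z s \<omega>)) \<partial>P x)"
  proof (intro nn_integral_eq_integral[symmetric] integrable_const_bound[where B=1])
    show "(\<lambda>\<omega>. indicator A \<omega> * markov_sg P Z t ?f (Z s \<omega>)) \<in> borel_measurable (P x)"
      using AS by (intro borel_measurable_times ms borel_measurable_indicator)
  qed (auto simp: nn le1 indicator_def)
  also have "\<dots> = (\<integral>\<^sup>+\<omega>. indicator A \<omega> * markov_op t (indicator B) (Z s \<omega>) \<partial>P x)"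
    by (simp add: ennreal_mult ennreal_indicator nn eq)
  finally show ?thesis .
qed

lemma markov_nn_integral:
  assumes s: "0 \<le> s" and t: "0 \<le> t" and A: "A \<in> sets (\<F> s)" and f: "f \<in> borel_measurable borel"
  shows "(\<integral>\<^sup>+\<omega>. indicator A \<omega> * f (Z (s + t) \<omega>) \<partial>P x) = (\<integral>\<^sup>+\<omega>. indicator A \<omega> * markov_op t f (Z s \<omega>) \<partial>P x)"
  using f
proof induction
  case (cong f g)
  then have "f = g" by auto
  with cong show ?case by simp
next
  case (set B)
  show ?case by (rule markov_indicator) (use assms set in auto)
next
  case (mult u c)
  have [measurable]: "A \<in> sets (P x)" using A filtration_subset by auto
  have [measurable]: "(\<lambda>\<omega>. u (Z (s + t) \<omega>)) \<in> borel_measurable (P x)"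
    using s t mult(2) by (intro measurable_compose[OF Z_measurable]) auto
  have [measurable]: "(\<lambda>\<omega>. markov_op t u (Z s \<omega>)) \<in> borel_measurable (P x)"
    using s t mult(2) by (intro measurable_compose[OF Z_measurable markov_op_measurable]) auto
  have "markov_op t (\<lambda>x. c * u x) = (\<lambda>x. c * markov_op t u x)"
    unfolding markov_op_def using mult(2) t
    by (intro ext nn_integral_cmult measurable_compose[OF Z_measurable]) auto
  then show ?case using mult(4) by (simp add: mult.left_commute[of _ c] nn_integral_cmult)
next
  case (add u v)
  have [measurable]: "A \<in> sets (P x)" using A filtration_subset by auto
  have [measurable]: "(\<lambda>\<omega>. u (Z (s + t) \<omega>)) \<in> borel_measurable (P x)" "(\<lambda>\<omega>. v (Z (s + t) \<omega>)) \<in> borel_measurable (P x)"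
    using s t add by (auto intro!: measurable_compose[OF Z_measurable])
  have [measurable]: "(\<lambda>\<omega>. markov_op t u (Z s \<omega>)) \<in> borel_measurable (P x)" "(\<lambda>\<omega>. markov_op t v (Z s \<omega>)) \<in> borel_measurable (P x)"
    using s t add by (auto intro!: measurable_compose[OF Z_measurable markov_op_measurable])
  have "markov_op t (\<lambda>x. v x + u x) = (\<lambda>x. markov_op t v x + markov_op t u x)"
    unfolding markov_op_def using add t
    by (intro ext nn_integral_add measurable_compose[OF Z_measurable]) auto
  then show ?case using add by (simp add: distrib_left nn_integral_add)
next
  case (seq U)
  have [measurable]: "A \<in> sets (P x)" using A filtration_subset by auto
  have mU: "(\<lambda>\<omega>. U i (Z (s + t) \<omega>)) \<in> borel_measurable (P x)" for i
    using s t seq by (auto intro!: measurable_compose[OF Z_measurable])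
  have mU': "(\<lambda>\<omega>. U i (Z t \<omega>)) \<in> borel_measurable (P y)" for i y
    using t seq by (auto intro!: measurable_compose[OF Z_measurable])
  have mT: "(\<lambda>\<omega>. markov_op t (U i) (Z s \<omega>)) \<in> borel_measurable (P x)" for i
    using s t seq by (auto intro!: measurable_compose[OF Z_measurable markov_op_measurable])
  have markov_op_SUP: "markov_op t (Sup (range U)) y = (SUP i. markov_op t (U i) y)" for y
    unfolding markov_op_def SUP_apply
    by (intro nn_integral_monotone_convergence_SUP mU') (use seq in \<open>auto simp: incseq_def le_fun_def\<close>)
  have incT: "markov_op t (U i) y \<le> markov_op t (U j) y" if "i \<le> j" for i j y
    unfolding markov_op_def using seq that by (intro nn_integral_mono) (auto simp: incseq_def le_fun_def)
  have "(\<integral>\<^sup>+\<omega>. indicator A \<omega> * Sup (range U) (Z (s + t) \<omega>) \<partial>P x)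
      = (\<integral>\<^sup>+\<omega>. (SUP i. indicator A \<omega> * U i (Z (s + t) \<omega>)) \<partial>P x)"
    by (simp add: SUP_mult_left_ennreal image_comp)
  also have "\<dots> = (SUP i. \<integral>\<^sup>+\<omega>. indicator A \<omega> * U i (Z (s + t) \<omega>) \<partial>P x)"
    using mU seq by (intro nn_integral_monotone_convergence_SUP)
      (auto simp: incseq_def le_fun_def intro!: mult_left_mono)
  also have "\<dots> = (SUP i. \<integral>\<^sup>+\<omega>. indicator A \<omega> * markov_op t (U i) (Z s \<omega>) \<partial>P x)"
    using seq by simp
  also have "\<dots> = (\<integral>\<^sup>+\<omega>. (SUP i. indicator A \<omega> * markov_op t (U i) (Z s \<omega>)) \<partial>P x)"
    using mT by (intro nn_integral_monotone_convergence_SUP[symmetric])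
      (auto simp: incseq_def le_fun_def intro!: mult_left_mono incT)
  also have "\<dots> = (\<integral>\<^sup>+\<omega>. indicator A \<omega> * markov_op t (Sup (range U)) (Z s \<omega>) \<partial>P x)"
    by (simp add: SUP_mult_left_ennreal markov_op_SUP)
  finally show ?case .
qed


text \<open>The induction splits off the latest time \<open>m\<close>: the Markov property at
  \<open>s + m\<close> turns what follows into a function of \<open>Z (s + m)\<close>, which
  together with the condition \<open>B m\<close> becomes the new end function. Hence
  \<open>b\<close> and \<open>f\<close> vary in the induction. One \<open>g\<close> serves all
  \<open>x\<close>, \<open>s\<close> and \<open>A\<close>, so that it can be identified later by a
  convenient choice of these.\<close>

lemma markov_cylinder:
  assumes "finite I" "I \<subseteq> {0..b}" "0 \<le> b" "\<And>r. B r \<in> sets borel" "f \<in> borel_measurable borel"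
  shows "\<exists>g\<in>borel_measurable borel. \<forall>x s A. 0 \<le> s \<longrightarrow> A \<in> sets (\<F> s) \<longrightarrow>
    (\<integral>\<^sup>+\<omega>. indicator (A \<inter> {\<omega>\<in>\<Omega>. \<forall>r\<in>I. Z (s + r) \<omega> \<in> B r}) \<omega> * f (Z (s + b) \<omega>) \<partial>P x)
      = (\<integral>\<^sup>+\<omega>. indicator A \<omega> * g (Z s \<omega>) \<partial>P x)"
  using assms
proof (induction I arbitrary: b f rule: finite_linorder_max_induct)
  case empty
  have "(\<integral>\<^sup>+\<omega>. indicator (A \<inter> {\<omega>\<in>\<Omega>. \<forall>r\<in>{}. Z (s + r) \<omega> \<in> B r}) \<omega> * f (Z (s + b) \<omega>) \<partial>P x)
      = (\<integral>\<^sup>+\<omega>. indicator A \<omega> * markov_op b f (Z s \<omega>) \<partial>P x)" if "0 \<le> s" "A \<in> sets (\<F> s)" for x s A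
  proof -
    have "A \<subseteq> \<Omega>" using sets.sets_into_space[OF that(2)] by simp
    then have "A \<inter> {\<omega>\<in>\<Omega>. \<forall>r\<in>{}. Z (s + r) \<omega> \<in> B r} = A" by auto
    then show ?thesis using markov_nn_integral[OF that(1) empty(2) that(2) empty(4)] by simp
  qed
  then show ?case using markov_op_measurable[OF empty(2) empty(4)] by blast
next
  case (insert m I)
  have m: "0 \<le> m" "m \<le> b" and I: "I \<subseteq> {0..m}" using insert.prems(1) insert.hyps(2) by (auto simp: less_imp_le)
  let ?f = "\<lambda>y. indicator (B m) y * markov_op (b - m) f y"
  have mf: "?f \<in> borel_measurable borel"
    using insert.prems(3)[of m] markov_op_measurable[OF _ insert.prems(4), of "b - m"] m by auto
  obtain g where g: "g \<in> borel_measurable borel" "\<And>x s A. 0 \<le> s \<Longrightarrow> A \<in> sets (\<F> s) \<Longrightarrow>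
    (\<integral>\<^sup>+\<omega>. indicator (A \<inter> {\<omega>\<in>\<Omega>. \<forall>r\<in>I. Z (s + r) \<omega> \<in> B r}) \<omega> * ?f (Z (s + m) \<omega>) \<partial>P x)
      = (\<integral>\<^sup>+\<omega>. indicator A \<omega> * g (Z s \<omega>) \<partial>P x)"
    using insert.IH[OF I m(1) insert.prems(3) mf] by blast
  have "(\<integral>\<^sup>+\<omega>. indicator (A \<inter> {\<omega>\<in>\<Omega>. \<forall>r\<in>insert m I. Z (s + r) \<omega> \<in> B r}) \<omega> * f (Z (s + b) \<omega>) \<partial>P x)
      = (\<integral>\<^sup>+\<omega>. indicator A \<omega> * g (Z s \<omega>) \<partial>P x)" if s: "0 \<le> s" and A: "A \<in> sets (\<F> s)" for x s A
  proof -
    let ?A = "A \<inter> {\<omega>\<in>\<Omega>. \<forall>r\<in>insert m I. Z (s + r) \<omega> \<in> B r}"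
    have Asub: "A \<subseteq> \<Omega>" using sets.sets_into_space[OF A] by simp
    have sets_r: "{\<omega>\<in>\<Omega>. Z (s + r) \<omega> \<in> B r} \<in> sets (\<F> (s + m))" if "r \<in> insert m I" for r
    proof -
      have "0 \<le> r" "r \<le> m" using that I m(1) by auto
      then have "Z (s + r) -` B r \<inter> space (\<F> (s + m)) \<in> sets (\<F> (s + m))"
        using s by (intro measurable_sets[OF Z_measurable_filtration insert.prems(3)]) auto
      moreover have "Z (s + r) -` B r \<inter> space (\<F> (s + m)) = {\<omega>\<in>\<Omega>. Z (s + r) \<omega> \<in> B r}" by auto
      ultimately show ?thesis by simp
    qed
    have "?A = A \<inter> (\<Inter>r\<in>insert m I. {\<omega>\<in>\<Omega>. Z (s + r) \<omega> \<in> B r})" using Asub by auto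
    also have "\<dots> \<in> sets (\<F> (s + m))"
      using A filtration_mono[of s "s + m"] m insert.hyps(1)
      by (intro sets.Int sets.finite_INT sets_r) auto
    finally have A': "?A \<in> sets (\<F> (s + m))" .
    have "(\<integral>\<^sup>+\<omega>. indicator ?A \<omega> * f (Z (s + b) \<omega>) \<partial>P x) = (\<integral>\<^sup>+\<omega>. indicator ?A \<omega> * markov_op (b - m) f (Z (s + m) \<omega>) \<partial>P x)"
      using markov_nn_integral[OF _ _ A' insert.prems(4), of "b - m" x] s m by (simp add: add.assoc)
    also have "\<dots> = (\<integral>\<^sup>+\<omega>. indicator (A \<inter> {\<omega>\<in>\<Omega>. \<forall>r\<in>I. Z (s + r) \<omega> \<in> B r}) \<omega> * ?f (Z (s + m) \<omega>) \<partial>P x)"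
      by (intro nn_integral_cong) (auto simp: indicator_def)
    also have "\<dots> = (\<integral>\<^sup>+\<omega>. indicator A \<omega> * g (Z s \<omega>) \<partial>P x)" by (rule g(2)[OF s A])
    finally show ?thesis .
  qed
  then show ?case using g(1) by blast
qed

lemma path_set_measurable:
  assumes B: "B \<in> sigma_sets UNIV path_cylinders" and s: "0 \<le> s"
  shows "{\<omega>\<in>\<Omega>. (\<lambda>r. Z (s + r) \<omega>) \<in> B} \<in> S"
proof -
  have "(\<lambda>\<omega> r. Z (s + r) \<omega>) \<in> P 0 \<rightarrow>\<^sub>M sigma UNIV path_cylinders"
  proof (rule measurable_measure_of)
    fix y assume "y \<in> (path_cylinders :: (real \<Rightarrow> 'h) set set)"
    then obtain I B where y: "y = {w. \<forall>r\<in>I. w r \<in> B r}" "finite I" "I \<subseteq> {0..}" "\<And>r. B r \<in> sets borel"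
      unfolding path_cylinders_def by blast
    have "(\<lambda>\<omega> r. Z (s + r) \<omega>) -` y \<inter> space (P 0) = space (P 0) \<inter> (\<Inter>r\<in>I. Z (s + r) -` B r \<inter> space (P 0))"
      unfolding y(1) by auto
    also have "\<dots> \<in> sets (P 0)"
    proof (cases "I = {}")
      case False
      then show ?thesis using y s
        by (intro sets.Int sets.top sets.finite_INT measurable_sets[OF Z_measurable]) auto
    qed (use sets.top[of "P 0"] in auto)
    finally show "(\<lambda>\<omega> r. Z (s + r) \<omega>) -` y \<inter> space (P 0) \<in> sets (P 0)" .
  qed auto
  moreover have "B \<in> sets (sigma UNIV path_cylinders)" using B by (simp add: sets_measure_of)
  ultimately have "(\<lambda>\<omega> r. Z (s + r) \<omega>) -` B \<inter> space (P 0) \<in> sets (P 0)" by (rule measurable_sets)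
  moreover have "(\<lambda>\<omega> r. Z (s + r) \<omega>) -` B \<inter> space (P 0) = {\<omega>\<in>\<Omega>. (\<lambda>r. Z (s + r) \<omega>) \<in> B}" by auto
  ultimately show ?thesis by simp
qed

text \<open>The pi-lambda theorem carries the Markov property from cylinders to the sigma-algebra
  they generate, which contains the avoidance of a closed set in the form of
  \<open>avoids_closed_iff\<close>.\<close>

lemma markov_path:
  assumes B: "B \<in> sigma_sets UNIV path_cylinders" and s: "0 \<le> s" and A: "A \<in> sets (\<F> s)"
  shows "emeasure (P x) (A \<inter> {\<omega>\<in>\<Omega>. (\<lambda>r. Z (s + r) \<omega>) \<in> B})
       = (\<integral>\<^sup>+\<omega>. indicator A \<omega> * emeasure (P (Z s \<omega>)) {\<omega>'\<in>\<Omega>. (\<lambda>r. Z r \<omega>') \<in> B} \<partial>P x)"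
proof -
  interpret prob_space "P x" by (rule prob_space_P)
  have AS: "A \<in> S" using A filtration_subset by auto
  have AO: "A \<subseteq> \<Omega>" using sets.sets_into_space[OF A] by simp
  let ?C = "\<lambda>B. {\<omega>\<in>\<Omega>. (\<lambda>r. Z (s + r) \<omega>) \<in> B}" and ?D = "\<lambda>B. {\<omega>'\<in>\<Omega>. (\<lambda>r. Z r \<omega>') \<in> B}"
  have DS: "?D B \<in> S" if "B \<in> sigma_sets UNIV path_cylinders" for B
    using path_set_measurable[OF that, of 0] by simp
  have CS: "?C B \<in> S" if "B \<in> sigma_sets UNIV path_cylinders" for B
    using path_set_measurable[OF that s] .
  have mD: "(\<lambda>\<omega>. emeasure (P (Z s \<omega>)) (?D B)) \<in> borel_measurable (P x)" if "B \<in> sigma_sets UNIV path_cylinders" for B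
    using measurable_compose[OF Z_measurable[OF s] P_kernel[OF DS[OF that]]] .
  have AP: "A \<in> sets (P x)" using AS by simp
  have mAD: "(\<lambda>\<omega>. indicator A \<omega> * emeasure (P (Z s \<omega>)) (?D B)) \<in> borel_measurable (P x)"
    if "B \<in> sigma_sets UNIV path_cylinders" for B
    by (rule borel_measurable_times_ennreal[OF borel_measurable_indicator[OF AP] mD[OF that]])
  show ?thesis
    using Int_stable_path_cylinders subset_Pow_Union[of path_cylinders, THEN order_trans, OF Pow_mono[OF subset_UNIV]] B
  proof (induction rule: sigma_sets_induct_disjoint)
    case (basic K)
    then obtain I B where K: "K = {w. \<forall>r\<in>I. w r \<in> B r}" "finite I" "I \<subseteq> {0..}" "\<And>r. B r \<in> sets borel"
      unfolding path_cylinders_def by blast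
    obtain b where b: "0 \<le> b" "I \<subseteq> {0..b}"
    proof (cases "I = {}")
      case False
      then show ?thesis using K(2,3) that[of "Max I"] Max_ge[OF K(2)] by (auto simp: subset_iff)
    qed auto
    obtain g where g: "g \<in> borel_measurable borel" "\<And>x s A. 0 \<le> s \<Longrightarrow> A \<in> sets (\<F> s) \<Longrightarrow>
      (\<integral>\<^sup>+\<omega>. indicator (A \<inter> {\<omega>\<in>\<Omega>. \<forall>r\<in>I. Z (s + r) \<omega> \<in> B r}) \<omega> * 1 \<partial>P x)
        = (\<integral>\<^sup>+\<omega>. indicator A \<omega> * g (Z s \<omega>) \<partial>P x)"
      using markov_cylinder[where B=B and f="\<lambda>_. 1", OF K(2) b(2,1) K(4)] by (auto simp: Bex_def)
    have CK: "?C K = {\<omega>\<in>\<Omega>. \<forall>r\<in>I. Z (s + r) \<omega> \<in> B r}" and DK: "?D K = {\<omega>\<in>\<Omega>. \<forall>r\<in>I. Z (0 + r) \<omega> \<in> B r}"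
      unfolding K(1) by auto
    have sK: "K \<in> sigma_sets UNIV path_cylinders" using basic by (rule sigma_sets.Basic)
    \<comment> \<open>The choice \<open>s = 0\<close> and \<open>A = \<Omega>\<close> identifies
      \<open>g\<close>, since under \<open>P y\<close> the process starts at \<open>y\<close> almost
      surely.\<close>
    have gD: "g y = emeasure (P y) (?D K)" for y
    proof -
      interpret y: prob_space "P y" by (rule prob_space_P)
      have "emeasure (P y) (?D K) = (\<integral>\<^sup>+\<omega>. indicator (?D K) \<omega> \<partial>P y)"
        using DS[OF sK] by simp
      also have "\<dots> = (\<integral>\<^sup>+\<omega>. indicator (\<Omega> \<inter> {\<omega>\<in>\<Omega>. \<forall>r\<in>I. Z (0 + r) \<omega> \<in> B r}) \<omega> * 1 \<partial>P y)"
        unfolding DK by (intro nn_integral_cong) (auto simp: indicator_def)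
      also have "\<dots> = (\<integral>\<^sup>+\<omega>. indicator \<Omega> \<omega> * g (Z 0 \<omega>) \<partial>P y)"
        by (rule g(2)) (use sets.top[of "\<F> 0"] in simp_all)
      also have "\<dots> = (\<integral>\<^sup>+\<omega>. g y \<partial>P y)"
      proof (rule nn_integral_cong_AE)
        show "AE \<omega> in P y. indicator \<Omega> \<omega> * g (Z 0 \<omega>) = g y"
          using Z_0[of y] AE_space by eventually_elim simp
      qed
      also have "\<dots> = g y" using y.emeasure_space_1 by simp
      finally show ?thesis ..
    qed
    have "emeasure (P x) (A \<inter> ?C K) = (\<integral>\<^sup>+\<omega>. indicator (A \<inter> ?C K) \<omega> \<partial>P x)"
      using CS[OF sK] by (intro nn_integral_indicator[symmetric] sets.Int AP) simp
    also have "\<dots> = (\<integral>\<^sup>+\<omega>. indicator (A \<inter> {\<omega>\<in>\<Omega>. \<forall>r\<in>I. Z (s + r) \<omega> \<in> B r}) \<omega> * 1 \<partial>P x)" unfolding CK by simp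
    also have "\<dots> = (\<integral>\<^sup>+\<omega>. indicator A \<omega> * g (Z s \<omega>) \<partial>P x)" by (rule g(2)[OF s A])
    finally show ?case unfolding gD .
  next
    case (compl K)
    have sK': "UNIV - K \<in> sigma_sets UNIV path_cylinders" using compl(1) by (rule sigma_sets.Compl)
    have e: "emeasure (P y) (?D K) + emeasure (P y) (?D (UNIV - K)) = 1" for y
    proof -
      interpret y: prob_space "P y" by (rule prob_space_P)
      have "emeasure (P y) (?D K) + emeasure (P y) (?D (UNIV - K)) = emeasure (P y) (?D K \<union> ?D (UNIV - K))"
        using DS[OF compl(1)] DS[OF sK'] by (intro plus_emeasure) auto
      also have "?D K \<union> ?D (UNIV - K) = \<Omega>" by auto
      also have "emeasure (P y) \<Omega> = 1" using y.emeasure_space_1 by simp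
      finally show ?thesis .
    qed
    \<comment> \<open>To avoid subtraction in \<open>ennreal\<close>, the two complementary parts
      are added up to the measure of \<open>A\<close>, and the finite measure of the first one is
      cancelled at the end.\<close>
    have "emeasure (P x) (A \<inter> ?C K) + emeasure (P x) (A \<inter> ?C (UNIV - K)) = emeasure (P x) A"
    proof -
      have "A \<inter> ?C K \<in> sets (P x)" "A \<inter> ?C (UNIV - K) \<in> sets (P x)"
        using CS[OF compl(1)] CS[OF sK'] by (auto intro: sets.Int[OF AP, simplified])
      then have "emeasure (P x) (A \<inter> ?C K) + emeasure (P x) (A \<inter> ?C (UNIV - K)) = emeasure (P x) ((A \<inter> ?C K) \<union> (A \<inter> ?C (UNIV - K)))"
        by (intro plus_emeasure) auto
      also have "(A \<inter> ?C K) \<union> (A \<inter> ?C (UNIV - K)) = A" using AO by auto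
      finally show ?thesis .
    qed
    also have "\<dots> = (\<integral>\<^sup>+\<omega>. indicator A \<omega> * (emeasure (P (Z s \<omega>)) (?D K) + emeasure (P (Z s \<omega>)) (?D (UNIV - K))) \<partial>P x)"
      unfolding e using AP by simp
    also have "\<dots> = (\<integral>\<^sup>+\<omega>. indicator A \<omega> * emeasure (P (Z s \<omega>)) (?D K) \<partial>P x) + (\<integral>\<^sup>+\<omega>. indicator A \<omega> * emeasure (P (Z s \<omega>)) (?D (UNIV - K)) \<partial>P x)"
      unfolding distrib_left by (rule nn_integral_add[OF mAD[OF compl(1)] mAD[OF sK']])
    finally have "emeasure (P x) (A \<inter> ?C K) + emeasure (P x) (A \<inter> ?C (UNIV - K)) =
      emeasure (P x) (A \<inter> ?C K) + (\<integral>\<^sup>+\<omega>. indicator A \<omega> * emeasure (P (Z s \<omega>)) (?D (UNIV - K)) \<partial>P x)"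
      using compl(2) by simp
    then show ?case by (simp add: ennreal_add_left_cancel)
  next
    case (union K)
    have sK: "K i \<in> sigma_sets UNIV path_cylinders" for i using union(2) by auto
    have "emeasure (P x) (A \<inter> ?C (\<Union>i. K i)) = emeasure (P x) (\<Union>i. A \<inter> ?C (K i))"
      by (intro arg_cong[where f="emeasure (P x)"]) auto
    also have "\<dots> = (\<Sum>i. emeasure (P x) (A \<inter> ?C (K i)))"
    proof (rule suminf_emeasure[symmetric])
      show "range (\<lambda>i. A \<inter> ?C (K i)) \<subseteq> sets (P x)"
        using CS[OF sK] by (intro image_subsetI sets.Int AP) simp
      show "disjoint_family (\<lambda>i. A \<inter> ?C (K i))" using union(1) by (auto simp: disjoint_family_on_def)
    qed
    also have "\<dots> = (\<Sum>i. \<integral>\<^sup>+\<omega>. indicator A \<omega> * emeasure (P (Z s \<omega>)) (?D (K i)) \<partial>P x)"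
      by (simp only: union(3))
    also have "\<dots> = (\<integral>\<^sup>+\<omega>. (\<Sum>i. indicator A \<omega> * emeasure (P (Z s \<omega>)) (?D (K i))) \<partial>P x)"
      by (rule nn_integral_suminf[OF mAD[OF sK], symmetric])
    also have "\<dots> = (\<integral>\<^sup>+\<omega>. indicator A \<omega> * emeasure (P (Z s \<omega>)) (?D (\<Union>i. K i)) \<partial>P x)"
    proof (intro nn_integral_cong)
      fix \<omega>
      have "(\<Sum>i. emeasure (P (Z s \<omega>)) (?D (K i))) = emeasure (P (Z s \<omega>)) (\<Union>i. ?D (K i))"
        using DS[OF sK] union(1) by (intro suminf_emeasure) (auto simp: disjoint_family_on_def)
      also have "(\<Union>i. ?D (K i)) = ?D (\<Union>i. K i)" by auto
      finally show "(\<Sum>i. indicator A \<omega> * emeasure (P (Z s \<omega>)) (?D (K i))) = indicator A \<omega> * emeasure (P (Z s \<omega>)) (?D (\<Union>i. K i))"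
        by (simp add: ennreal_suminf_cmult)
    qed
    finally show ?case .
  qed auto
qed

end

section \<open>The killed process\<close>

text \<open>Since the infimum need not be attained, \<open>t < exit_time\<close> is not a condition
  on the path up to time \<open>t\<close>. The weak inequality is one, on an open time interval, and
  it is the version handled first.\<close>

lemma exit_time_ge_iff: "ereal u \<le> exit_time Z E \<omega> \<longleftrightarrow> (\<forall>r. 0 < r \<and> r < u \<longrightarrow> Z r \<omega> \<in> E)"
  unfolding exit_time_def le_INF_iff by (auto simp: not_le[symmetric])

locale killed_process = markov_process \<Omega> S P Z
  for \<Omega> :: "'w set" and S
    and P :: "'h::{real_inner, complete_space, second_countable_topology} \<Rightarrow> 'w measure" and Z +
  fixes E :: "'h set"
  assumes E_borel: "E \<in> sets borel" and E_nonempty: "E \<noteq> {}"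
    and killing: "killing_cond P Z E"
begin

definition surv :: "real \<Rightarrow> 'w set" where
  "surv t = {\<omega>\<in>\<Omega>. ereal t < exit_time Z E \<omega>}"

definition exit_ge :: "real \<Rightarrow> 'w set" where
  "exit_ge u = {\<omega>\<in>\<Omega>. ereal u \<le> exit_time Z E \<omega>}"

lemma surv_measure_pos: "x \<in> E \<Longrightarrow> 0 < t \<Longrightarrow> 0 < measure (P x) (surv t)"
  using killing unfolding killing_cond_def surv_def by simp

text \<open>A set of positive measure is measurable, since the measure of a non-measurable set is 0.\<close>

lemma surv_sets: "0 < t \<Longrightarrow> surv t \<in> S"
proof (rule ccontr)
  assume t: "0 < t" and "surv t \<notin> S"
  obtain x where "x \<in> E" using E_nonempty by auto
  from surv_measure_pos[OF this t] measure_notin_sets[of "surv t" "P x"] \<open>surv t \<notin> S\<close>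
  show False by simp
qed

lemma surv_in: "\<omega> \<in> surv t \<Longrightarrow> 0 < r \<Longrightarrow> r \<le> t \<Longrightarrow> Z r \<omega> \<in> E"
proof (rule ccontr)
  assume "\<omega> \<in> surv t" "0 < r" "r \<le> t" "Z r \<omega> \<notin> E"
  then have "exit_time Z E \<omega> \<le> ereal r" unfolding exit_time_def by (intro INF_lower2[of r]) auto
  also have "\<dots> \<le> ereal t" using \<open>r \<le> t\<close> by simp
  also have "\<dots> < exit_time Z E \<omega>" using \<open>\<omega> \<in> surv t\<close> by (simp add: surv_def)
  finally show False by simp
qed

lemma exit_ge_eq: "exit_ge u = {\<omega>\<in>\<Omega>. \<forall>r. 0 < r \<and> r < u \<longrightarrow> Z r \<omega> \<in> E}"
  unfolding exit_ge_def exit_time_ge_iff ..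

text \<open>For a Borel set \<open>E\<close> the condition ranges over uncountably many times, so
  measurability is inherited from \<open>surv_sets\<close> along times increasing to
  \<open>u\<close>. The offset 2 keeps these times positive.\<close>

lemma exit_ge_sets:
  assumes u: "0 < u" shows "exit_ge u \<in> S"
proof -
  have "exit_ge u = (\<Inter>n. surv (u - u / (real n + 2)))"
  proof (intro equalityI subsetI)
    fix \<omega> assume w: "\<omega> \<in> exit_ge u"
    show "\<omega> \<in> (\<Inter>n. surv (u - u / (real n + 2)))"
    proof
      fix n
      have "ereal (u - u / (real n + 2)) < ereal u" using u by simp
      also have "\<dots> \<le> exit_time Z E \<omega>" using w by (simp add: exit_ge_def)
      finally show "\<omega> \<in> surv (u - u / (real n + 2))" using w by (simp add: surv_def exit_ge_def)
    qed
  next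
    fix \<omega> assume w: "\<omega> \<in> (\<Inter>n. surv (u - u / (real n + 2)))"
    then have sp: "\<omega> \<in> \<Omega>" by (auto simp: surv_def)
    moreover have "Z r \<omega> \<in> E" if r: "0 < r" "r < u" for r
    proof -
      have "0 < (u - r) / u" using r by simp
      then obtain n where n: "1 / real (Suc n) < (u - r) / u" using nat_approx_posE by blast
      have "u / (real n + 2) \<le> u / real (Suc n)" using u by (intro divide_left_mono) auto
      also have "\<dots> < u - r" using n u by (simp add: field_simps)
      finally have "r \<le> u - u / (real n + 2)" by simp
      then show ?thesis using w r by (intro surv_in[of \<omega> "u - u / (real n + 2)"]) auto
    qed
    ultimately show "\<omega> \<in> exit_ge u" by (simp add: exit_ge_eq)
  qed
  also have "\<dots> \<in> sets (P 0)"
  proof (intro sets.countable_INT image_subsetI)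
    fix n
    have "u / (real n + 2) < u" using u by (simp add: field_simps add_pos_nonneg)
    then show "surv (u - u / (real n + 2)) \<in> sets (P 0)" using surv_sets by simp
  qed auto
  finally show ?thesis by simp
qed

lemma surv_eq_UN: "surv t = (\<Union>n. exit_ge (t + 1 / real (Suc n)))"
proof (intro equalityI subsetI)
  fix \<omega> assume w: "\<omega> \<in> surv t"
  then obtain z where z: "ereal t < ereal z" "ereal z < exit_time Z E \<omega>"
    using ereal_dense2[of "ereal t" "exit_time Z E \<omega>"] by (auto simp: surv_def)
  then have "0 < z - t" by simp
  then obtain n where n: "1 / real (Suc n) < z - t" using nat_approx_posE by blast
  then have "ereal (t + 1 / real (Suc n)) \<le> ereal z" by simp
  also have "\<dots> \<le> exit_time Z E \<omega>" using z by simp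
  finally have "\<omega> \<in> exit_ge (t + 1 / real (Suc n))" using w by (simp add: exit_ge_def surv_def)
  then show "\<omega> \<in> (\<Union>n. exit_ge (t + 1 / real (Suc n)))" by blast
next
  fix \<omega> assume "\<omega> \<in> (\<Union>n. exit_ge (t + 1 / real (Suc n)))"
  then obtain n where n: "\<omega> \<in> exit_ge (t + 1 / real (Suc n))" by blast
  have "ereal t < ereal (t + 1 / real (Suc n))" by simp
  also have "\<dots> \<le> exit_time Z E \<omega>" using n by (simp add: exit_ge_def)
  finally show "\<omega> \<in> surv t" using n by (simp add: exit_ge_def surv_def)
qed

lemma exit_ge_mono: "u \<le> v \<Longrightarrow> exit_ge v \<subseteq> exit_ge u"
  unfolding exit_ge_eq by auto

section \<open>Survival over consecutive time intervals\<close>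

text \<open>Elements of the path space may be discontinuous. Avoidance of \<open>F\<close> is
  therefore expressed by rational times and a uniform distance, a countable form that cylinders
  generate.\<close>

lemma avoid_path_set:
  fixes F :: "'h set"
  shows "{w. \<exists>k. \<forall>r\<in>\<rat> \<inter> {0..b}. 1 / real (Suc k) \<le> infdist (w r) F} \<in> sigma_sets UNIV path_cylinders"
proof -
  have sub: "path_cylinders \<subseteq> Pow (UNIV :: (real \<Rightarrow> 'h) set)" by simp
  interpret sigma_algebra UNIV "sigma_sets UNIV (path_cylinders :: (real \<Rightarrow> 'h) set set)"
    by (rule sigma_algebra_sigma_sets[OF sub])
  have "{w. 1 / real (Suc k) \<le> infdist (w r) F} \<in> sigma_sets UNIV path_cylinders" if "r \<in> \<rat> \<inter> {0..b}" for k r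
  proof -
    have "{y. 1 / real (Suc k) \<le> infdist y F} \<in> sets borel"
      by (intro borel_closed closed_Collect_le continuous_intros)
    from path_coordinate_in_sigma[OF _ this, of r] that show ?thesis by simp
  qed
  moreover have "countable (\<rat> \<inter> {0..b})" by (intro countable_Int1 countable_rat)
  ultimately have "(\<Inter>r\<in>\<rat> \<inter> {0..b}. {w. 1 / real (Suc k) \<le> infdist (w r) F}) \<in> sigma_sets UNIV path_cylinders" for k
    by (cases "\<rat> \<inter> {0..b} = {}") (auto intro!: countable_INT' simp: image_subset_iff)
  then have "(\<Union>k. (\<Inter>r\<in>\<rat> \<inter> {0..b}. {w. 1 / real (Suc k) \<le> infdist (w r) F})) \<in> sigma_sets UNIV path_cylinders"
    by (intro countable_UN) auto
  also have "(\<Union>k. (\<Inter>r\<in>\<rat> \<inter> {0..b}. {w. 1 / real (Suc k) \<le> infdist (w r) F}))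
    = {w. \<exists>k. \<forall>r\<in>\<rat> \<inter> {0..b}. 1 / real (Suc k) \<le> infdist (w r) F}" by auto
  finally show ?thesis .
qed

text \<open>Survival to \<open>s\<close> keeps the path off \<open>F\<close> on
  \<open>{a..s}\<close>, and the restarted path stays in \<open>E\<close> during the open interval
  of length \<open>v\<close>, which covers the rest up to \<open>b\<close> because
  \<open>b - s < v\<close>. For closed \<open>F\<close>, unlike for the complement of
  \<open>E\<close>, these are events to which \<open>markov_path\<close> applies.\<close>

lemma markov_avoid_closed:
  assumes F: "closed F" "F \<noteq> {}" "F \<inter> E = {}" and ab: "0 < a" "a < s" "s < b" "b < s + v"
  shows "(\<integral>\<^sup>+\<omega>. indicator (surv s) \<omega> * emeasure (P (Z s \<omega>)) (exit_ge v) \<partial>P x)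
    \<le> emeasure (P x) {\<omega>\<in>\<Omega>. \<forall>r\<in>{a..b}. Z r \<omega> \<notin> F}"
proof -
  have s: "0 \<le> s" and v: "0 < v" using ab by auto
  define B where "B = {w. \<exists>k. \<forall>r\<in>\<rat> \<inter> {0..b - s}. 1 / real (Suc k) \<le> infdist (w r) F}"
  have B: "B \<in> sigma_sets UNIV path_cylinders" unfolding B_def by (rule avoid_path_set)
  have B_iff: "(\<lambda>r. Z (t + r) \<omega>) \<in> B \<longleftrightarrow> (\<forall>r\<in>{0..b - s}. Z (t + r) \<omega> \<notin> F)" if "\<omega> \<in> \<Omega>" "0 \<le> t" for \<omega> t
  proof -
    have "continuous_on {0..b - s} ((\<lambda>r. Z r \<omega>) \<circ> (\<lambda>r. t + r))"
      using that(2) by (intro continuous_on_compose continuous_intros continuous_on_subset[OF Z_continuous[OF that(1)]]) auto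
    then have "continuous_on {0..b - s} (\<lambda>r. Z (t + r) \<omega>)" by (simp add: o_def)
    from avoids_closed_iff[OF this F(1,2)] show ?thesis unfolding B_def using ab by simp
  qed
  \<comment> \<open>\<open>surv s\<close> need not belong to \<open>\<F> s\<close>. The larger event
    of avoiding \<open>F\<close> on \<open>{a..s}\<close> does belong to it; replacing one by the
    other is one source of the inequality.\<close>
  define A where "A = \<Omega> - {\<omega>\<in>\<Omega>. \<exists>r\<in>{a..s}. Z r \<omega> \<in> F}"
  have "{\<omega>\<in>space (\<F> s). \<exists>r\<in>{a..s}. Z r \<omega> \<in> F} \<in> sets (\<F> s)"
  proof (rule hit_closed_measurable[OF _ _ F(1) ab(2)])
    show "Z r \<in> borel_measurable (\<F> s)" if "r \<in> {a..s}" for r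
      using that ab by (intro Z_measurable_filtration) auto
    show "continuous_on {a..s} (\<lambda>r. Z r \<omega>)" if "\<omega> \<in> space (\<F> s)" for \<omega>
      using that ab by (intro continuous_on_subset[OF Z_continuous]) auto
  qed
  then have A: "A \<in> sets (\<F> s)" unfolding A_def using sets.compl_sets by force
  have "(\<integral>\<^sup>+\<omega>. indicator (surv s) \<omega> * emeasure (P (Z s \<omega>)) (exit_ge v) \<partial>P x)
     \<le> (\<integral>\<^sup>+\<omega>. indicator A \<omega> * emeasure (P (Z s \<omega>)) {\<omega>'\<in>\<Omega>. (\<lambda>r. Z r \<omega>') \<in> B} \<partial>P x)"
  proof (intro nn_integral_mono)
    fix \<omega>
    show "indicator (surv s) \<omega> * emeasure (P (Z s \<omega>)) (exit_ge v)
      \<le> indicator A \<omega> * emeasure (P (Z s \<omega>)) {\<omega>'\<in>\<Omega>. (\<lambda>r. Z r \<omega>') \<in> B}"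
    proof (cases "\<omega> \<in> surv s")
      case True
      have "\<omega> \<in> A"
        using True surv_in[OF True] ab F(3) unfolding A_def surv_def by fastforce
      have ZE: "Z s \<omega> \<in> E" using ab by (intro surv_in[OF True]) auto
      have "emeasure (P (Z s \<omega>)) (exit_ge v) \<le> emeasure (P (Z s \<omega>)) {\<omega>'\<in>\<Omega>. (\<lambda>r. Z r \<omega>') \<in> B}"
      proof (rule emeasure_mono_AE)
        show "AE \<omega>' in P (Z s \<omega>). \<omega>' \<in> exit_ge v \<longrightarrow> \<omega>' \<in> {\<omega>'\<in>\<Omega>. (\<lambda>r. Z r \<omega>') \<in> B}"
          using Z_0[of "Z s \<omega>"]
        proof eventually_elim
          case (elim \<omega>')
          show ?case
          proof
            assume w': "\<omega>' \<in> exit_ge v"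
            then have sp: "\<omega>' \<in> \<Omega>" by (simp add: exit_ge_def)
            \<comment> \<open>\<open>exit_ge\<close> says nothing about time 0. There the restarted
              path is at \<open>Z s \<omega>\<close> almost surely, a point of \<open>E\<close> by
              survival.\<close>
            have "Z r \<omega>' \<in> E" if "r \<in> {0..b - s}" for r
            proof (cases "r = 0")
              case False
              then show ?thesis using that w' ab by (auto simp: exit_ge_eq)
            qed (use ZE elim in simp)
            then have "\<forall>r\<in>{0..b - s}. Z (0 + r) \<omega>' \<notin> F" using F(3) by auto
            then show "\<omega>' \<in> {\<omega>'\<in>\<Omega>. (\<lambda>r. Z r \<omega>') \<in> B}" using B_iff[OF sp order_refl] sp by simp
          qed
        qed
        show "{\<omega>'\<in>\<Omega>. (\<lambda>r. Z r \<omega>') \<in> B} \<in> sets (P (Z s \<omega>))"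
          using path_set_measurable[OF B order_refl] by simp
      qed
      with True \<open>\<omega> \<in> A\<close> show ?thesis by simp
    qed simp
  qed
  also have "\<dots> = emeasure (P x) (A \<inter> {\<omega>\<in>\<Omega>. (\<lambda>r. Z (s + r) \<omega>) \<in> B})"
    by (rule markov_path[OF B s A, symmetric])
  also have "A \<inter> {\<omega>\<in>\<Omega>. (\<lambda>r. Z (s + r) \<omega>) \<in> B} = {\<omega>\<in>\<Omega>. \<forall>r\<in>{a..b}. Z r \<omega> \<notin> F}"
  proof (intro set_eqI iffI)
    fix \<omega> assume w: "\<omega> \<in> A \<inter> {\<omega>\<in>\<Omega>. (\<lambda>r. Z (s + r) \<omega>) \<in> B}"
    then have sp: "\<omega> \<in> \<Omega>" by simp
    have "Z r \<omega> \<notin> F" if r: "r \<in> {a..b}" for r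
    proof (cases "r \<le> s")
      case True
      then show ?thesis using w r by (auto simp: A_def)
    next
      case False
      then have "r - s \<in> {0..b - s}" using r by auto
      then have "Z (s + (r - s)) \<omega> \<notin> F" using w B_iff[OF sp s] by blast
      then show ?thesis by simp
    qed
    then show "\<omega> \<in> {\<omega>\<in>\<Omega>. \<forall>r\<in>{a..b}. Z r \<omega> \<notin> F}" using sp by simp
  next
    fix \<omega> assume w: "\<omega> \<in> {\<omega>\<in>\<Omega>. \<forall>r\<in>{a..b}. Z r \<omega> \<notin> F}"
    then have sp: "\<omega> \<in> \<Omega>" by simp
    have "\<forall>r\<in>{0..b - s}. Z (s + r) \<omega> \<notin> F" using w ab by auto
    then show "\<omega> \<in> A \<inter> {\<omega>\<in>\<Omega>. (\<lambda>r. Z (s + r) \<omega>) \<in> B}"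
      using w ab B_iff[OF sp s] by (auto simp: A_def)
  qed
  finally show ?thesis .
qed

text \<open>In terms of the complementary event \<open>H\<close> the claim is that the probability
  of \<open>H\<close> and the integral add up to at most 1. Any \<open>c\<close> below that
  probability is attained by hitting a closed \<open>F\<close>, while the integral is at most the
  probability of avoiding the same \<open>F\<close>.\<close>

lemma exit_ge_superadditive:
  assumes s: "0 < s" and v: "0 < v"
  shows "(\<integral>\<^sup>+\<omega>. indicator (surv s) \<omega> * emeasure (P (Z s \<omega>)) (exit_ge v) \<partial>P x)
    \<le> emeasure (P x) (exit_ge (s + v))" (is "?I \<le> _")
proof -
  interpret prob_space "P x" by (rule prob_space_P)
  define H where "H = {\<omega>\<in>\<Omega>. \<exists>r\<in>{0<..<s + v}. Z r \<omega> \<in> - E}"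
  have V: "exit_ge (s + v) \<in> sets (P x)" using exit_ge_sets[of "s + v"] s v by simp
  have H_eq: "H = \<Omega> - exit_ge (s + v)" unfolding H_def exit_ge_eq by auto
  have H: "H \<in> sets (P x)" unfolding H_eq using V by (metis sets.compl_sets space_P)
  have I1: "?I \<le> 1"
  proof -
    have "?I \<le> (\<integral>\<^sup>+\<omega>. 1 \<partial>P x)"
    proof (intro nn_integral_mono)
      fix \<omega>
      interpret y: prob_space "P (Z s \<omega>)" by (rule prob_space_P)
      show "indicator (surv s) \<omega> * emeasure (P (Z s \<omega>)) (exit_ge v) \<le> 1"
        using y.emeasure_le_1 by (auto simp: indicator_def)
    qed
    then show ?thesis using emeasure_space_1 by simp
  qed
  have key: "c + ?I \<le> 1" if c: "c < emeasure (P x) H" for c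
  proof -
    have "c < outer_measure_of (P x) {\<omega>\<in>space (P x). \<exists>r\<in>{0<..<s + v}. Z r \<omega> \<in> - E}"
      using c H unfolding H_def by simp
    then obtain F a b where F: "closed F" "F \<subseteq> - E" "0 < a" "a < b" "b < s + v"
      "c \<le> emeasure (P x) {\<omega>\<in>space (P x). \<exists>r\<in>{a..b}. Z r \<omega> \<in> F}"
      using E_borel s v
      by (rule_tac hit_capacitable[of "P x" Z "- E" "s + v" c])
         (auto intro: Z_measurable Z_continuous finite_measure_axioms borel_comp)
    show ?thesis
    proof (cases "F = {}")
      case True
      then have "c = 0" using F(6) by simp
      then show ?thesis using I1 by simp
    next
      case False
      \<comment> \<open>The window is enlarged so that \<open>s\<close> lies in its interior, still
        inside the open interval from 0 to \<open>s + v\<close>. Enlarging it can only increase the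
        hitting event.\<close>
      define a' b' where "a' = min a (s / 2)" and "b' = max b (s + v / 2)"
      have ab: "0 < a'" "a' < s" "s < b'" "b' < s + v" "a' \<le> a" "b \<le> b'" "a' < b'"
        using F s v by (auto simp: a'_def b'_def min_def max_def)
      let ?N = "{\<omega>\<in>\<Omega>. \<forall>r\<in>{a'..b'}. Z r \<omega> \<notin> F}" and ?H = "{\<omega>\<in>\<Omega>. \<exists>r\<in>{a'..b'}. Z r \<omega> \<in> F}"
      have "{\<omega>\<in>space (P x). \<exists>r\<in>{a'..b'}. Z r \<omega> \<in> F} \<in> sets (P x)"
        using ab by (intro hit_closed_measurable F(1) Z_measurable continuous_on_subset[OF Z_continuous]) auto
      then have mH: "?H \<in> sets (P x)" by simp
      have N_eq: "?N = space (P x) - ?H" by auto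
      have mN: "?N \<in> sets (P x)" unfolding N_eq by (rule sets.compl_sets[OF mH])
      have "c \<le> emeasure (P x) {\<omega>\<in>\<Omega>. \<exists>r\<in>{a..b}. Z r \<omega> \<in> F}" using F(6) by simp
      also have "\<dots> \<le> emeasure (P x) ?H"
        using ab(5,6) by (intro emeasure_mono[OF _ mH] subsetI) force
      finally have 1: "c \<le> emeasure (P x) ?H" .
      have 2: "?I \<le> emeasure (P x) ?N"
        using F(2) by (intro markov_avoid_closed F(1) False ab) auto
      have "c + ?I \<le> emeasure (P x) ?H + emeasure (P x) ?N" by (rule add_mono[OF 1 2])
      also have "\<dots> = emeasure (P x) (?H \<union> ?N)" by (rule plus_emeasure[OF mH mN]) auto
      also have "\<dots> \<le> 1" by (rule emeasure_le_1)
      finally show ?thesis .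
    qed
  qed
  have "emeasure (P x) H + ?I \<le> 1"
  proof (rule ccontr)
    assume gt: "\<not> ?thesis"
    have "?I < top" using I1 by (auto simp: less_top[symmetric] top_unique)
    then obtain i where i: "?I = ennreal i" "0 \<le> i" by (cases ?I) auto
    obtain h where h: "emeasure (P x) H = ennreal h" "0 \<le> h" by (cases "emeasure (P x) H") auto
    have "i \<le> 1" using I1 unfolding i(1) by (simp add: ennreal_le_1)
    have "ennreal (h + i) > ennreal 1" using gt unfolding i(1) h(1) using h(2) i(2) by (simp add: not_le)
    then have "1 < h + i" using ennreal_less_iff[of 1 "h + i"] by simp
    \<comment> \<open>The midpoint of \<open>1 - i\<close> and \<open>h\<close>: it is below
      \<open>h\<close>, so \<open>key\<close> applies, yet \<open>c + i\<close> exceeds 1.\<close>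
    define c where "c = (h + (1 - i)) / 2"
    have "0 \<le> c" "c < h" "1 < c + i" using \<open>1 < h + i\<close> \<open>i \<le> 1\<close> h(2) by (simp_all add: c_def field_simps)
    then have "ennreal c + ?I \<le> 1" by (intro key) (simp add: h(1) ennreal_lessI)
    then have "ennreal (c + i) \<le> 1" unfolding i(1) using \<open>0 \<le> c\<close> i(2) by simp
    then show False using \<open>1 < c + i\<close> by (simp add: ennreal_le_1)
  qed
  moreover have "emeasure (P x) H + emeasure (P x) (exit_ge (s + v)) = 1"
  proof -
    have "emeasure (P x) H + emeasure (P x) (exit_ge (s + v)) = emeasure (P x) (H \<union> exit_ge (s + v))"
      by (rule plus_emeasure[OF H V]) (auto simp: H_eq)
    also have "H \<union> exit_ge (s + v) = space (P x)" unfolding H_eq by (auto simp: exit_ge_def)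
    finally show ?thesis using emeasure_space_1 by simp
  qed
  ultimately have "emeasure (P x) H + ?I \<le> emeasure (P x) H + emeasure (P x) (exit_ge (s + v))" by simp
  then show ?thesis by (simp add: ennreal_add_left_cancel_le)
qed

text \<open>Strict survival is the increasing union of the events \<open>exit_ge\<close> at slightly
  later times, so the previous inequality passes to the limit by monotone convergence.\<close>

lemma surv_superadditive:
  assumes s: "0 < s" and t: "0 < t"
  shows "(\<integral>\<^sup>+\<omega>. indicator (surv s) \<omega> * emeasure (P (Z s \<omega>)) (surv t) \<partial>P x) \<le> emeasure (P x) (surv (s + t))"
proof -
  let ?v = "\<lambda>n. t + 1 / real (Suc n)"
  have v: "0 < ?v n" for n using t by (simp add: add_pos_pos)
  have dec: "?v m \<le> ?v n" if "n \<le> m" for n m using that by (simp add: frac_le)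
  have eq: "emeasure (P y) (surv t) = (SUP n. emeasure (P y) (exit_ge (?v n)))" for y
    unfolding surv_eq_UN using exit_ge_sets[OF v] exit_ge_mono[OF dec]
    by (intro SUP_emeasure_incseq[symmetric]) (auto simp: incseq_def)
  have m: "(\<lambda>\<omega>. indicator (surv s) \<omega> * emeasure (P (Z s \<omega>)) (exit_ge (?v n))) \<in> borel_measurable (P x)" for n
  proof (intro borel_measurable_times_ennreal borel_measurable_indicator)
    show "surv s \<in> sets (P x)" using surv_sets[OF s] by simp
    show "(\<lambda>\<omega>. emeasure (P (Z s \<omega>)) (exit_ge (?v n))) \<in> borel_measurable (P x)"
      using s by (intro measurable_compose[OF Z_measurable P_kernel] exit_ge_sets v) simp
  qed
  have "(\<integral>\<^sup>+\<omega>. indicator (surv s) \<omega> * emeasure (P (Z s \<omega>)) (surv t) \<partial>P x)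
     = (\<integral>\<^sup>+\<omega>. (SUP n. indicator (surv s) \<omega> * emeasure (P (Z s \<omega>)) (exit_ge (?v n))) \<partial>P x)"
    unfolding eq by (simp add: SUP_mult_left_ennreal)
  also have "\<dots> = (SUP n. \<integral>\<^sup>+\<omega>. indicator (surv s) \<omega> * emeasure (P (Z s \<omega>)) (exit_ge (?v n)) \<partial>P x)"
  proof (rule nn_integral_monotone_convergence_SUP[OF _ m])
    show "incseq (\<lambda>n \<omega>. indicator (surv s) \<omega> * emeasure (P (Z s \<omega>)) (exit_ge (?v n)))"
      unfolding incseq_def le_fun_def using exit_ge_mono[OF dec] exit_ge_sets[OF v]
      by (intro allI impI mult_left_mono emeasure_mono) auto
  qed
  also have "\<dots> \<le> emeasure (P x) (surv (s + t))"
  proof (rule SUP_least)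
    fix n
    have "(\<integral>\<^sup>+\<omega>. indicator (surv s) \<omega> * emeasure (P (Z s \<omega>)) (exit_ge (?v n)) \<partial>P x) \<le> emeasure (P x) (exit_ge (s + ?v n))"
      by (rule exit_ge_superadditive[OF s v])
    also have "\<dots> \<le> emeasure (P x) (surv (s + t))"
    proof (rule emeasure_mono)
      show "exit_ge (s + ?v n) \<subseteq> surv (s + t)" unfolding surv_eq_UN[of "s + t"]
        by (auto simp: add.assoc)
      show "surv (s + t) \<in> sets (P x)" using surv_sets[of "s + t"] s t by simp
    qed
    finally show "(\<integral>\<^sup>+\<omega>. indicator (surv s) \<omega> * emeasure (P (Z s \<omega>)) (exit_ge (?v n)) \<partial>P x) \<le> emeasure (P x) (surv (s + t))" .
  qed
  finally show ?thesis .
qed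

end

section \<open>Compactness of the semigroup\<close>

lemma SUP_power2_ennreal:
  fixes f :: "nat \<Rightarrow> ennreal"
  assumes "incseq f"
  shows "(SUP i. f i)\<^sup>2 = (SUP i. (f i)\<^sup>2)"
proof -
  have "(\<lambda>i. f i * f i) \<longlonglongrightarrow> (SUP i. f i) * (SUP i. f i)"
    by (rule tendsto_mult_ennreal[OF LIMSEQ_SUP[OF assms] LIMSEQ_SUP[OF assms]]) (metis ennreal_zero_neq_top infinity_ennreal_def)
  moreover from assms have "incseq (\<lambda>i. f i * f i)"
    by (auto simp: incseq_def intro!: mult_mono)
  from LIMSEQ_SUP[OF this] have "(\<lambda>i. f i * f i) \<longlonglongrightarrow> (SUP i. f i * f i)" .
  ultimately show ?thesis unfolding power2_eq_square by (rule LIMSEQ_unique)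
qed

context markov_process
begin

lemma markov_op_kernel:
  assumes "0 \<le> t"
  shows "(\<lambda>x. distr (P x) borel (Z t)) \<in> borel \<rightarrow>\<^sub>M subprob_algebra borel"
  using measurable_compose[OF P_subprob measurable_distr[OF Z_measurable[OF assms]]] .

lemma markov_sg_measurable:
  assumes "0 \<le> t" "f \<in> borel_measurable borel"
  shows "markov_sg P Z t f \<in> borel_measurable borel"
  unfolding markov_sg_def using measurable_compose[OF Z_measurable[OF assms(1)] assms(2)]
  by (rule integral_P_measurable)

lemma markov_op_ennreal:
  assumes "0 \<le> t" "f \<in> borel_measurable borel" "\<And>y. 0 \<le> f y" "\<And>y. f y \<le> c"
  shows "markov_op t (\<lambda>y. ennreal (f y)) x = ennreal (markov_sg P Z t f x)" "0 \<le> markov_sg P Z t f x"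
    "markov_sg P Z t f x \<le> c"
proof -
  interpret prob_space "P x" by (rule prob_space_P)
  have i: "integrable (P x) (\<lambda>\<omega>. f (Z t \<omega>))"
    using measurable_compose[OF Z_measurable[OF assms(1)] assms(2)] assms(3,4)
    by (intro integrable_const_bound[where B=c]) auto
  then show "markov_op t (\<lambda>y. ennreal (f y)) x = ennreal (markov_sg P Z t f x)"
    unfolding markov_op_def markov_sg_def using assms(3) by (intro nn_integral_eq_integral) auto
  show "0 \<le> markov_sg P Z t f x" unfolding markov_sg_def using assms(3) by (intro integral_nonneg_AE) auto
  have "markov_sg P Z t f x \<le> (\<integral>\<omega>. c \<partial>P x)" unfolding markov_sg_def
    using i assms(4) by (intro integral_mono) auto
  then show "markov_sg P Z t f x \<le> c" using prob_space by simp
qed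

text \<open>Invariance is given for bounded real functions. On indicators it says that the
  transition kernel preserves \<open>\<mu>\<close>, that is \<open>\<mu> \<bind> ?K = \<mu>\<close>,
  and integrating against both sides gives all nonnegative functions, integrable or not.\<close>

lemma nn_integral_markov_op_invariant:
  assumes inv: "invariant_prob P Z \<mu>" and t: "0 \<le> t" and f: "f \<in> borel_measurable borel"
  shows "(\<integral>\<^sup>+x. markov_op t f x \<partial>\<mu>) = (\<integral>\<^sup>+x. f x \<partial>\<mu>)"
proof -
  interpret prob_space \<mu> using inv by (simp add: invariant_prob_def)
  have [measurable_cong]: "sets \<mu> = sets borel" using inv by (simp add: invariant_prob_def)
  let ?K = "\<lambda>x. distr (P x) borel (Z t)"
  have K: "?K \<in> \<mu> \<rightarrow>\<^sub>M subprob_algebra borel" using markov_op_kernel[OF t] by measurable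
  have ne: "space \<mu> \<noteq> {}" by (rule not_empty)
  have trK: "markov_op t g x = (\<integral>\<^sup>+y. g y \<partial>?K x)" if "g \<in> borel_measurable borel" for g x
    unfolding markov_op_def by (subst nn_integral_distr[OF Z_measurable[OF t]]) (use that in auto)
  have "\<mu> \<bind> ?K = \<mu>"
  proof (rule measure_eqI)
    show "sets (\<mu> \<bind> ?K) = sets \<mu>" using sets_bind[OF sets_kernel[OF K] ne] \<open>sets \<mu> = sets borel\<close> by simp
    fix A assume "A \<in> sets (\<mu> \<bind> ?K)"
    then have A: "A \<in> sets borel" using sets_bind[OF sets_kernel[OF K] ne] by simp
    then have A': "A \<in> sets \<mu>" using \<open>sets \<mu> = sets borel\<close> by simp
    have f: "(indicator A :: 'h \<Rightarrow> real) \<in> borel_measurable borel" "bounded (range (indicator A :: 'h \<Rightarrow> real))"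
      using A by (auto simp: bounded_iff indicator_def intro!: exI[of _ 1])
    have b: "0 \<le> (indicator A y :: real)" "indicator A y \<le> (1::real)" for y by (auto simp: indicator_def)
    note te = markov_op_ennreal[OF t f(1) b]
    have "emeasure (\<mu> \<bind> ?K) A = (\<integral>\<^sup>+x. emeasure (?K x) A \<partial>\<mu>)" by (rule emeasure_bind[OF ne K A])
    also have "\<dots> = (\<integral>\<^sup>+x. markov_op t (indicator A) x \<partial>\<mu>)"
      using A by (intro nn_integral_cong) (simp add: trK)
    also have "\<dots> = (\<integral>\<^sup>+x. ennreal (markov_sg P Z t (indicator A) x) \<partial>\<mu>)"
      unfolding te(1)[symmetric] by (simp add: ennreal_indicator)
    also have "\<dots> = ennreal (\<integral>x. markov_sg P Z t (indicator A) x \<partial>\<mu>)"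
      using te(2,3) markov_sg_measurable[OF t f(1)]
      by (intro nn_integral_eq_integral integrable_const_bound[where B=1]) auto
    also have "\<dots> = ennreal (\<integral>x. indicator A x \<partial>\<mu>)"
      using inv t f unfolding invariant_prob_def by auto
    also have "\<dots> = emeasure \<mu> A" using A' by (simp add: emeasure_eq_measure)
    finally show "emeasure (\<mu> \<bind> ?K) A = emeasure \<mu> A" .
  qed
  then have "(\<integral>\<^sup>+x. f x \<partial>\<mu>) = (\<integral>\<^sup>+x. f x \<partial>(\<mu> \<bind> ?K))" by simp
  also have "\<dots> = (\<integral>\<^sup>+x. \<integral>\<^sup>+y. f y \<partial>?K x \<partial>\<mu>)" by (rule nn_integral_bind[OF f K])
  finally show ?thesis using f by (simp add: trK)
qed

text \<open>Multiplication with the indicators of sets of vanishing measure tends to 0 strongly, hence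
  uniformly on a precompact set.\<close>

lemma compact_small_sets_bounded:
  assumes inv: "invariant_prob P Z \<mu>" and comp: "compact_on_L2 P Z \<mu>" and t: "0 < t" and e: "0 < (e::real)"
  shows "\<exists>d>0. \<forall>B f. B \<in> sets borel \<longrightarrow> emeasure \<mu> B < ennreal d \<longrightarrow> f \<in> borel_measurable borel \<longrightarrow>
    bounded (range f) \<longrightarrow> (\<integral>\<^sup>+x. ennreal ((f x)\<^sup>2) \<partial>\<mu>) \<le> 1 \<longrightarrow>
    (\<integral>\<^sup>+x. indicator B x * ennreal ((markov_sg P Z t f x)\<^sup>2) \<partial>\<mu>) \<le> ennreal e"
proof (rule ccontr)
  assume neg: "\<not> ?thesis"
  interpret prob_space \<mu> using inv by (simp add: invariant_prob_def)
  have [measurable_cong]: "sets \<mu> = sets borel" using inv by (simp add: invariant_prob_def)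
  define Q where "Q d B f \<longleftrightarrow> B \<in> sets borel \<and> emeasure \<mu> B < ennreal d \<and> f \<in> borel_measurable borel \<and>
    bounded (range f) \<and> (\<integral>\<^sup>+x. ennreal ((f x)\<^sup>2) \<partial>\<mu>) \<le> 1 \<and>
    \<not> (\<integral>\<^sup>+x. indicator B x * ennreal ((markov_sg P Z t f x)\<^sup>2) \<partial>\<mu>) \<le> ennreal e" for d B f
  have "\<exists>Bf. Q d (fst Bf) (snd Bf)" if "0 < d" for d
    using neg that unfolding Q_def by auto
  then have "\<forall>n. \<exists>Bf. Q (1 / real (Suc n)) (fst Bf) (snd Bf)" by simp
  from choice[OF this] obtain Bf where QBf: "\<And>n. Q (1 / real (Suc n)) (fst (Bf n)) (snd (Bf n))" by blast
  define B f where "B n = fst (Bf n)" and "f n = snd (Bf n)" for n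
  have Bf: "B n \<in> sets borel" "emeasure \<mu> (B n) < ennreal (1 / real (Suc n))"
    "f n \<in> borel_measurable borel" "bounded (range (f n))" "(\<integral>\<^sup>+x. ennreal ((f n x)\<^sup>2) \<partial>\<mu>) \<le> 1"
    "\<not> (\<integral>\<^sup>+x. indicator (B n) x * ennreal ((markov_sg P Z t (f n) x)\<^sup>2) \<partial>\<mu>) \<le> ennreal e" for n
    using QBf[of n] unfolding Q_def B_def f_def by simp_all
  have "\<forall>n. f n \<in> borel_measurable borel \<and> bounded (range (f n)) \<and> (\<integral>\<^sup>+x. ennreal ((f n x)\<^sup>2) \<partial>\<mu>) \<le> 1"
    by (intro allI conjI Bf)
  from comp[unfolded compact_on_L2_def, THEN spec, THEN mp, OF t, THEN spec, THEN mp, OF this]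
  obtain r :: "nat \<Rightarrow> nat" where r: "strict_mono r" and
    Cauchy: "\<forall>e>0. \<exists>N. \<forall>m\<ge>N. \<forall>n\<ge>N. (\<integral>\<^sup>+x. ennreal ((markov_sg P Z t (f (r m)) x - markov_sg P Z t (f (r n)) x)\<^sup>2) \<partial>\<mu>) < ennreal e"
    by (elim exE conjE)
  \<comment> \<open>In a^2 <= 2 (a - h)^2 + 2 h^2 the Cauchy tail contributes at most
    \<open>2 * (e / 4)\<close>, and the part of \<open>h\<close> on a small set at most another
    \<open>e / 2\<close>.\<close>
  have "0 < e / 4" using e by simp
  from Cauchy[THEN spec, THEN mp, OF this] obtain N where N: "\<forall>m\<ge>N. \<forall>n\<ge>N.
    (\<integral>\<^sup>+x. ennreal ((markov_sg P Z t (f (r m)) x - markov_sg P Z t (f (r n)) x)\<^sup>2) \<partial>\<mu>) < ennreal (e / 4)" ..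
  \<comment> \<open>A fixed member of the tail serves as reference. As the image of a bounded
    function it is bounded, so its square has a small integral over sets of small measure.\<close>
  define h where "h = markov_sg P Z t (f (r N))"
  have [measurable]: "markov_sg P Z t (f n) \<in> borel_measurable borel" for n
    using Bf(3) t by (intro markov_sg_measurable) auto
  have [measurable]: "B n \<in> sets borel" for n by (rule Bf(1))
  have [measurable]: "h \<in> borel_measurable borel" unfolding h_def by measurable
  obtain c where c: "\<And>y. \<bar>f (r N) y\<bar> \<le> c" using Bf(4)[of "r N"] by (auto simp: bounded_iff)
  have hc: "\<bar>h x\<bar> \<le> c" for x
  proof -
    interpret x: prob_space "P x" by (rule prob_space_P)
    have i: "integrable (P x) (\<lambda>\<omega>. f (r N) (Z t \<omega>))"
      using measurable_compose[OF Z_measurable[of t x] Bf(3)] t c by (intro x.integrable_const_bound[where B=c]) auto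
    have "\<bar>h x\<bar> \<le> (\<integral>\<omega>. \<bar>f (r N) (Z t \<omega>)\<bar> \<partial>P x)"
      unfolding h_def markov_sg_def by (rule integral_abs_bound)
    also have "\<dots> \<le> (\<integral>\<omega>. c \<partial>P x)"
      by (rule integral_mono[OF integrable_abs[OF i] x.integrable_const c])
    also have "\<dots> = c" using x.prob_space by simp
    finally show ?thesis .
  qed
  obtain m0 where m0: "1 / real (Suc m0) < e / (4 * (c\<^sup>2 + 1))"
    using nat_approx_posE[of "e / (4 * (c\<^sup>2 + 1))"] e by (auto simp: add_nonneg_pos)
  define m where "m = max N m0"
  have rm: "m0 \<le> r m" using seq_suble[OF r, of m] by (simp add: m_def)
  have "(\<integral>\<^sup>+x. indicator (B (r m)) x * ennreal ((markov_sg P Z t (f (r m)) x)\<^sup>2) \<partial>\<mu>)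
     \<le> (\<integral>\<^sup>+x. 2 * ennreal ((markov_sg P Z t (f (r m)) x - h x)\<^sup>2) + ennreal (2 * c\<^sup>2) * indicator (B (r m)) x \<partial>\<mu>)"
  proof (rule nn_integral_mono)
    fix x
    have "(markov_sg P Z t (f (r m)) x)\<^sup>2 \<le> 2 * (markov_sg P Z t (f (r m)) x - h x)\<^sup>2 + 2 * (h x)\<^sup>2"
      using sum_squares_bound[of "markov_sg P Z t (f (r m)) x - h x" "h x"] by (simp add: power2_eq_square algebra_simps)
    also have "(h x)\<^sup>2 \<le> c\<^sup>2" using hc[of x] by (metis abs_ge_zero power2_abs power_mono)
    finally have "ennreal ((markov_sg P Z t (f (r m)) x)\<^sup>2) \<le> ennreal (2 * (markov_sg P Z t (f (r m)) x - h x)\<^sup>2 + 2 * c\<^sup>2)"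
      by (intro ennreal_leI) simp
    also have "\<dots> = 2 * ennreal ((markov_sg P Z t (f (r m)) x - h x)\<^sup>2) + ennreal (2 * c\<^sup>2)"
      by (simp add: ennreal_mult)
    finally show "indicator (B (r m)) x * ennreal ((markov_sg P Z t (f (r m)) x)\<^sup>2)
      \<le> 2 * ennreal ((markov_sg P Z t (f (r m)) x - h x)\<^sup>2) + ennreal (2 * c\<^sup>2) * indicator (B (r m)) x"
      by (auto simp: indicator_def)
  qed
  also have "\<dots> = 2 * (\<integral>\<^sup>+x. ennreal ((markov_sg P Z t (f (r m)) x - h x)\<^sup>2) \<partial>\<mu>) + ennreal (2 * c\<^sup>2) * emeasure \<mu> (B (r m))"
    by (subst nn_integral_add) (auto simp: nn_integral_cmult)
  also have "\<dots> \<le> 2 * ennreal (e / 4) + ennreal (2 * c\<^sup>2) * ennreal (1 / real (Suc m0))"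
  proof (intro add_mono mult_left_mono)
    show "(\<integral>\<^sup>+x. ennreal ((markov_sg P Z t (f (r m)) x - h x)\<^sup>2) \<partial>\<mu>) \<le> ennreal (e / 4)"
      unfolding h_def using N[THEN spec, of m, THEN mp, THEN spec, of N] by (simp add: m_def less_imp_le)
    have "emeasure \<mu> (B (r m)) \<le> ennreal (1 / real (Suc (r m)))" using Bf(2)[of "r m"] by simp
    also have "\<dots> \<le> ennreal (1 / real (Suc m0))" using rm by (intro ennreal_leI) (simp add: frac_le)
    finally show "emeasure \<mu> (B (r m)) \<le> ennreal (1 / real (Suc m0))" .
  qed auto
  also have "\<dots> = ennreal (e / 2 + 2 * c\<^sup>2 * (1 / real (Suc m0)))"
  proof -
    have "2 * ennreal (e / 4) = ennreal (e / 2)"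
      using ennreal_mult[of 2 "e / 4"] e by simp
    moreover have "ennreal (2 * c\<^sup>2) * ennreal (1 / real (Suc m0)) = ennreal (2 * c\<^sup>2 * (1 / real (Suc m0)))"
      by (rule ennreal_mult[symmetric]) auto
    ultimately show ?thesis
      using ennreal_plus[of "e / 2" "2 * c\<^sup>2 * (1 / real (Suc m0))"] e by simp
  qed
  also have "\<dots> \<le> ennreal e"
  proof (rule ennreal_leI)
    have "2 * c\<^sup>2 * (1 / real (Suc m0)) \<le> 2 * (c\<^sup>2 + 1) * (e / (4 * (c\<^sup>2 + 1)))"
      using m0 by (intro mult_mono) auto
    also have "\<dots> = e / 2"
    proof -
      have "2 * k * (e / (4 * k)) = e / 2" if "0 < k" for k :: real using that by simp
      from this[of "c\<^sup>2 + 1"] show ?thesis by (simp add: add_nonneg_pos)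
    qed
    finally show "e / 2 + 2 * c\<^sup>2 * (1 / real (Suc m0)) \<le> e" by simp
  qed
  finally show False using Bf(6) by blast
qed

text \<open>Truncation and division by \<open>sqrt a\<close> bring \<open>g\<close> into the unit
  ball of bounded functions, where compactness is stated; homogeneity and monotone convergence undo
  both. A bound \<open>a\<close> on the squared norm, rather than a normalization, is what can be
  iterated.\<close>

lemma compact_small_sets:
  assumes inv: "invariant_prob P Z \<mu>" and comp: "compact_on_L2 P Z \<mu>" and t: "0 < t" and e: "0 < (e::real)"
  shows "\<exists>d>0. \<forall>B g a. B \<in> sets borel \<longrightarrow> emeasure \<mu> B < ennreal d \<longrightarrow> g \<in> borel_measurable borel \<longrightarrow>
    0 < a \<longrightarrow> (\<integral>\<^sup>+x. (g x)\<^sup>2 \<partial>\<mu>) \<le> ennreal a \<longrightarrow>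
    (\<integral>\<^sup>+x. indicator B x * (markov_op t g x)\<^sup>2 \<partial>\<mu>) \<le> ennreal (e * a)"
proof -
  have [measurable_cong]: "sets \<mu> = sets borel" using inv by (simp add: invariant_prob_def)
  have t0: "0 \<le> t" using t by simp
  obtain d where d: "0 < d" and dB: "\<And>B f. B \<in> sets borel \<Longrightarrow> emeasure \<mu> B < ennreal d \<Longrightarrow> f \<in> borel_measurable borel \<Longrightarrow>
    bounded (range f) \<Longrightarrow> (\<integral>\<^sup>+x. ennreal ((f x)\<^sup>2) \<partial>\<mu>) \<le> 1 \<Longrightarrow>
    (\<integral>\<^sup>+x. indicator B x * ennreal ((markov_sg P Z t f x)\<^sup>2) \<partial>\<mu>) \<le> ennreal e"
    using compact_small_sets_bounded[OF inv comp t e] by blast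
  have "(\<integral>\<^sup>+x. indicator B x * (markov_op t g x)\<^sup>2 \<partial>\<mu>) \<le> ennreal (e * a)"
    if B[measurable]: "B \<in> sets borel" and Bd: "emeasure \<mu> B < ennreal d" and g[measurable]: "g \<in> borel_measurable borel"
      and a: "0 < a" and ga: "(\<integral>\<^sup>+x. (g x)\<^sup>2 \<partial>\<mu>) \<le> ennreal a" for B g a
  proof -
    define G where "G n x = min (of_nat n) (g x)" for n :: nat and x
    have [measurable]: "G n \<in> borel_measurable borel" for n unfolding G_def by measurable
    have [measurable]: "markov_op t (G n) \<in> borel_measurable borel" for n using t0 by (intro markov_op_measurable) auto
    have incG: "incseq (\<lambda>n. G n x)" for x
      unfolding G_def incseq_def by (intro allI impI min.mono of_nat_mono order_refl)
    have SG: "(SUP n. G n x) = g x" for x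
    proof (rule antisym)
      show "(SUP n. G n x) \<le> g x" unfolding G_def by (intro SUP_least) auto
      show "g x \<le> (SUP n. G n x)"
      proof (cases "g x = top")
        case True
        then show ?thesis by (simp add: G_def ennreal_SUP_of_nat_eq_top)
      next
        case False
        then obtain n where "g x < of_nat n" using ennreal_Ex_less_of_nat[of "g x"] by (auto simp: less_top)
        then have "g x \<le> G n x" by (simp add: G_def less_imp_le)
        then show ?thesis by (rule SUP_upper2[OF UNIV_I])
      qed
    qed
    have trSG: "(SUP n. markov_op t (G n) x) = markov_op t g x" and inc_tr: "incseq (\<lambda>n. markov_op t (G n) x)" for x
    proof -
      have m: "(\<lambda>\<omega>. G n (Z t \<omega>)) \<in> borel_measurable (P x)" for n
        by (rule measurable_compose[OF Z_measurable[OF t0]]) simp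
      have "markov_op t g x = (\<integral>\<^sup>+\<omega>. (SUP n. G n (Z t \<omega>)) \<partial>P x)" unfolding markov_op_def SG ..
      also have "\<dots> = (SUP n. markov_op t (G n) x)" unfolding markov_op_def
        using incG m by (intro nn_integral_monotone_convergence_SUP) (auto simp: incseq_def le_fun_def)
      finally show "(SUP n. markov_op t (G n) x) = markov_op t g x" ..
      show "incseq (\<lambda>n. markov_op t (G n) x)"
        unfolding markov_op_def incseq_def using incG by (auto simp: incseq_def intro!: nn_integral_mono)
    qed
    have bound: "(\<integral>\<^sup>+x. indicator B x * (markov_op t (G n) x)\<^sup>2 \<partial>\<mu>) \<le> ennreal (e * a)" for n
    proof -
      define f where "f x = enn2real (G n x) / sqrt a" for x
      have Gn: "G n x \<le> of_nat n" for x by (simp add: G_def)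
      have Gf: "G n x = ennreal (sqrt a * f x)" for x
      proof -
        have "G n x < top" using le_less_trans[OF Gn[of x] of_nat_less_top] .
        then show ?thesis using a by (simp add: f_def)
      qed
      have f0: "0 \<le> f x" for x using a by (simp add: f_def)
      have fc: "f x \<le> real n / sqrt a" for x
      proof -
        have "enn2real (G n x) \<le> enn2real (of_nat n)" by (intro enn2real_mono Gn) (rule of_nat_less_top)
        then show ?thesis unfolding f_def using a by (intro divide_right_mono) auto
      qed
      have fm[measurable]: "f \<in> borel_measurable borel" unfolding f_def by measurable
      have bf: "bounded (range f)" unfolding bounded_iff using f0 fc by (intro exI[of _ "real n / sqrt a"]) auto
      have "(\<integral>\<^sup>+x. ennreal ((f x)\<^sup>2) \<partial>\<mu>) \<le> (\<integral>\<^sup>+x. ennreal (1 / a) * (g x)\<^sup>2 \<partial>\<mu>)"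
      proof (rule nn_integral_mono)
        fix x
        have "ennreal ((f x)\<^sup>2) = ennreal (1 / a * (sqrt a * f x)\<^sup>2)" using a by (simp add: power_mult_distrib)
        also have "\<dots> = ennreal (1 / a) * (G n x)\<^sup>2"
          unfolding Gf using a f0 by (subst ennreal_mult) (auto simp: ennreal_power)
        also have "\<dots> \<le> ennreal (1 / a) * (g x)\<^sup>2"
          by (intro mult_left_mono power_mono) (auto simp: G_def)
        finally show "ennreal ((f x)\<^sup>2) \<le> ennreal (1 / a) * (g x)\<^sup>2" .
      qed
      also have "\<dots> = ennreal (1 / a) * (\<integral>\<^sup>+x. (g x)\<^sup>2 \<partial>\<mu>)" by (rule nn_integral_cmult) measurable
      also have "\<dots> \<le> ennreal (1 / a) * ennreal a" using ga by (intro mult_left_mono) auto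
      also have "\<dots> = 1" using a by (simp add: ennreal_mult[symmetric])
      finally have "(\<integral>\<^sup>+x. indicator B x * ennreal ((markov_sg P Z t f x)\<^sup>2) \<partial>\<mu>) \<le> ennreal e"
        by (intro dB B Bd fm bf)
      have trG: "(markov_op t (G n) x)\<^sup>2 = ennreal a * ennreal ((markov_sg P Z t f x)\<^sup>2)" for x
      proof -
        have "markov_op t (G n) x = (\<integral>\<^sup>+\<omega>. ennreal (sqrt a) * ennreal (f (Z t \<omega>)) \<partial>P x)"
          unfolding markov_op_def Gf using a f0 by (simp add: ennreal_mult)
        also have "\<dots> = ennreal (sqrt a) * markov_op t (\<lambda>y. ennreal (f y)) x"
          unfolding markov_op_def by (intro nn_integral_cmult measurable_compose[OF Z_measurable[OF t0]]) simp
        finally have "markov_op t (G n) x = ennreal (sqrt a) * ennreal (markov_sg P Z t f x)"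
          unfolding markov_op_ennreal(1)[OF t0 fm f0 fc] .
        then show ?thesis using a markov_op_ennreal(2)[OF t0 fm f0 fc]
          by (simp add: power_mult_distrib ennreal_power)
      qed
      have [measurable]: "markov_sg P Z t f \<in> borel_measurable borel" by (rule markov_sg_measurable[OF t0 fm])
      have "(\<integral>\<^sup>+x. indicator B x * (markov_op t (G n) x)\<^sup>2 \<partial>\<mu>) = (\<integral>\<^sup>+x. ennreal a * (indicator B x * ennreal ((markov_sg P Z t f x)\<^sup>2)) \<partial>\<mu>)"
        unfolding trG by (simp add: mult.left_commute)
      also have "\<dots> = ennreal a * (\<integral>\<^sup>+x. indicator B x * ennreal ((markov_sg P Z t f x)\<^sup>2) \<partial>\<mu>)"
        by (rule nn_integral_cmult) measurable
      also have "\<dots> \<le> ennreal a * ennreal e" by (intro mult_left_mono) (fact, simp)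
      finally show ?thesis using a e by (simp add: ennreal_mult mult.commute)
    qed
    have "(\<integral>\<^sup>+x. indicator B x * (markov_op t g x)\<^sup>2 \<partial>\<mu>) = (\<integral>\<^sup>+x. (SUP n. indicator B x * (markov_op t (G n) x)\<^sup>2) \<partial>\<mu>)"
      unfolding trSG[symmetric] SUP_power2_ennreal[OF inc_tr] by (simp add: SUP_mult_left_ennreal)
    also have "\<dots> = (SUP n. \<integral>\<^sup>+x. indicator B x * (markov_op t (G n) x)\<^sup>2 \<partial>\<mu>)"
      using inc_tr by (intro nn_integral_monotone_convergence_SUP)
        (auto simp: incseq_def le_fun_def intro!: mult_left_mono power_mono)
    also have "\<dots> \<le> ennreal (e * a)" by (intro SUP_least bound)
    finally show ?thesis .
  qed
  then show ?thesis using d by blast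
qed

end

section \<open>Domination of the eigenfunction by the survival probability\<close>

context killed_process
begin

text \<open>The counterpart of \<open>killed_sg\<close> for nonnegative extended functions, with
  which estimates can be made before any integrability is known.\<close>

definition killed_op :: "real \<Rightarrow> ('h \<Rightarrow> ennreal) \<Rightarrow> 'h \<Rightarrow> ennreal" where
  "killed_op t f x = (\<integral>\<^sup>+\<omega>. indicator (surv t) \<omega> * f (Z t \<omega>) \<partial>P x)"

abbreviation surv_prob :: "real \<Rightarrow> 'h \<Rightarrow> real" where
  "surv_prob t x \<equiv> measure (P x) (surv t)"

lemma surv_sets_P: "0 < t \<Longrightarrow> surv t \<in> sets (P x)"
  using surv_sets by simp

lemma Z_compose_measurable:
  "0 < t \<Longrightarrow> f \<in> borel \<rightarrow>\<^sub>M N \<Longrightarrow> (\<lambda>\<omega>. f (Z t \<omega>)) \<in> P x \<rightarrow>\<^sub>M N"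
  by (rule measurable_compose[OF Z_measurable]) simp

lemma killed_op_integrand_measurable:
  "0 < t \<Longrightarrow> f \<in> borel_measurable borel \<Longrightarrow> (\<lambda>\<omega>. indicator (surv t) \<omega> * f (Z t \<omega>) :: ennreal) \<in> borel_measurable (P x)"
  by (intro borel_measurable_times_ennreal borel_measurable_indicator surv_sets_P Z_compose_measurable)

lemma killed_op_measurable:
  "0 < t \<Longrightarrow> f \<in> borel_measurable borel \<Longrightarrow> killed_op t f \<in> borel_measurable borel"
  unfolding killed_op_def by (intro nn_integral_P_measurable killed_op_integrand_measurable)

lemma emeasure_surv: "emeasure (P x) (surv t) = ennreal (surv_prob t x)"
proof -
  interpret prob_space "P x" by (rule prob_space_P)
  show ?thesis by (rule emeasure_eq_measure)
qed

lemma surv_prob_le_1: "surv_prob t x \<le> 1"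
proof -
  interpret prob_space "P x" by (rule prob_space_P)
  show ?thesis by (rule prob_le_1)
qed

lemma surv_prob_measurable: "0 < t \<Longrightarrow> surv_prob t \<in> borel_measurable borel"
  using P_kernel[OF surv_sets[of t]] by (simp add: measure_def)

lemma killed_sg_eq: "killed_sg P Z E t f x = (\<integral>\<omega>. indicator (surv t) \<omega> * f (Z t \<omega>) \<partial>P x)"
  unfolding killed_sg_def by (intro Bochner_Integration.integral_cong) (auto simp: surv_def indicator_def)

lemma killed_sg_one: "0 < t \<Longrightarrow> killed_sg P Z E t (\<lambda>_. 1) x = surv_prob t x"
  unfolding killed_sg_eq using surv_sets_P[of t x] by (simp add: Int_absorb2 surv_def subset_iff)

lemma killed_sg_integrand_measurable:
  fixes f :: "'h \<Rightarrow> real"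
  shows "0 < t \<Longrightarrow> f \<in> borel_measurable borel \<Longrightarrow> (\<lambda>\<omega>. indicator (surv t) \<omega> * f (Z t \<omega>)) \<in> borel_measurable (P x)"
  by (intro borel_measurable_times borel_measurable_indicator surv_sets_P Z_compose_measurable)

lemma killed_sg_measurable:
  "0 < t \<Longrightarrow> f \<in> borel_measurable borel \<Longrightarrow> killed_sg P Z E t f \<in> borel_measurable borel"
  unfolding killed_sg_eq by (intro integral_P_measurable killed_sg_integrand_measurable)

lemma killed_op_mono:
  assumes "0 < t" "\<And>y. y \<in> E \<Longrightarrow> f y \<le> g y"
  shows "killed_op t f x \<le> killed_op t g x"
  unfolding killed_op_def using surv_in[of _ t t] assms
  by (intro nn_integral_mono) (auto simp: indicator_def)

lemma killed_op_add:
  assumes "0 < t" "f \<in> borel_measurable borel" "g \<in> borel_measurable borel"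
  shows "killed_op t (\<lambda>y. f y + g y) x = killed_op t f x + killed_op t g x"
  unfolding killed_op_def distrib_left using assms by (intro nn_integral_add killed_op_integrand_measurable)

lemma killed_op_cmult:
  assumes "0 < t" "f \<in> borel_measurable borel"
  shows "killed_op t (\<lambda>y. c * f y) x = c * killed_op t f x"
  unfolding killed_op_def mult.left_commute[of _ c] using assms by (intro nn_integral_cmult killed_op_integrand_measurable)

lemma killed_op_const:
  assumes "0 < t" shows "killed_op t (\<lambda>_. c) x = c * ennreal (surv_prob t x)"
  unfolding killed_op_def emeasure_surv[symmetric] using surv_sets_P[OF assms, of x]
  by (subst mult.commute) (rule nn_integral_cmult_indicator)

text \<open>Cauchy-Schwarz against the indicator of \<open>surv t\<close> gains the factor
  \<open>surv_prob t x\<close>. This factor compensates the division by the survival probability in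
  \<open>cond_surv\<close>.\<close>

lemma killed_op_power2_le:
  assumes "0 < t" "f \<in> borel_measurable borel"
  shows "(killed_op t f x)\<^sup>2 \<le> ennreal (surv_prob t x) * killed_op t (\<lambda>y. (f y)\<^sup>2) x"
proof -
  have "killed_op t f x = (\<integral>\<^sup>+\<omega>. indicator (surv t) \<omega> * (indicator (surv t) \<omega> * f (Z t \<omega>)) \<partial>P x)"
    unfolding killed_op_def by (intro nn_integral_cong) (simp add: indicator_def)
  then have "(killed_op t f x)\<^sup>2 \<le> (\<integral>\<^sup>+\<omega>. (indicator (surv t) \<omega>)\<^sup>2 \<partial>P x) * (\<integral>\<^sup>+\<omega>. (indicator (surv t) \<omega> * f (Z t \<omega>))\<^sup>2 \<partial>P x)"
    using Cauchy_Schwarz_nn_integral[OF borel_measurable_indicator[OF surv_sets_P[OF assms(1), of x]] killed_op_integrand_measurable[OF assms]]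
    by simp
  also have "(\<integral>\<^sup>+\<omega>. (indicator (surv t) \<omega>)\<^sup>2 \<partial>P x) = (\<integral>\<^sup>+\<omega>. indicator (surv t) \<omega> \<partial>P x)"
    by (intro nn_integral_cong) (simp add: indicator_def)
  also have "\<dots> = ennreal (surv_prob t x)"
    unfolding emeasure_surv[symmetric] by (rule nn_integral_indicator[OF surv_sets_P[OF assms(1)]])
  also have "(\<integral>\<^sup>+\<omega>. (indicator (surv t) \<omega> * f (Z t \<omega>))\<^sup>2 \<partial>P x) = killed_op t (\<lambda>y. (f y)\<^sup>2) x"
    unfolding killed_op_def by (intro nn_integral_cong) (simp add: indicator_def)
  finally show ?thesis .
qed

lemma killed_op_le_markov_op:
  assumes "0 < t" shows "killed_op t f x \<le> markov_op t (\<lambda>y. indicator E y * f y) x"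
  unfolding killed_op_def markov_op_def using surv_in[of _ t t] assms
  by (intro nn_integral_mono) (auto simp: indicator_def)

lemma nn_integral_killed_op_le:
  assumes inv: "invariant_prob P Z \<mu>" and t: "0 < t" and f: "f \<in> borel_measurable borel"
  shows "(\<integral>\<^sup>+x. killed_op t f x \<partial>\<mu>) \<le> (\<integral>\<^sup>+x. indicator E x * f x \<partial>\<mu>)"
proof -
  have "(\<integral>\<^sup>+x. killed_op t f x \<partial>\<mu>) \<le> (\<integral>\<^sup>+x. markov_op t (\<lambda>y. indicator E y * f y) x \<partial>\<mu>)"
    by (intro nn_integral_mono killed_op_le_markov_op t)
  also have "\<dots> = (\<integral>\<^sup>+x. indicator E x * f x \<partial>\<mu>)"
    using t f E_borel by (intro nn_integral_markov_op_invariant[OF inv]) auto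
  finally show ?thesis .
qed

lemma killed_sg_abs_le:
  assumes "0 < t" "f \<in> borel_measurable borel"
  shows "ennreal \<bar>killed_sg P Z E t f x\<bar> \<le> killed_op t (\<lambda>y. ennreal \<bar>f y\<bar>) x"
proof (cases "integrable (P x) (\<lambda>\<omega>. indicator (surv t) \<omega> * f (Z t \<omega>))")
  case True
  have "ennreal \<bar>killed_sg P Z E t f x\<bar> \<le> (\<integral>\<^sup>+\<omega>. ennreal (norm (indicator (surv t) \<omega> * f (Z t \<omega>))) \<partial>P x)"
    unfolding killed_sg_eq using integral_norm_bound_ennreal[OF True] by simp
  also have "\<dots> = killed_op t (\<lambda>y. ennreal \<bar>f y\<bar>) x"
    unfolding killed_op_def by (intro nn_integral_cong) (simp add: indicator_def)
  finally show ?thesis .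
next
  \<comment> \<open>Without integrability the Bochner integral is 0 by default, and the bound is
    trivial.\<close>
  case False
  then show ?thesis unfolding killed_sg_eq by (simp add: not_integrable_integral_eq)
qed

lemma killed_sg_centered_le:
  assumes "0 < t" "f \<in> borel_measurable borel"
  shows "ennreal \<bar>killed_sg P Z E t f x - c * surv_prob t x\<bar> \<le> killed_op t (\<lambda>y. ennreal (\<bar>f y\<bar> + \<bar>c\<bar>)) x"
proof -
  have "\<bar>killed_sg P Z E t f x - c * surv_prob t x\<bar> \<le> \<bar>killed_sg P Z E t f x\<bar> + \<bar>c\<bar> * surv_prob t x"
    using abs_triangle_ineq4[of "killed_sg P Z E t f x" "c * surv_prob t x"] by (simp add: abs_mult)
  then have "ennreal \<bar>killed_sg P Z E t f x - c * surv_prob t x\<bar> \<le> ennreal \<bar>killed_sg P Z E t f x\<bar> + ennreal \<bar>c\<bar> * ennreal (surv_prob t x)"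
    by (simp add: ennreal_leI ennreal_mult[symmetric] ennreal_plus[symmetric] del: ennreal_plus)
  also have "\<dots> \<le> killed_op t (\<lambda>y. ennreal \<bar>f y\<bar>) x + killed_op t (\<lambda>_. ennreal \<bar>c\<bar>) x"
    unfolding killed_op_const[OF assms(1)] by (intro add_mono killed_sg_abs_le assms) simp
  also have "\<dots> = killed_op t (\<lambda>y. ennreal \<bar>f y\<bar> + ennreal \<bar>c\<bar>) x"
    using assms by (intro killed_op_add[symmetric]) auto
  finally show ?thesis by simp
qed

lemma killed_op_surv_prob_le:
  assumes "0 < s" "0 < t"
  shows "killed_op s (\<lambda>y. ennreal (surv_prob t y)) x \<le> ennreal (surv_prob (s + t) x)"
  using surv_superadditive[OF assms, of x] unfolding killed_op_def emeasure_surv .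

text \<open>The part of the eigenfunction not dominated by the rescaled survival probability.\<close>

definition excess :: "real \<Rightarrow> real \<Rightarrow> ('h \<Rightarrow> real) \<Rightarrow> real \<Rightarrow> 'h \<Rightarrow> real" where
  "excess K l \<phi> t x = indicator E x * max 0 (\<phi> x - K * (exp (l * t) * surv_prob t x))"

lemma excess_nonneg: "0 \<le> excess K l \<phi> t x"
  by (simp add: excess_def)

lemma excess_measurable:
  assumes "0 < t" "\<phi> \<in> borel_measurable borel"
  shows "excess K l \<phi> t \<in> borel_measurable borel"
  unfolding excess_def using surv_prob_measurable[OF assms(1)] assms(2) E_borel by measurable

lemma le_excess: "x \<in> E \<Longrightarrow> \<phi> x \<le> K * (exp (l * t) * surv_prob t x) + excess K l \<phi> t x"
  by (simp add: excess_def)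

text \<open>Apply exp (l s) Q_s to \<open>le_excess\<close>: the eigenfunction equation restores
  \<open>\<phi>\<close> on the left, and \<open>killed_op_surv_prob_le\<close> absorbs the survival
  part on the right.\<close>

lemma killed_op_excess_bound:
  assumes s: "0 < s" and t: "0 < t" and K: "0 \<le> K" and \<phi>: "\<phi> \<in> borel_measurable borel"
    and pos: "\<And>y. y \<in> E \<Longrightarrow> 0 < \<phi> y"
    and eig: "killed_sg P Z E s \<phi> x = exp (- l * s) * \<phi> x" and x: "x \<in> E"
  shows "ennreal (\<phi> x) \<le> ennreal (K * (exp (l * (s + t)) * surv_prob (s + t) x)) + ennreal (exp (l * s)) * killed_op s (\<lambda>y. ennreal (excess K l \<phi> t y)) x"
proof -
  have m: "(\<lambda>y. ennreal (excess K l \<phi> t y)) \<in> borel_measurable borel" "(\<lambda>y. ennreal (surv_prob t y)) \<in> borel_measurable borel"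
    using excess_measurable[OF t \<phi>] surv_prob_measurable[OF t] by auto
  have m2: "(\<lambda>y. ennreal (K * exp (l * t)) * ennreal (surv_prob t y)) \<in> borel_measurable borel"
    using m(2) by measurable
  have "\<phi> x = exp (l * s) * \<bar>killed_sg P Z E s \<phi> x\<bar>"
    unfolding eig using pos[OF x] by (simp add: abs_mult exp_minus)
  then have "ennreal (\<phi> x) = ennreal (exp (l * s)) * ennreal \<bar>killed_sg P Z E s \<phi> x\<bar>"
    by (metis abs_ge_zero ennreal_mult exp_ge_zero)
  also have "\<dots> \<le> ennreal (exp (l * s)) * killed_op s (\<lambda>y. ennreal (K * exp (l * t)) * ennreal (surv_prob t y) + ennreal (excess K l \<phi> t y)) x"
  proof (rule mult_left_mono)
    have "ennreal \<bar>killed_sg P Z E s \<phi> x\<bar> \<le> killed_op s (\<lambda>y. ennreal \<bar>\<phi> y\<bar>) x" by (rule killed_sg_abs_le[OF s \<phi>])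
    also have "\<dots> \<le> killed_op s (\<lambda>y. ennreal (K * exp (l * t)) * ennreal (surv_prob t y) + ennreal (excess K l \<phi> t y)) x"
    proof (rule killed_op_mono[OF s])
      fix y assume y: "y \<in> E"
      have "\<bar>\<phi> y\<bar> \<le> K * exp (l * t) * surv_prob t y + excess K l \<phi> t y"
        using le_excess[OF y, of \<phi> K l t] pos[OF y] by (simp add: mult.assoc)
      then have "ennreal \<bar>\<phi> y\<bar> \<le> ennreal (K * exp (l * t) * surv_prob t y + excess K l \<phi> t y)" by (rule ennreal_leI)
      also have "\<dots> = ennreal (K * exp (l * t)) * ennreal (surv_prob t y) + ennreal (excess K l \<phi> t y)"
        using K by (simp add: ennreal_plus ennreal_mult excess_nonneg)
      finally show "ennreal \<bar>\<phi> y\<bar> \<le> ennreal (K * exp (l * t)) * ennreal (surv_prob t y) + ennreal (excess K l \<phi> t y)" .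
    qed
    finally show "ennreal \<bar>killed_sg P Z E s \<phi> x\<bar> \<le> killed_op s (\<lambda>y. ennreal (K * exp (l * t)) * ennreal (surv_prob t y) + ennreal (excess K l \<phi> t y)) x" .
  qed simp
  also have "\<dots> = ennreal (exp (l * s)) * (ennreal (K * exp (l * t)) * killed_op s (\<lambda>y. ennreal (surv_prob t y)) x) + ennreal (exp (l * s)) * killed_op s (\<lambda>y. ennreal (excess K l \<phi> t y)) x"
    unfolding killed_op_add[OF s m2 m(1)] killed_op_cmult[OF s m(2)] by (rule distrib_left)
  also have "\<dots> \<le> ennreal (exp (l * s)) * (ennreal (K * exp (l * t)) * ennreal (surv_prob (s + t) x)) + ennreal (exp (l * s)) * killed_op s (\<lambda>y. ennreal (excess K l \<phi> t y)) x"
    by (intro add_right_mono mult_left_mono killed_op_surv_prob_le s t) auto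
  also have "ennreal (exp (l * s)) * (ennreal (K * exp (l * t)) * ennreal (surv_prob (s + t) x)) = ennreal (K * (exp (l * (s + t)) * surv_prob (s + t) x))"
    using K by (simp add: ennreal_mult[symmetric] distrib_left exp_add mult_ac)
  finally show ?thesis .
qed

text \<open>The excess vanishes off the displayed set, whence the indicator.
  \<open>killed_op\<close> is enlarged to \<open>markov_op\<close> because compactness is assumed
  for the semigroup without killing.\<close>

lemma excess_step:
  assumes t: "0 < t" and K: "0 \<le> K" and \<phi>: "\<phi> \<in> borel_measurable borel"
    and pos: "\<And>y. y \<in> E \<Longrightarrow> 0 < \<phi> y"
    and eig: "x \<in> E \<Longrightarrow> killed_sg P Z E 1 \<phi> x = exp (- l * 1) * \<phi> x"
  shows "ennreal (excess K l \<phi> (1 + t) x)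
    \<le> indicator {x\<in>E. K * (exp (l * (1 + t)) * surv_prob (1 + t) x) < \<phi> x} x * (ennreal (exp l) * markov_op 1 (\<lambda>y. ennreal (excess K l \<phi> t y)) x)"
proof (cases "x \<in> E \<and> K * (exp (l * (1 + t)) * surv_prob (1 + t) x) < \<phi> x")
  case True
  then have x: "x \<in> E" and lt: "K * (exp (l * (1 + t)) * surv_prob (1 + t) x) < \<phi> x" by auto
  have nn: "0 \<le> K * (exp (l * (1 + t)) * surv_prob (1 + t) x)" using K by simp
  have "ennreal (excess K l \<phi> (1 + t) x) = ennreal (\<phi> x) - ennreal (K * (exp (l * (1 + t)) * surv_prob (1 + t) x))"
    using x lt nn by (simp add: excess_def ennreal_minus)
  also have "\<dots> \<le> ennreal (exp l) * killed_op 1 (\<lambda>y. ennreal (excess K l \<phi> t y)) x"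
    using killed_op_excess_bound[OF _ t K \<phi> pos eig[OF x] x] by (simp add: ennreal_minus_le_iff)
  also have "\<dots> \<le> ennreal (exp l) * markov_op 1 (\<lambda>y. ennreal (excess K l \<phi> t y)) x"
  proof (rule mult_left_mono)
    have "(\<lambda>y. indicator E y * ennreal (excess K l \<phi> t y)) = (\<lambda>y. ennreal (excess K l \<phi> t y))"
      by (auto simp: excess_def indicator_def)
    then show "killed_op 1 (\<lambda>y. ennreal (excess K l \<phi> t y)) x \<le> markov_op 1 (\<lambda>y. ennreal (excess K l \<phi> t y)) x"
      using killed_op_le_markov_op[of 1 "\<lambda>y. ennreal (excess K l \<phi> t y)" x] by simp
  qed simp
  finally show ?thesis using True by simp
next
  case False
  then have "excess K l \<phi> (1 + t) x = 0" by (auto simp: excess_def)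
  then show ?thesis by simp
qed

end

text \<open>To be read at a point: \<open>q\<close> is Q_t 1, \<open>D\<close> is abs (Q_t f - c Q_t
  1), \<open>H\<close> and \<open>H2\<close> are Q_t of abs f + abs c and of its square,
  \<open>z\<close> is the excess, \<open>\<Psi>\<close> and \<open>\<Psi>2\<close> are Q_t of z and
  of z^2, \<open>e\<close> is exp (lam1 t) and \<open>G\<close> is exp (gamma t). The right side is
  free of division by \<open>q\<close>, and each of its terms can be integrated.\<close>

lemma weighted_ratio_bound:
  fixes q D H H2 \<Psi> \<Psi>2 z \<phi> K e G :: real
  assumes q: "0 < q" and D: "0 \<le> D" "D \<le> H" and H2: "H\<^sup>2 \<le> q * H2"
    and \<Psi>: "0 \<le> \<Psi>" "\<Psi>\<^sup>2 \<le> q * \<Psi>2" and z: "0 \<le> z" "z \<le> \<phi>"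
    and K: "0 < K" and e: "0 < e" and G: "0 < G"
    and \<phi>1: "\<phi> \<le> K * (e * q) + z" and \<phi>2: "\<phi> \<le> e * (K * e * q + \<Psi>)"
  shows "D / q * \<phi> \<le> K * (e * D) + 1 / G + K\<^sup>2 * e ^ 4 * G ^ 3 * z\<^sup>2 + 2 / G * H2 + e\<^sup>2 * G * \<Psi>2"
proof -
  define T where "T = H / q"
  have T0: "0 \<le> T" and DT: "D / q \<le> T" using q D by (auto simp: T_def divide_right_mono)
  have qT2: "q * T\<^sup>2 \<le> H2"
  proof -
    have "q * T\<^sup>2 = H\<^sup>2 / q" using q by (simp add: T_def power2_eq_square)
    also have "\<dots> \<le> H2" using H2 q by (simp add: divide_le_eq mult.commute)
    finally show ?thesis .
  qed
  \<comment> \<open>By \<open>\<phi>2\<close>, \<open>\<rho> * q\<close> bounds what remains of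
    \<open>z\<close> after \<open>e * \<Psi>\<close> is removed. The weight \<open>\<theta>\<close>
    is chosen so that \<open>\<rho> * q * (T\<^sup>2 / \<theta>)\<close> equals
    \<open>q * T\<^sup>2 / G\<close>.\<close>
  define \<rho> where "\<rho> = K * e\<^sup>2"
  define \<theta> where "\<theta> = \<rho> * G"
  have \<rho>: "0 < \<rho>" and \<theta>: "0 < \<theta>" using K e G by (auto simp: \<rho>_def \<theta>_def)
  have amgm: "a * b \<le> r * a\<^sup>2 + b\<^sup>2 / r" if "0 < r" for a b r :: real
  proof -
    have "0 \<le> (r * a - b)\<^sup>2 + r\<^sup>2 * a\<^sup>2 + b\<^sup>2" by simp
    then have "2 * (r * (a * b)) \<le> 2 * (r * (r * a\<^sup>2 + b\<^sup>2 / r))"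
      using that by (simp add: power2_diff power2_eq_square algebra_simps)
    then show ?thesis using that by simp
  qed
  have split: "z * T \<le> \<theta> * z + H2 / G + e * (\<Psi> * T)"
  proof (cases "z \<le> e * \<Psi>")
    case True
    then have "z * T \<le> e * \<Psi> * T" using T0 by (intro mult_right_mono) auto
    moreover have "0 \<le> H2" using qT2 q by (meson order_trans zero_le_mult_iff zero_le_power2 less_imp_le)
    ultimately show ?thesis using \<theta> z G by (simp add: mult.assoc add_increasing)
  next
    case False
    define v where "v = z - e * \<Psi>"
    have v: "0 \<le> v" "v \<le> z" "v \<le> \<rho> * q"
      using False e \<Psi> z \<phi>2 by (auto simp: v_def \<rho>_def power2_eq_square algebra_simps)
    have "1 * T \<le> \<theta> * 1\<^sup>2 + T\<^sup>2 / \<theta>" by (rule amgm[OF \<theta>])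
    then have "v * T \<le> v * (\<theta> + T\<^sup>2 / \<theta>)" using v by (intro mult_left_mono) auto
    also have "\<dots> = v * \<theta> + v * (T\<^sup>2 / \<theta>)" by (simp add: distrib_left)
    also have "\<dots> \<le> z * \<theta> + \<rho> * q * (T\<^sup>2 / \<theta>)"
      using v \<theta> by (intro add_mono mult_right_mono) auto
    also have "\<rho> * q * (T\<^sup>2 / \<theta>) = q * T\<^sup>2 / G" using \<rho> by (simp add: \<theta>_def)
    also have "\<dots> \<le> H2 / G" using qT2 G by (intro divide_right_mono) auto
    finally have "v * T \<le> \<theta> * z + H2 / G" by (simp add: mult.commute)
    moreover have "z * T = v * T + e * (\<Psi> * T)" by (simp add: v_def algebra_simps)
    ultimately show ?thesis by simp
  qed
  have "e * (\<Psi> * T) \<le> e\<^sup>2 * G * \<Psi>2 + H2 / G"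
  proof -
    \<comment> \<open>The weight \<open>e * G / q\<close> makes the two squares appear as
      \<open>\<Psi>\<^sup>2 / q\<close> and \<open>q * T\<^sup>2\<close>, which
      \<open>\<Psi>2\<close> and \<open>H2\<close> bound.\<close>
    have "\<Psi> * T \<le> e * G / q * \<Psi>\<^sup>2 + T\<^sup>2 / (e * G / q)" using e G q by (intro amgm) auto
    also have "\<dots> = e * G * (\<Psi>\<^sup>2 / q) + q * T\<^sup>2 / (e * G)" by simp
    also have "\<dots> \<le> e * G * \<Psi>2 + H2 / (e * G)"
      using \<Psi>(2) q e G qT2 by (intro add_mono mult_left_mono divide_right_mono) (auto simp: divide_le_eq mult.commute)
    finally have "e * (\<Psi> * T) \<le> e * (e * G * \<Psi>2 + H2 / (e * G))" using e by (intro mult_left_mono) auto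
    also have "\<dots> = e\<^sup>2 * G * \<Psi>2 + H2 / G" using e by (simp add: power2_eq_square distrib_left)
    finally show ?thesis .
  qed
  moreover have "\<theta> * z \<le> 1 / G + K\<^sup>2 * e ^ 4 * G ^ 3 * z\<^sup>2"
  proof -
    have "1 * (\<theta> * z) \<le> 1 / G * 1\<^sup>2 + (\<theta> * z)\<^sup>2 / (1 / G)" using G by (intro amgm) auto
    also have "\<dots> = 1 / G + K\<^sup>2 * e ^ 4 * G ^ 3 * z\<^sup>2"
      by (simp add: \<theta>_def \<rho>_def power_mult_distrib power2_eq_square power3_eq_cube power4_eq_xxxx)
    finally show ?thesis by simp
  qed
  moreover have "D / q * \<phi> \<le> K * (e * D) + z * T"
  proof -
    have "D / q * \<phi> \<le> D / q * (K * (e * q) + z)" using D q by (intro mult_left_mono \<phi>1) auto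
    also have "\<dots> = K * (e * D) + z * (D / q)" using q by (simp add: field_simps)
    also have "\<dots> \<le> K * (e * D) + z * T" using DT z by (intro add_left_mono mult_left_mono) auto
    finally show ?thesis .
  qed
  ultimately show ?thesis using split by simp
qed

section \<open>Decay of the excess\<close>

context killed_process
begin

text \<open>The rate \<open>k\<close> is arbitrary: once the set carrying the excess is small
  enough, each unit of time multiplies the bound on the squared norm by \<open>exp (- k)\<close>.
  The unit steps start at a time between \<open>T\<close> and \<open>T + 1\<close>, where the norm
  of \<open>\<phi>\<close> gives a bound independent of \<open>t\<close>.\<close>

lemma excess_decay:
  assumes inv: "invariant_prob P Z \<mu>" and comp: "compact_on_L2 P Z \<mu>"
    and K: "0 \<le> K" and \<phi>: "\<phi> \<in> borel_measurable borel"
    and pos: "\<And>y. y \<in> E \<Longrightarrow> 0 < \<phi> y"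
    and eig: "AE x in \<mu>. x \<in> E \<longrightarrow> killed_sg P Z E 1 \<phi> x = exp (- l * 1) * \<phi> x"
    and L2: "(\<integral>\<^sup>+x. indicator E x * ennreal ((\<phi> x)\<^sup>2) \<partial>\<mu>) < \<infinity>"
    and small: "\<And>d. 0 < d \<Longrightarrow> \<exists>T. \<forall>t\<ge>T. emeasure \<mu> {x\<in>E. K * (exp (l * t) * surv_prob t x) < \<phi> x} < ennreal d"
    and k: "0 \<le> k"
  shows "\<exists>C>0. \<exists>T>0. \<forall>t\<ge>T. (\<integral>\<^sup>+x. ennreal ((excess K l \<phi> t x)\<^sup>2) \<partial>\<mu>) \<le> ennreal (C * exp (- k * t))"
proof -
  have [measurable_cong]: "sets \<mu> = sets borel" using inv by (simp add: invariant_prob_def)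
  note [measurable] = \<phi> E_borel
  \<comment> \<open>The part \<open>- 2 * l\<close> of the exponent pays for the square of the
    factor \<open>exp l\<close> in \<open>excess_step\<close>.\<close>
  obtain d where d: "0 < d" and dB: "\<And>B g a. B \<in> sets borel \<Longrightarrow> emeasure \<mu> B < ennreal d \<Longrightarrow> g \<in> borel_measurable borel \<Longrightarrow>
    0 < a \<Longrightarrow> (\<integral>\<^sup>+x. (g x)\<^sup>2 \<partial>\<mu>) \<le> ennreal a \<Longrightarrow>
    (\<integral>\<^sup>+x. indicator B x * (markov_op 1 g x)\<^sup>2 \<partial>\<mu>) \<le> ennreal (exp (- k - 2 * l) * a)"
    using compact_small_sets[OF inv comp zero_less_one, of "exp (- k - 2 * l)"] by (auto simp del: One_nat_def)
  obtain T0 where T0: "\<And>t. T0 \<le> t \<Longrightarrow> emeasure \<mu> {x\<in>E. K * (exp (l * t) * surv_prob t x) < \<phi> x} < ennreal d"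
    using small[OF d] by blast
  define T where "T = max T0 1"
  define A where "A = enn2real (\<integral>\<^sup>+x. indicator E x * ennreal ((\<phi> x)\<^sup>2) \<partial>\<mu>) + 1"
  have A: "0 < A" unfolding A_def by (simp add: add_nonneg_pos)
  have L2A: "(\<integral>\<^sup>+x. indicator E x * ennreal ((\<phi> x)\<^sup>2) \<partial>\<mu>) \<le> ennreal A"
  proof -
    have "(\<integral>\<^sup>+x. indicator E x * ennreal ((\<phi> x)\<^sup>2) \<partial>\<mu>) = ennreal (enn2real (\<integral>\<^sup>+x. indicator E x * ennreal ((\<phi> x)\<^sup>2) \<partial>\<mu>))"
      using L2 by (simp add: less_top)
    also have "\<dots> \<le> ennreal A" unfolding A_def by (intro ennreal_leI) simp
    finally show ?thesis .
  qed
  have base: "(\<integral>\<^sup>+x. ennreal ((excess K l \<phi> t x)\<^sup>2) \<partial>\<mu>) \<le> ennreal A" for t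
  proof -
    have "(\<integral>\<^sup>+x. ennreal ((excess K l \<phi> t x)\<^sup>2) \<partial>\<mu>) \<le> (\<integral>\<^sup>+x. indicator E x * ennreal ((\<phi> x)\<^sup>2) \<partial>\<mu>)"
    proof (rule nn_integral_mono)
      fix x
      have "excess K l \<phi> t x \<le> \<phi> x" if "x \<in> E"
        using that pos[OF that] K by (simp add: excess_def)
      then show "ennreal ((excess K l \<phi> t x)\<^sup>2) \<le> indicator E x * ennreal ((\<phi> x)\<^sup>2)"
        using excess_nonneg[of K l \<phi> t x]
        by (cases "x \<in> E") (auto intro!: ennreal_leI power_mono simp: excess_def[of K l \<phi> t x])
    qed
    with L2A show ?thesis by (rule order_trans[rotated])
  qed
  have step: "(\<integral>\<^sup>+x. ennreal ((excess K l \<phi> (1 + t) x)\<^sup>2) \<partial>\<mu>) \<le> ennreal (exp (- k) * a)"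
    if t: "T \<le> t" and a: "0 < a" and Ia: "(\<integral>\<^sup>+x. ennreal ((excess K l \<phi> t x)\<^sup>2) \<partial>\<mu>) \<le> ennreal a" for t a
  proof -
    have t0: "0 < t" "T0 \<le> 1 + t" using t by (auto simp: T_def)
    define B where "B = {x\<in>E. K * (exp (l * (1 + t)) * surv_prob (1 + t) x) < \<phi> x}"
    have [measurable]: "surv_prob (1 + t) \<in> borel_measurable borel" using t0 by (intro surv_prob_measurable) simp
    have "{x \<in> space borel. x \<in> E \<and> K * (exp (l * (1 + t)) * surv_prob (1 + t) x) < \<phi> x} \<in> sets borel" by measurable
    then have B[measurable]: "B \<in> sets borel" by (simp add: B_def)
    define g where "g x = ennreal (excess K l \<phi> t x)" for x
    have g[measurable]: "g \<in> borel_measurable borel" unfolding g_def using excess_measurable[OF t0(1) \<phi>] by measurable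
    have g2: "(g x)\<^sup>2 = ennreal ((excess K l \<phi> t x)\<^sup>2)" for x
      unfolding g_def by (simp add: ennreal_power excess_nonneg)
    have [measurable]: "markov_op 1 g \<in> borel_measurable borel" using g by (intro markov_op_measurable) auto
    have "(\<integral>\<^sup>+x. ennreal ((excess K l \<phi> (1 + t) x)\<^sup>2) \<partial>\<mu>) \<le> (\<integral>\<^sup>+x. ennreal (exp (2 * l)) * (indicator B x * (markov_op 1 g x)\<^sup>2) \<partial>\<mu>)"
    proof (rule nn_integral_mono_AE)
      show "AE x in \<mu>. ennreal ((excess K l \<phi> (1 + t) x)\<^sup>2) \<le> ennreal (exp (2 * l)) * (indicator B x * (markov_op 1 g x)\<^sup>2)"
        using eig
      proof eventually_elim
        case (elim x)
        have "ennreal (excess K l \<phi> (1 + t) x) \<le> indicator B x * (ennreal (exp l) * markov_op 1 g x)"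
          unfolding B_def g_def by (rule excess_step[OF t0(1) K \<phi> pos]) (use elim in auto)
        then have "(ennreal (excess K l \<phi> (1 + t) x))\<^sup>2 \<le> (indicator B x * (ennreal (exp l) * markov_op 1 g x))\<^sup>2"
          by (intro power_mono) auto
        also have "\<dots> = ennreal (exp (2 * l)) * (indicator B x * (markov_op 1 g x)\<^sup>2)"
          by (cases "x \<in> B") (simp_all add: power_mult_distrib ennreal_power exp_double)
        finally show ?case by (simp add: ennreal_power excess_nonneg)
      qed
    qed
    also have "\<dots> = ennreal (exp (2 * l)) * (\<integral>\<^sup>+x. indicator B x * (markov_op 1 g x)\<^sup>2 \<partial>\<mu>)"
      by (rule nn_integral_cmult) measurable
    also have "\<dots> \<le> ennreal (exp (2 * l)) * ennreal (exp (- k - 2 * l) * a)"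
      using T0[OF t0(2)] Ia by (intro mult_left_mono dB B g a) (simp_all add: B_def g2)
    also have "\<dots> = ennreal (exp (- k) * a)"
      using a by (simp add: ennreal_mult[symmetric] mult.assoc[symmetric] exp_add[symmetric])
    finally show ?thesis .
  qed
  have iter: "(\<integral>\<^sup>+x. ennreal ((excess K l \<phi> (t + real n) x)\<^sup>2) \<partial>\<mu>) \<le> ennreal (exp (- k) ^ n * A)" if "T \<le> t" for t n
  proof (induction n)
    case 0 then show ?case using base by simp
  next
    case (Suc n)
    have "(\<integral>\<^sup>+x. ennreal ((excess K l \<phi> (1 + (t + real n)) x)\<^sup>2) \<partial>\<mu>) \<le> ennreal (exp (- k) * (exp (- k) ^ n * A))"
      using that A by (intro step Suc.IH) auto
    then show ?case by (simp add: algebra_simps)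
  qed
  have "(\<integral>\<^sup>+x. ennreal ((excess K l \<phi> t x)\<^sup>2) \<partial>\<mu>) \<le> ennreal (A * exp (k * (T + 1)) * exp (- k * t))" if t: "T \<le> t" for t
  proof -
    define n where "n = nat \<lfloor>t - T\<rfloor>"
    have n: "real n \<le> t - T" "t - T < real n + 1" using t unfolding n_def by linarith+
    have "(\<integral>\<^sup>+x. ennreal ((excess K l \<phi> t x)\<^sup>2) \<partial>\<mu>) \<le> ennreal (exp (- k) ^ n * A)"
      using iter[of "t - real n" n] n by simp
    also have "\<dots> \<le> ennreal (A * exp (k * (T + 1)) * exp (- k * t))"
    proof (rule ennreal_leI)
      have "exp (- k) ^ n = exp (- k * real n)" by (simp add: exp_of_nat_mult[symmetric] mult.commute)
      also have "\<dots> \<le> exp (k * (T + 1) - k * t)"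
      proof -
        have "k * (t - T) \<le> k * (real n + 1)" using n k by (intro mult_left_mono) auto
        then show ?thesis by (simp add: algebra_simps)
      qed
      also have "\<dots> = exp (k * (T + 1)) * exp (- k * t)" by (simp add: exp_add[symmetric])
      finally have "A * exp (- k) ^ n \<le> A * (exp (k * (T + 1)) * exp (- k * t))" using A by (intro mult_left_mono) auto
      then show "exp (- k) ^ n * A \<le> A * exp (k * (T + 1)) * exp (- k * t)" by (simp add: mult_ac)
    qed
    finally show ?thesis .
  qed
  moreover have "0 < A * exp (k * (T + 1))" "0 < T" using A by (auto simp: T_def)
  ultimately show ?thesis by blast
qed

text \<open>The set where \<open>\<phi>\<close> is below \<open>\<eta>\<close> is small since
  \<open>\<phi>\<close> is positive on \<open>E\<close>. On the rest, membership forces the rescaled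
  survival probability to differ from \<open>\<phi> / M\<close> by at least
  \<open>\<eta> / (2 * M)\<close>, and Chebyshev's inequality applies.\<close>

lemma low_survival_set_small:
  assumes inv: "invariant_prob P Z \<mu>" and M: "0 < M" and \<phi>: "\<phi> \<in> borel_measurable borel"
    and pos: "\<And>y. y \<in> E \<Longrightarrow> 0 < \<phi> y" and \<gamma>: "0 < \<gamma>" and c: "0 \<le> c"
    and gap: "\<And>t. T0 \<le> t \<Longrightarrow> (\<integral>\<^sup>+x. indicator E x * ennreal ((exp (l * t) * surv_prob t x - \<phi> x / M)\<^sup>2) \<partial>\<mu>) \<le> ennreal (c * exp (- 2 * \<gamma> * t))"
    and d: "0 < d"
  shows "\<exists>T. \<forall>t\<ge>T. emeasure \<mu> {x\<in>E. 2 * M * (exp (l * t) * surv_prob t x) < \<phi> x} < ennreal d"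
proof -
  interpret prob_space \<mu> using inv by (simp add: invariant_prob_def)
  have sets_mu[measurable_cong]: "sets \<mu> = sets borel" using inv by (simp add: invariant_prob_def)
  have space_mu: "space \<mu> = UNIV" using sets_eq_imp_space_eq[OF sets_mu] by simp
  note [measurable] = \<phi> E_borel
  define L where "L n = {x\<in>E. \<phi> x < 1 / real (Suc n)}" for n
  have "{x \<in> space borel. x \<in> E \<and> \<phi> x < 1 / real (Suc n)} \<in> sets borel" for n by measurable
  then have L[measurable]: "L n \<in> sets borel" for n by (simp add: L_def)
  have decL: "decseq L"
    unfolding L_def by (intro decseq_SucI) (auto intro: less_le_trans simp: frac_le)
  have "(\<Inter>n. L n) = {}"
  proof (rule ccontr)
    assume "(\<Inter>n. L n) \<noteq> {}"
    then obtain x where x: "\<And>n. x \<in> L n" by blast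
    then have "0 < \<phi> x" using pos by (auto simp: L_def)
    then obtain n where "1 / real (Suc n) < \<phi> x" using nat_approx_posE by blast
    with x[of n] show False by (simp add: L_def)
  qed
  then have "(INF n. emeasure \<mu> (L n)) = 0"
    using INF_emeasure_decseq[of L \<mu>] decL L by (simp add: sets_mu image_subset_iff)
  moreover have "0 < ennreal (d / 2)" using d by (simp add: ennreal_less_zero_iff)
  ultimately obtain n where n: "emeasure \<mu> (L n) < ennreal (d / 2)" by (metis INF_less_iff)
  define \<eta> where "\<eta> = 1 / real (Suc n)"
  define \<epsilon> where "\<epsilon> = (\<eta> / (2 * M))\<^sup>2"
  have \<eta>: "0 < \<eta>" and \<epsilon>: "0 < \<epsilon>" using M by (auto simp: \<eta>_def \<epsilon>_def)
  have "((\<lambda>t. c / \<epsilon> * exp (- 2 * \<gamma> * t)) \<longlongrightarrow> 0) at_top" using \<gamma> by real_asymp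
  from order_tendstoD(2)[OF this, of "d / 2"] d
  have "eventually (\<lambda>t. c / \<epsilon> * exp (- 2 * \<gamma> * t) < d / 2) at_top" by simp
  then obtain T1 where T1: "\<And>t. T1 \<le> t \<Longrightarrow> c / \<epsilon> * exp (- 2 * \<gamma> * t) < d / 2"
    unfolding eventually_at_top_linorder by blast
  have "emeasure \<mu> {x\<in>E. 2 * M * (exp (l * t) * surv_prob t x) < \<phi> x} < ennreal d" if t: "max (max T0 T1) 1 \<le> t" for t
  proof -
    have [measurable]: "surv_prob t \<in> borel_measurable borel" using t by (intro surv_prob_measurable) simp
    let ?B = "{x\<in>E. 2 * M * (exp (l * t) * surv_prob t x) < \<phi> x}"
    have "{x\<in>space borel. x \<in> E \<and> 2 * M * (exp (l * t) * surv_prob t x) < \<phi> x} \<in> sets borel" by measurable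
    then have B: "?B \<in> sets borel" by simp
    let ?u = "\<lambda>x. (exp (l * t) * surv_prob t x - \<phi> x / M)\<^sup>2"
    have "emeasure \<mu> ?B = (\<integral>\<^sup>+x. indicator ?B x \<partial>\<mu>)" using B by (simp add: sets_mu)
    also have "\<dots> \<le> (\<integral>\<^sup>+x. indicator (L n) x + ennreal (1 / \<epsilon>) * (indicator E x * ennreal (?u x)) \<partial>\<mu>)"
    proof (rule nn_integral_mono)
      fix x
      show "indicator ?B x \<le> indicator (L n) x + ennreal (1 / \<epsilon>) * (indicator E x * ennreal (?u x))"
      proof (cases "x \<in> ?B \<and> x \<notin> L n")
        case True
        then have x: "x \<in> E" "2 * M * (exp (l * t) * surv_prob t x) < \<phi> x" "\<eta> \<le> \<phi> x" by (auto simp: L_def \<eta>_def)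
        have "\<eta> / (2 * M) \<le> \<phi> x / (2 * M)" using x(3) M by (intro divide_right_mono) auto
        also have "\<dots> \<le> \<phi> x / M - exp (l * t) * surv_prob t x" using x(2) M by (simp add: field_simps)
        finally have "\<epsilon> \<le> (\<phi> x / M - exp (l * t) * surv_prob t x)\<^sup>2"
          unfolding \<epsilon>_def using \<eta> M by (intro power_mono) auto
        then have "1 \<le> 1 / \<epsilon> * ?u x" using \<epsilon> by (simp add: power2_commute le_divide_eq)
        then have "ennreal 1 \<le> ennreal (1 / \<epsilon> * ?u x)" by (rule ennreal_leI)
        also have "\<dots> = ennreal (1 / \<epsilon>) * ennreal (?u x)" using \<epsilon> by (intro ennreal_mult) auto
        finally show ?thesis using x(1) True by simp
      qed (auto simp: indicator_def)
    qed
    also have "\<dots> = emeasure \<mu> (L n) + ennreal (1 / \<epsilon>) * (\<integral>\<^sup>+x. indicator E x * ennreal (?u x) \<partial>\<mu>)"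
      by (subst nn_integral_add) (auto simp: nn_integral_cmult sets_mu)
    also have "\<dots> \<le> emeasure \<mu> (L n) + ennreal (1 / \<epsilon>) * ennreal (c * exp (- 2 * \<gamma> * t))"
      using t by (intro add_left_mono mult_left_mono gap) auto
    also have "ennreal (1 / \<epsilon>) * ennreal (c * exp (- 2 * \<gamma> * t)) = ennreal (c / \<epsilon> * exp (- 2 * \<gamma> * t))"
      using \<epsilon> c by (simp add: ennreal_mult[symmetric])
    also have "emeasure \<mu> (L n) + \<dots> < ennreal (d / 2) + ennreal (d / 2)"
      using n T1[of t] t d by (intro add_strict_mono ennreal_lessI) auto
    also have "\<dots> = ennreal d" using d by (simp add: ennreal_plus[symmetric] del: ennreal_plus)
    finally show ?thesis .
  qed
  then show ?thesis by blast
qed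

end

section \<open>Pointwise estimate of the conditional expectation and conclusion\<close>

context killed_process
begin

text \<open>Verifies the hypotheses of \<open>weighted_ratio_bound\<close> at one point. The two
  \<open>killed_op\<close> terms stay in \<open>ennreal\<close>: if one is infinite the claim is
  trivial, otherwise the computation takes place in the reals.\<close>

lemma cond_surv_pointwise:
  assumes t: "0 < t" and K: "0 < K" and G: "0 < G" and \<phi>: "\<phi> \<in> borel_measurable borel"
    and pos: "\<And>y. y \<in> E \<Longrightarrow> 0 < \<phi> y" and f: "f \<in> borel_measurable borel" and x: "x \<in> E"
    and eig: "killed_sg P Z E t \<phi> x = exp (- l * t) * \<phi> x"
  shows "ennreal (\<bar>cond_surv P Z E t f x - c\<bar> * \<phi> x)
    \<le> ennreal (K * (exp (l * t) * \<bar>killed_sg P Z E t f x - c * surv_prob t x\<bar>) + 1 / G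
          + K\<^sup>2 * exp (l * t) ^ 4 * G ^ 3 * (excess K l \<phi> t x)\<^sup>2)
      + ennreal (2 / G) * killed_op t (\<lambda>y. ennreal ((\<bar>f y\<bar> + \<bar>c\<bar>)\<^sup>2)) x
      + ennreal ((exp (l * t))\<^sup>2 * G) * killed_op t (\<lambda>y. ennreal ((excess K l \<phi> t y)\<^sup>2)) x"
    (is "?L \<le> ennreal ?R + ennreal ?a * ?H2 + ennreal ?b * ?\<Psi>2")
proof (cases "?H2 = top \<or> ?\<Psi>2 = top")
  case True
  have "0 < ?a" "0 < ?b" using G by auto
  with True show ?thesis by (auto simp: ennreal_mult_top ennreal_top_mult)
next
  case False
  define q where "q = surv_prob t x"
  define e where "e = exp (l * t)"
  define z where "z = excess K l \<phi> t x"
  have q: "0 < q" unfolding q_def by (rule surv_measure_pos[OF x t])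
  have e: "0 < e" by (simp add: e_def)
  from False obtain h2 where h2: "?H2 = ennreal h2" "0 \<le> h2" by (cases ?H2) auto
  from False obtain p2 where p2: "?\<Psi>2 = ennreal p2" "0 \<le> p2" by (cases ?\<Psi>2) auto
  have sq: "\<exists>h\<ge>0. killed_op t (\<lambda>y. ennreal (g y)) x = ennreal h \<and> h\<^sup>2 \<le> q * w"
    if g: "g \<in> borel_measurable borel" "\<And>y. 0 \<le> g y" and w: "killed_op t (\<lambda>y. ennreal ((g y)\<^sup>2)) x = ennreal w" "0 \<le> w" for g w
  proof -
    have m: "(\<lambda>y. ennreal (g y)) \<in> borel_measurable borel" using g(1) by measurable
    have eq: "(\<lambda>y. (ennreal (g y))\<^sup>2) = (\<lambda>y. ennreal ((g y)\<^sup>2))" using g(2) by (simp add: ennreal_power)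
    have le: "(killed_op t (\<lambda>y. ennreal (g y)) x)\<^sup>2 \<le> ennreal (q * w)"
      using killed_op_power2_le[OF t m, of x] unfolding eq w(1) q_def[symmetric] using q w(2) by (simp add: ennreal_mult)
    have "killed_op t (\<lambda>y. ennreal (g y)) x \<noteq> top"
    proof
      assume "killed_op t (\<lambda>y. ennreal (g y)) x = top"
      with le show False by (simp add: power2_eq_square ennreal_mult_top top_unique)
    qed
    then obtain h where h: "killed_op t (\<lambda>y. ennreal (g y)) x = ennreal h" "0 \<le> h" by (cases "killed_op t (\<lambda>y. ennreal (g y)) x") auto
    have "ennreal (h\<^sup>2) \<le> ennreal (q * w)" using le unfolding h(1) using h(2) by (simp add: ennreal_power)
    then have "h\<^sup>2 \<le> q * w" using q w(2) by (simp add: ennreal_le_iff)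
    then show ?thesis using h by blast
  qed
  have mf: "(\<lambda>y. \<bar>f y\<bar> + \<bar>c\<bar>) \<in> borel_measurable borel" using f by measurable
  obtain H where H: "0 \<le> H" "killed_op t (\<lambda>y. ennreal (\<bar>f y\<bar> + \<bar>c\<bar>)) x = ennreal H" "H\<^sup>2 \<le> q * h2"
    using sq[OF mf _ h2] by auto
  obtain \<Psi> where \<Psi>: "0 \<le> \<Psi>" "killed_op t (\<lambda>y. ennreal (excess K l \<phi> t y)) x = ennreal \<Psi>" "\<Psi>\<^sup>2 \<le> q * p2"
    using sq[OF excess_measurable[OF t \<phi>] excess_nonneg p2] by auto
  define D where "D = \<bar>killed_sg P Z E t f x - c * surv_prob t x\<bar>"
  have "ennreal D \<le> ennreal H" unfolding D_def H(2)[symmetric] by (rule killed_sg_centered_le[OF t f])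
  then have DH: "D \<le> H" using H(1) by (simp add: ennreal_le_iff)
  have z: "0 \<le> z" "z \<le> \<phi> x" "\<phi> x \<le> K * (e * q) + z"
    unfolding z_def e_def q_def using excess_nonneg le_excess[OF x] x pos[OF x] K by (auto simp: excess_def)
  \<comment> \<open>The eigenfunction equation over the whole time \<open>t\<close>, with the crude
    bound 1 for \<open>surv_prob t\<close> under the operator. This costs a second factor
    \<open>e\<close>, but the constant \<open>K * e\<close> is then multiplied by
    \<open>q\<close>.\<close>
  have "\<phi> x \<le> e * (K * e * q + \<Psi>)"
  proof -
    have "ennreal \<bar>killed_sg P Z E t \<phi> x\<bar> \<le> killed_op t (\<lambda>y. ennreal \<bar>\<phi> y\<bar>) x" by (rule killed_sg_abs_le[OF t \<phi>])
    also have "\<dots> \<le> killed_op t (\<lambda>y. ennreal (K * e) + ennreal (excess K l \<phi> t y)) x"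
    proof (rule killed_op_mono[OF t])
      fix y assume y: "y \<in> E"
      have "K * (e * surv_prob t y) \<le> K * (e * 1)" using K e surv_prob_le_1 by (intro mult_left_mono) auto
      then have "\<bar>\<phi> y\<bar> \<le> K * e + excess K l \<phi> t y"
        using le_excess[OF y, of \<phi> K l t] pos[OF y] by (simp add: e_def)
      then have "ennreal \<bar>\<phi> y\<bar> \<le> ennreal (K * e + excess K l \<phi> t y)" by (rule ennreal_leI)
      also have "\<dots> = ennreal (K * e) + ennreal (excess K l \<phi> t y)"
        using K e by (intro ennreal_plus) (auto simp: excess_nonneg)
      finally show "ennreal \<bar>\<phi> y\<bar> \<le> ennreal (K * e) + ennreal (excess K l \<phi> t y)" .
    qed
    also have "\<dots> = killed_op t (\<lambda>_. ennreal (K * e)) x + killed_op t (\<lambda>y. ennreal (excess K l \<phi> t y)) x"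
      using excess_measurable[OF t \<phi>] by (intro killed_op_add[OF t]) auto
    also have "\<dots> = ennreal (K * e * q + \<Psi>)"
      unfolding killed_op_const[OF t] \<Psi>(2) q_def[symmetric] using K e q \<Psi>(1) by (simp add: ennreal_mult ennreal_plus)
    finally have "\<bar>killed_sg P Z E t \<phi> x\<bar> \<le> K * e * q + \<Psi>"
      using K e q \<Psi>(1) by (subst (asm) ennreal_le_iff) auto
    then have "e * \<bar>killed_sg P Z E t \<phi> x\<bar> \<le> e * (K * e * q + \<Psi>)" using e by (intro mult_left_mono) auto
    moreover have "e * \<bar>killed_sg P Z E t \<phi> x\<bar> = \<phi> x"
      unfolding eig e_def using pos[OF x] by (simp add: abs_mult exp_minus)
    ultimately show ?thesis by simp
  qed
  then have main: "D / q * \<phi> x \<le> K * (e * D) + 1 / G + K\<^sup>2 * e ^ 4 * G ^ 3 * z\<^sup>2 + 2 / G * h2 + e\<^sup>2 * G * p2"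
    using H \<Psi> z DH by (intro weighted_ratio_bound[OF q _ DH _ _ _ _ _ K e G]) (auto simp: D_def)
  have "cond_surv P Z E t f x - c = (killed_sg P Z E t f x - c * q) / q"
    unfolding cond_surv_def killed_sg_one[OF t] q_def[symmetric] using q by (simp add: diff_divide_distrib)
  then have "\<bar>cond_surv P Z E t f x - c\<bar> = D / q" unfolding D_def q_def[symmetric] using q by (simp add: abs_divide)
  then have "?L = ennreal (D / q * \<phi> x)" by simp
  also have "\<dots> \<le> ennreal (?R + 2 / G * h2 + e\<^sup>2 * G * p2)"
    using main by (intro ennreal_leI) (simp add: D_def e_def z_def)
  also have "\<dots> = ennreal ?R + ennreal ?a * ?H2 + ennreal ?b * ?\<Psi>2"
  proof -
    have R: "0 \<le> ?R" using K G by (intro add_nonneg_nonneg mult_nonneg_nonneg) auto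
    have a: "0 \<le> 2 / G * h2" and b: "0 \<le> e\<^sup>2 * G * p2" using G h2(2) p2(2) by auto
    have "ennreal (?R + 2 / G * h2 + e\<^sup>2 * G * p2) = ennreal ?R + ennreal (2 / G * h2) + ennreal (e\<^sup>2 * G * p2)"
      by (simp only: ennreal_plus[OF add_nonneg_nonneg[OF R a] b] ennreal_plus[OF R a])
    also have "ennreal (2 / G * h2) = ennreal ?a * ?H2" unfolding h2(1) using G h2(2) by (intro ennreal_mult) auto
    also have "ennreal (e\<^sup>2 * G * p2) = ennreal ?b * ?\<Psi>2"
      unfolding p2(1) e_def using G p2(2) by (intro ennreal_mult) auto
    finally show ?thesis .
  qed
  finally show ?thesis .
qed

text \<open>The product is integrable by 2 a b <= a^2 + b^2. If its integral were 0, the product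
  would vanish almost everywhere, hence so would \<open>\<phi>\<close> on \<open>E\<close>, against
  the normalization.\<close>

lemma eigenfunction_pairing_pos:
  assumes \<mu>: "sets \<mu> = sets borel"
    and \<phi>: "in_L2 \<mu> E \<phi>" "\<And>y. y \<in> E \<Longrightarrow> 0 < \<phi> y" and \<psi>: "in_L2 \<mu> E \<psi>" "\<And>y. y \<in> E \<Longrightarrow> 0 < \<psi> y"
    and norm: "(\<integral>x. indicator E x * \<phi> x \<partial>\<mu>) = 1"
  shows "0 < (\<integral>x. indicator E x * \<phi> x * \<psi> x \<partial>\<mu>)"
proof -
  note [measurable_cong] = \<mu>
  have [measurable]: "\<phi> \<in> borel_measurable borel" "\<psi> \<in> borel_measurable borel" using \<phi>(1) \<psi>(1) by (auto simp: in_L2_def)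
  note [measurable] = E_borel
  have int: "integrable \<mu> (\<lambda>x. indicator E x * (g x)\<^sup>2)" if "in_L2 \<mu> E g" for g
  proof (rule integrableI_nonneg)
    have [measurable]: "g \<in> borel_measurable borel" using that by (simp add: in_L2_def)
    show "(\<lambda>x. indicator E x * (g x)\<^sup>2) \<in> borel_measurable \<mu>" by measurable
    have "(\<integral>\<^sup>+x. ennreal (indicator E x * (g x)\<^sup>2) \<partial>\<mu>) = (\<integral>\<^sup>+x. indicator E x * ennreal ((g x)\<^sup>2) \<partial>\<mu>)"
      by (intro nn_integral_cong) (simp add: indicator_def)
    then show "(\<integral>\<^sup>+x. ennreal (indicator E x * (g x)\<^sup>2) \<partial>\<mu>) < \<infinity>" using that by (simp add: in_L2_def)
  qed auto
  have nn: "0 \<le> indicator E x * \<phi> x * \<psi> x" for x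
    using \<phi>(2)[of x] \<psi>(2)[of x] by (cases "x \<in> E") (auto intro!: mult_nonneg_nonneg less_imp_le)
  have i: "integrable \<mu> (\<lambda>x. indicator E x * \<phi> x * \<psi> x)"
  proof (rule Bochner_Integration.integrable_bound[OF Bochner_Integration.integrable_add[OF int[OF \<phi>(1)] int[OF \<psi>(1)]]])
    show "AE x in \<mu>. norm (indicator E x * \<phi> x * \<psi> x) \<le> norm (indicator E x * (\<phi> x)\<^sup>2 + indicator E x * (\<psi> x)\<^sup>2)"
    proof (rule AE_I2)
      fix x
      show "norm (indicator E x * \<phi> x * \<psi> x) \<le> norm (indicator E x * (\<phi> x)\<^sup>2 + indicator E x * (\<psi> x)\<^sup>2)"
      proof (cases "x \<in> E")
        case True
        have "0 < \<phi> x * \<psi> x" using \<phi>(2)[OF True] \<psi>(2)[OF True] by simp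
        moreover have "2 * (\<phi> x * \<psi> x) \<le> (\<phi> x)\<^sup>2 + (\<psi> x)\<^sup>2" using sum_squares_bound[of "\<phi> x" "\<psi> x"] by simp
        ultimately show ?thesis using True by simp
      qed simp
    qed
  qed measurable
  have "(\<integral>x. indicator E x * \<phi> x * \<psi> x \<partial>\<mu>) \<noteq> 0"
  proof
    assume "(\<integral>x. indicator E x * \<phi> x * \<psi> x \<partial>\<mu>) = 0"
    then have "AE x in \<mu>. indicator E x * \<phi> x * \<psi> x = 0"
      using integral_nonneg_eq_0_iff_AE[OF i] nn by simp
    then have "AE x in \<mu>. indicator E x * \<phi> x = 0"
      by eventually_elim (use \<phi>(2) \<psi>(2) in \<open>force simp: indicator_def split: if_splits\<close>)
    then have "(\<integral>x. indicator E x * \<phi> x \<partial>\<mu>) = 0" by (rule integral_eq_zero_AE)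
    with norm show False by simp
  qed
  moreover have "0 \<le> (\<integral>x. indicator E x * \<phi> x * \<psi> x \<partial>\<mu>)" using nn by (intro integral_nonneg_AE) auto
  ultimately show ?thesis by simp
qed

end

theorem mainTheorem6:
  fixes \<Omega> :: "'w set" and S :: "'w set set"
    and P :: "'h::{real_inner, complete_space, second_countable_topology} \<Rightarrow> 'w measure"
    and Z :: "real \<Rightarrow> 'w \<Rightarrow> 'h" and \<mu> :: "'h measure" and E :: "'h set"
    and lam1 \<gamma> M :: real and \<phi> \<phi>s f :: "'h \<Rightarrow> real"
  assumes proc: "cont_markov_process \<Omega> S P Z"
    and inv: "invariant_prob P Z \<mu>"
    and compact: "compact_on_L2 P Z \<mu>"
    and irred: "irreducible_proc P Z \<mu>"
    and E_meas: "E \<in> sets borel" and E_bdd: "bounded E" and E_conn: "connected E"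
    and E_supp: "E \<subseteq> measure_support \<mu>"
    and killing: "killing_cond P Z E"
    and phi_L2: "in_L2 \<mu> E \<phi>" and phi_pos: "\<forall>x\<in>E. \<phi> x > 0"
    and phis_L2: "in_L2 \<mu> E \<phi>s" and phis_pos: "\<forall>x\<in>E. \<phi>s x > 0"
    and phi_eig: "\<forall>t\<ge>0. AE x in \<mu>. x \<in> E \<longrightarrow> killed_sg P Z E t \<phi> x = exp (- lam1 * t) * \<phi> x"
    and phis_eig: "\<forall>t\<ge>0. \<forall>g. in_L2 \<mu> E g \<longrightarrow>
        (\<integral>x. indicator E x * \<phi>s x * killed_sg P Z E t g x \<partial>\<mu>)
          = exp (- lam1 * t) * (\<integral>x. indicator E x * \<phi>s x * g x \<partial>\<mu>)"
    and phi_norm: "(\<integral>x. indicator E x * \<phi> x \<partial>\<mu>) = 1"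
    and phis_norm: "(\<integral>x. indicator E x * \<phi>s x \<partial>\<mu>) = 1"
    and M_def: "M = (\<integral>x. indicator E x * \<phi> x * \<phi>s x \<partial>\<mu>)"
    and gamma_pos: "\<gamma> > 0"
    and gap: "\<exists>T0. \<forall>t\<ge>T0. \<forall>g. in_L2 \<mu> E g \<longrightarrow>
        (\<integral>\<^sup>+x. indicator E x * ennreal ((exp (lam1 * t) * killed_sg P Z E t g x
              - \<phi> x / M * (\<integral>y. indicator E y * \<phi>s y * g y \<partial>\<mu>))\<^sup>2) \<partial>\<mu>)
          \<le> ennreal ((exp (- \<gamma> * t) * (1 + 1 / M))\<^sup>2) * (\<integral>\<^sup>+x. indicator E x * ennreal ((g x)\<^sup>2) \<partial>\<mu>)"
    and f_L2: "in_L2 \<mu> E f"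
  shows "\<exists>T>0. \<exists>C>0. \<forall>t\<ge>T.
           (\<integral>\<^sup>+x. indicator E x * ennreal (\<bar>cond_surv P Z E t f x - (\<integral>y. indicator E y * \<phi>s y * f y \<partial>\<mu>)\<bar> * \<phi> x) \<partial>\<mu>)
             \<le> ennreal (C * exp (- \<gamma> * t))"
proof -
  have "E \<noteq> {}" using phi_norm by auto
  interpret killed_process \<Omega> S P Z E
    by unfold_locales (use proc E_meas killing \<open>E \<noteq> {}\<close> in auto)
  interpret prob_space \<mu> using inv by (simp add: invariant_prob_def)
  have sets_mu[measurable_cong]: "sets \<mu> = sets borel" using inv by (simp add: invariant_prob_def)
  have mphi[measurable]: "\<phi> \<in> borel_measurable borel" and mf[measurable]: "f \<in> borel_measurable borel"
    using phi_L2 f_L2 by (auto simp: in_L2_def)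
  note [measurable] = E_meas
  define c where "c = (\<integral>y. indicator E y * \<phi>s y * f y \<partial>\<mu>)"
  have M: "0 < M" unfolding M_def
    using phi_pos phis_pos by (intro eigenfunction_pairing_pos sets_mu phi_L2 phis_L2 phi_norm) auto
  define K where "K = 2 * M"
  have K: "0 < K" using M by (simp add: K_def)
  define u1 where "u1 t x = exp (lam1 * t) * killed_sg P Z E t f x - \<phi> x / M * c" for t x
  define u2 where "u2 t x = exp (lam1 * t) * surv_prob t x - \<phi> x / M" for t x
  define F where "F = enn2real (\<integral>\<^sup>+x. indicator E x * ennreal ((f x)\<^sup>2) \<partial>\<mu>)"
  have F: "(\<integral>\<^sup>+x. indicator E x * ennreal ((f x)\<^sup>2) \<partial>\<mu>) = ennreal F" and F0: "0 \<le> F"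
    using f_L2 by (auto simp: F_def in_L2_def less_top)
  define c1 where "c1 = (1 + 1 / M)\<^sup>2 * F"
  define c2 where "c2 = (1 + 1 / M)\<^sup>2"
  have c12: "0 \<le> c1" "0 \<le> c2" using F0 by (auto simp: c1_def c2_def)
  obtain T0 where gap': "\<And>t g. T0 \<le> t \<Longrightarrow> in_L2 \<mu> E g \<Longrightarrow>
        (\<integral>\<^sup>+x. indicator E x * ennreal ((exp (lam1 * t) * killed_sg P Z E t g x
              - \<phi> x / M * (\<integral>y. indicator E y * \<phi>s y * g y \<partial>\<mu>))\<^sup>2) \<partial>\<mu>)
          \<le> ennreal ((exp (- \<gamma> * t) * (1 + 1 / M))\<^sup>2) * (\<integral>\<^sup>+x. indicator E x * ennreal ((g x)\<^sup>2) \<partial>\<mu>)"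
    using gap by blast
  have rate: "(exp (- \<gamma> * t) * (1 + 1 / M))\<^sup>2 = c2 * exp (- 2 * \<gamma> * t)" for t
    by (simp add: c2_def power_mult_distrib exp_double[symmetric] mult.assoc)
  have I1: "(\<integral>\<^sup>+x. indicator E x * ennreal ((u1 t x)\<^sup>2) \<partial>\<mu>) \<le> ennreal (c1 * exp (- 2 * \<gamma> * t))" if "T0 \<le> t" for t
    using gap'[OF that f_L2] unfolding u1_def c_def rate F using F0
    by (simp add: ennreal_mult[symmetric] c1_def c2_def mult_ac)
  have I2: "(\<integral>\<^sup>+x. indicator E x * ennreal ((u2 t x)\<^sup>2) \<partial>\<mu>) \<le> ennreal (c2 * exp (- 2 * \<gamma> * t))" if "max T0 1 \<le> t" for t
  proof -
    \<comment> \<open>The gap for the constant function 1, whose pairing with \<open>\<phi>s\<close>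
      is 1 by normalization, is the convergence of the rescaled survival probability.\<close>
    have one: "in_L2 \<mu> E (\<lambda>_. 1)"
      by (simp add: in_L2_def sets_mu emeasure_eq_measure)
    have "(\<integral>\<^sup>+x. indicator E x * ennreal ((u2 t x)\<^sup>2) \<partial>\<mu>) \<le> ennreal (c2 * exp (- 2 * \<gamma> * t)) * emeasure \<mu> E"
      using gap'[OF _ one, of t] that unfolding u2_def rate by (simp add: killed_sg_one phis_norm sets_mu)
    also have "\<dots> \<le> ennreal (c2 * exp (- 2 * \<gamma> * t)) * 1"
      by (intro mult_left_mono emeasure_le_1) auto
    finally show ?thesis by simp
  qed
  have pos: "\<And>y. y \<in> E \<Longrightarrow> 0 < \<phi> y" using phi_pos by auto
  have small: "\<exists>T. \<forall>t\<ge>T. emeasure \<mu> {x\<in>E. K * (exp (lam1 * t) * surv_prob t x) < \<phi> x} < ennreal d" if "0 < d" for d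
    unfolding K_def
    by (rule low_survival_set_small[OF inv M mphi pos gamma_pos c12(2) I2[unfolded u2_def] that])
  \<comment> \<open>The largest loss below is \<open>e ^ 4 * G ^ 3\<close>, at most
    \<open>exp ((4 * \<bar>lam1\<bar> + 3 * \<gamma>) * t)\<close>. One further
    \<open>\<gamma>\<close> leaves exactly the required rate.\<close>
  define k where "k = 4 * \<bar>lam1\<bar> + 4 * \<gamma>"
  have k: "0 \<le> k" using gamma_pos by (simp add: k_def)
  have "AE x in \<mu>. x \<in> E \<longrightarrow> killed_sg P Z E 1 \<phi> x = exp (- lam1 * 1) * \<phi> x"
    by (rule phi_eig[THEN spec, THEN mp]) simp
  moreover have "(\<integral>\<^sup>+x. indicator E x * ennreal ((\<phi> x)\<^sup>2) \<partial>\<mu>) < \<infinity>" using phi_L2 by (simp add: in_L2_def)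
  ultimately obtain C T1 where C: "0 < C" "0 < T1" and
    Iz: "\<And>t. T1 \<le> t \<Longrightarrow> (\<integral>\<^sup>+x. ennreal ((excess K lam1 \<phi> t x)\<^sup>2) \<partial>\<mu>) \<le> ennreal (C * exp (- k * t))"
    using excess_decay[OF inv compact less_imp_le[OF K] mphi pos _ _ small k] by blast
  \<comment> \<open>By invariance this bounds the integral of Q_t ((abs f + abs c)^2) for every
    \<open>t > 0\<close>; the decay of that term comes from its coefficient
    \<open>2 / G\<close>.\<close>
  define FH where "FH = enn2real (\<integral>\<^sup>+x. indicator E x * ennreal ((\<bar>f x\<bar> + \<bar>c\<bar>)\<^sup>2) \<partial>\<mu>)"
  have FH: "(\<integral>\<^sup>+x. indicator E x * ennreal ((\<bar>f x\<bar> + \<bar>c\<bar>)\<^sup>2) \<partial>\<mu>) = ennreal FH" and FH0: "0 \<le> FH"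
  proof -
    have "(\<integral>\<^sup>+x. indicator E x * ennreal ((\<bar>f x\<bar> + \<bar>c\<bar>)\<^sup>2) \<partial>\<mu>)
      \<le> (\<integral>\<^sup>+x. 2 * (indicator E x * ennreal ((f x)\<^sup>2)) + ennreal (2 * c\<^sup>2) \<partial>\<mu>)"
    proof (rule nn_integral_mono)
      fix x
      have "(\<bar>f x\<bar> + \<bar>c\<bar>)\<^sup>2 \<le> 2 * (f x)\<^sup>2 + 2 * c\<^sup>2"
        using sum_squares_bound[of "\<bar>f x\<bar>" "\<bar>c\<bar>"] by (simp add: power2_sum)
      then have "ennreal ((\<bar>f x\<bar> + \<bar>c\<bar>)\<^sup>2) \<le> ennreal (2 * (f x)\<^sup>2 + 2 * c\<^sup>2)" by (rule ennreal_leI)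
      also have "\<dots> = 2 * ennreal ((f x)\<^sup>2) + ennreal (2 * c\<^sup>2)" by (simp add: ennreal_mult)
      finally show "indicator E x * ennreal ((\<bar>f x\<bar> + \<bar>c\<bar>)\<^sup>2) \<le> 2 * (indicator E x * ennreal ((f x)\<^sup>2)) + ennreal (2 * c\<^sup>2)"
        by (simp add: indicator_def)
    qed
    also have "\<dots> = 2 * ennreal F + ennreal (2 * c\<^sup>2)"
      by (subst nn_integral_add) (auto simp: nn_integral_cmult F emeasure_space_1)
    also have "\<dots> < top" by (simp add: ennreal_mult_less_top)
    finally show "(\<integral>\<^sup>+x. indicator E x * ennreal ((\<bar>f x\<bar> + \<bar>c\<bar>)\<^sup>2) \<partial>\<mu>) = ennreal FH"
      by (simp add: FH_def)
  qed (simp add: FH_def)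
  define Cf where "Cf = (K + K * \<bar>c\<bar> + 1) + K * c1 + K * \<bar>c\<bar> * c2 + K\<^sup>2 * C + 2 * FH + C"
  have "0 < K + K * \<bar>c\<bar> + 1" using K by (simp add: add_pos_nonneg)
  then have Cf: "0 < Cf" unfolding Cf_def using K c12 C FH0 by (intro add_pos_nonneg) auto
  have "(\<integral>\<^sup>+x. indicator E x * ennreal (\<bar>cond_surv P Z E t f x - c\<bar> * \<phi> x) \<partial>\<mu>) \<le> ennreal (Cf * exp (- \<gamma> * t))"
    if t: "max (max T0 T1) 1 \<le> t" for t
  proof -
    have t0: "0 < t" using t by simp
    define e where "e = exp (lam1 * t)"
    define G where "G = exp (\<gamma> * t)"
    have e: "0 < e" and G: "0 < G" by (auto simp: e_def G_def)
    have [measurable]: "surv_prob t \<in> borel_measurable borel" "killed_sg P Z E t f \<in> borel_measurable borel"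
      "excess K lam1 \<phi> t \<in> borel_measurable borel"
      using t0 by (auto intro!: surv_prob_measurable killed_sg_measurable excess_measurable)
    have [measurable]: "u1 t \<in> borel_measurable borel" "u2 t \<in> borel_measurable borel"
      unfolding u1_def u2_def by measurable
    let ?H2 = "killed_op t (\<lambda>y. ennreal ((\<bar>f y\<bar> + \<bar>c\<bar>)\<^sup>2))" and ?\<Psi>2 = "killed_op t (\<lambda>y. ennreal ((excess K lam1 \<phi> t y)\<^sup>2))"
    have [measurable]: "?H2 \<in> borel_measurable borel" "?\<Psi>2 \<in> borel_measurable borel"
      using t0 by (auto intro!: killed_op_measurable)
    have "(\<integral>\<^sup>+x. indicator E x * ennreal (\<bar>cond_surv P Z E t f x - c\<bar> * \<phi> x) \<partial>\<mu>)
       \<le> (\<integral>\<^sup>+x. ennreal ((K + K * \<bar>c\<bar> + 1) / G) + ennreal (K * G) * (indicator E x * ennreal ((u1 t x)\<^sup>2))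
            + ennreal (K * \<bar>c\<bar> * G) * (indicator E x * ennreal ((u2 t x)\<^sup>2))
            + ennreal (K\<^sup>2 * e ^ 4 * G ^ 3) * ennreal ((excess K lam1 \<phi> t x)\<^sup>2)
            + ennreal (2 / G) * ?H2 x + ennreal (e\<^sup>2 * G) * ?\<Psi>2 x \<partial>\<mu>)"
    proof (rule nn_integral_mono_AE)
      have "AE x in \<mu>. x \<in> E \<longrightarrow> killed_sg P Z E t \<phi> x = exp (- lam1 * t) * \<phi> x"
        using phi_eig t0 by auto
      then show "AE x in \<mu>. indicator E x * ennreal (\<bar>cond_surv P Z E t f x - c\<bar> * \<phi> x)
        \<le> ennreal ((K + K * \<bar>c\<bar> + 1) / G) + ennreal (K * G) * (indicator E x * ennreal ((u1 t x)\<^sup>2))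
            + ennreal (K * \<bar>c\<bar> * G) * (indicator E x * ennreal ((u2 t x)\<^sup>2))
            + ennreal (K\<^sup>2 * e ^ 4 * G ^ 3) * ennreal ((excess K lam1 \<phi> t x)\<^sup>2)
            + ennreal (2 / G) * ?H2 x + ennreal (e\<^sup>2 * G) * ?\<Psi>2 x"
      proof eventually_elim
        case (elim x)
        show ?case
        proof (cases "x \<in> E")
          case True
          \<comment> \<open>Passes from squared errors to absolute ones. The squares integrate to
            order \<open>exp (- 2 * \<gamma> * t)\<close>, so with the weight \<open>G\<close> both
            terms are of order \<open>exp (- \<gamma> * t)\<close>; the constant
            \<open>1 / G\<close> is integrated against a probability measure.\<close>
          have sq: "\<bar>u\<bar> \<le> 1 / G + G * u\<^sup>2" for u :: real
          proof -
            have "0 \<le> (G * \<bar>u\<bar> - 1)\<^sup>2 + (G * \<bar>u\<bar>)\<^sup>2 + 1" by simp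
            then have "2 * (G * \<bar>u\<bar>) \<le> 2 * (G * (1 / G + G * u\<^sup>2))"
              using G by (simp add: power2_diff power_mult_distrib distrib_left power2_eq_square[of G])
            then show ?thesis using G by simp
          qed
          \<comment> \<open>The common limit \<open>c * \<phi> x / M\<close> cancels, leaving only
            the two spectral gap errors.\<close>
          have "e * \<bar>killed_sg P Z E t f x - c * surv_prob t x\<bar> = \<bar>u1 t x - c * u2 t x\<bar>"
            unfolding u1_def u2_def e_def[symmetric] using e
            by (simp add: abs_mult[symmetric, of e, unfolded abs_of_pos[OF e]] algebra_simps)
          also have "\<dots> \<le> \<bar>u1 t x\<bar> + \<bar>c\<bar> * \<bar>u2 t x\<bar>"
            using abs_triangle_ineq4[of "u1 t x" "c * u2 t x"] by (simp add: abs_mult)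
          also have "\<dots> \<le> (1 / G + G * (u1 t x)\<^sup>2) + \<bar>c\<bar> * (1 / G + G * (u2 t x)\<^sup>2)"
            by (intro add_mono mult_left_mono sq) auto
          finally have "K * (e * \<bar>killed_sg P Z E t f x - c * surv_prob t x\<bar>)
            \<le> K * ((1 / G + G * (u1 t x)\<^sup>2) + \<bar>c\<bar> * (1 / G + G * (u2 t x)\<^sup>2))"
            using K by (intro mult_left_mono) auto
          then have "K * (e * \<bar>killed_sg P Z E t f x - c * surv_prob t x\<bar>) + 1 / G + K\<^sup>2 * e ^ 4 * G ^ 3 * (excess K lam1 \<phi> t x)\<^sup>2
            \<le> (K + K * \<bar>c\<bar> + 1) / G + K * G * (u1 t x)\<^sup>2 + K * \<bar>c\<bar> * G * (u2 t x)\<^sup>2 + K\<^sup>2 * e ^ 4 * G ^ 3 * (excess K lam1 \<phi> t x)\<^sup>2"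
            by (simp add: algebra_simps add_divide_distrib)
          then have "ennreal (K * (e * \<bar>killed_sg P Z E t f x - c * surv_prob t x\<bar>) + 1 / G + K\<^sup>2 * e ^ 4 * G ^ 3 * (excess K lam1 \<phi> t x)\<^sup>2)
            \<le> ennreal ((K + K * \<bar>c\<bar> + 1) / G + K * G * (u1 t x)\<^sup>2 + K * \<bar>c\<bar> * G * (u2 t x)\<^sup>2 + K\<^sup>2 * e ^ 4 * G ^ 3 * (excess K lam1 \<phi> t x)\<^sup>2)"
            by (rule ennreal_leI)
          also have "\<dots> = ennreal ((K + K * \<bar>c\<bar> + 1) / G) + ennreal (K * G) * ennreal ((u1 t x)\<^sup>2)
            + ennreal (K * \<bar>c\<bar> * G) * ennreal ((u2 t x)\<^sup>2) + ennreal (K\<^sup>2 * e ^ 4 * G ^ 3) * ennreal ((excess K lam1 \<phi> t x)\<^sup>2)"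
            using K G e by (simp only: ennreal_mult[symmetric] ennreal_plus[symmetric] zero_le_power2 add_nonneg_nonneg
                mult_nonneg_nonneg less_imp_le abs_ge_zero zero_le_power divide_nonneg_nonneg zero_le_one)
          finally have bound: "ennreal (K * (e * \<bar>killed_sg P Z E t f x - c * surv_prob t x\<bar>) + 1 / G + K\<^sup>2 * e ^ 4 * G ^ 3 * (excess K lam1 \<phi> t x)\<^sup>2) \<le> \<dots>" .
          have "indicator E x * ennreal (\<bar>cond_surv P Z E t f x - c\<bar> * \<phi> x) = ennreal (\<bar>cond_surv P Z E t f x - c\<bar> * \<phi> x)"
            using True by simp
          also have "\<dots> \<le> ennreal (K * (e * \<bar>killed_sg P Z E t f x - c * surv_prob t x\<bar>) + 1 / G + K\<^sup>2 * e ^ 4 * G ^ 3 * (excess K lam1 \<phi> t x)\<^sup>2)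
             + ennreal (2 / G) * ?H2 x + ennreal (e\<^sup>2 * G) * ?\<Psi>2 x"
            unfolding e_def using elim True by (intro cond_surv_pointwise t0 K G mphi pos mf) auto
          also note add_right_mono[OF add_right_mono[OF bound]]
          finally show ?thesis using True by simp
        qed simp
      qed
    qed
    also have "\<dots> = ennreal ((K + K * \<bar>c\<bar> + 1) / G) + ennreal (K * G) * (\<integral>\<^sup>+x. indicator E x * ennreal ((u1 t x)\<^sup>2) \<partial>\<mu>)
            + ennreal (K * \<bar>c\<bar> * G) * (\<integral>\<^sup>+x. indicator E x * ennreal ((u2 t x)\<^sup>2) \<partial>\<mu>)
            + ennreal (K\<^sup>2 * e ^ 4 * G ^ 3) * (\<integral>\<^sup>+x. ennreal ((excess K lam1 \<phi> t x)\<^sup>2) \<partial>\<mu>)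
            + ennreal (2 / G) * (\<integral>\<^sup>+x. ?H2 x \<partial>\<mu>) + ennreal (e\<^sup>2 * G) * (\<integral>\<^sup>+x. ?\<Psi>2 x \<partial>\<mu>)"
      by (simp add: nn_integral_add nn_integral_cmult emeasure_space_1)
    also have "\<dots> \<le> ennreal ((K + K * \<bar>c\<bar> + 1) / G) + ennreal (K * G) * ennreal (c1 * exp (- 2 * \<gamma> * t))
            + ennreal (K * \<bar>c\<bar> * G) * ennreal (c2 * exp (- 2 * \<gamma> * t))
            + ennreal (K\<^sup>2 * e ^ 4 * G ^ 3) * ennreal (C * exp (- k * t))
            + ennreal (2 / G) * ennreal FH + ennreal (e\<^sup>2 * G) * ennreal (C * exp (- k * t))"
    proof (intro add_mono mult_left_mono order_refl)
      show "(\<integral>\<^sup>+x. indicator E x * ennreal ((u1 t x)\<^sup>2) \<partial>\<mu>) \<le> ennreal (c1 * exp (- 2 * \<gamma> * t))" using t by (intro I1) simp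
      show "(\<integral>\<^sup>+x. indicator E x * ennreal ((u2 t x)\<^sup>2) \<partial>\<mu>) \<le> ennreal (c2 * exp (- 2 * \<gamma> * t))" using t by (intro I2) simp
      show "(\<integral>\<^sup>+x. ennreal ((excess K lam1 \<phi> t x)\<^sup>2) \<partial>\<mu>) \<le> ennreal (C * exp (- k * t))" using t by (intro Iz) simp
      show "(\<integral>\<^sup>+x. ?H2 x \<partial>\<mu>) \<le> ennreal FH"
        unfolding FH[symmetric] by (rule nn_integral_killed_op_le[OF inv t0]) measurable
      have "(\<integral>\<^sup>+x. ?\<Psi>2 x \<partial>\<mu>) \<le> (\<integral>\<^sup>+x. indicator E x * ennreal ((excess K lam1 \<phi> t x)\<^sup>2) \<partial>\<mu>)"
        by (rule nn_integral_killed_op_le[OF inv t0]) measurable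
      also have "\<dots> \<le> (\<integral>\<^sup>+x. ennreal ((excess K lam1 \<phi> t x)\<^sup>2) \<partial>\<mu>)"
        by (intro nn_integral_mono) (simp add: indicator_def)
      also have "\<dots> \<le> ennreal (C * exp (- k * t))" using t by (intro Iz) simp
      finally show "(\<integral>\<^sup>+x. ?\<Psi>2 x \<partial>\<mu>) \<le> ennreal (C * exp (- k * t))" .
    qed auto
    also have "\<dots> = ennreal ((K + K * \<bar>c\<bar> + 1) / G + K * G * (c1 * exp (- 2 * \<gamma> * t))
            + K * \<bar>c\<bar> * G * (c2 * exp (- 2 * \<gamma> * t)) + K\<^sup>2 * e ^ 4 * G ^ 3 * (C * exp (- k * t))
            + 2 / G * FH + e\<^sup>2 * G * (C * exp (- k * t)))"
      using K G e c12 C FH0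
      by (simp only: ennreal_mult[symmetric] ennreal_plus[symmetric] zero_le_power2 add_nonneg_nonneg exp_ge_zero
                mult_nonneg_nonneg less_imp_le abs_ge_zero zero_le_power divide_nonneg_nonneg zero_le_one zero_le_numeral)
    also have "\<dots> \<le> ennreal (Cf * exp (- \<gamma> * t))"
    proof (rule ennreal_leI)
      have G1: "1 / G = exp (- \<gamma> * t)" by (simp add: G_def exp_minus inverse_eq_divide)
      have G2: "G * exp (- 2 * \<gamma> * t) = exp (- \<gamma> * t)" by (simp add: G_def exp_add[symmetric])
      have lt: "lam1 * t \<le> \<bar>lam1\<bar> * t" using t0 by (intro mult_right_mono) auto
      have gt: "0 \<le> \<gamma> * t" "0 \<le> \<bar>lam1\<bar> * t" using t0 gamma_pos by auto
      have e4: "e ^ 4 * G ^ 3 * exp (- k * t) \<le> exp (- \<gamma> * t)"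
      proof -
        have "e ^ 4 * G ^ 3 * exp (- k * t) = exp (4 * (lam1 * t) + 3 * (\<gamma> * t) - k * t)"
          by (simp add: e_def G_def exp_of_nat_mult[symmetric] exp_add[symmetric])
        also have "\<dots> \<le> exp (- \<gamma> * t)" using lt by (simp add: k_def algebra_simps)
        finally show ?thesis .
      qed
      have e2: "e\<^sup>2 * G * exp (- k * t) \<le> exp (- \<gamma> * t)"
      proof -
        have "e\<^sup>2 * G * exp (- k * t) = exp (2 * (lam1 * t) + \<gamma> * t - k * t)"
          by (simp add: e_def G_def exp_of_nat_mult[symmetric] exp_add[symmetric])
        also have "\<dots> \<le> exp (- \<gamma> * t)" using lt gt by (simp add: k_def algebra_simps)
        finally show ?thesis .
      qed
      have "(K + K * \<bar>c\<bar> + 1) / G + K * G * (c1 * exp (- 2 * \<gamma> * t))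
            + K * \<bar>c\<bar> * G * (c2 * exp (- 2 * \<gamma> * t)) + K\<^sup>2 * e ^ 4 * G ^ 3 * (C * exp (- k * t))
            + 2 / G * FH + e\<^sup>2 * G * (C * exp (- k * t))
        = (K + K * \<bar>c\<bar> + 1) * (1 / G) + K * c1 * (G * exp (- 2 * \<gamma> * t))
            + K * \<bar>c\<bar> * c2 * (G * exp (- 2 * \<gamma> * t)) + K\<^sup>2 * C * (e ^ 4 * G ^ 3 * exp (- k * t))
            + 2 * FH * (1 / G) + C * (e\<^sup>2 * G * exp (- k * t))"
        by (simp add: mult_ac)
      also have "\<dots> \<le> (K + K * \<bar>c\<bar> + 1) * exp (- \<gamma> * t) + K * c1 * exp (- \<gamma> * t)
            + K * \<bar>c\<bar> * c2 * exp (- \<gamma> * t) + K\<^sup>2 * C * exp (- \<gamma> * t)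
            + 2 * FH * exp (- \<gamma> * t) + C * exp (- \<gamma> * t)"
        unfolding G1 G2 using K C by (intro add_mono mult_left_mono e4 e2 order_refl) auto
      also have "\<dots> = Cf * exp (- \<gamma> * t)" by (simp only: Cf_def distrib_right)
      finally show "(K + K * \<bar>c\<bar> + 1) / G + K * G * (c1 * exp (- 2 * \<gamma> * t))
            + K * \<bar>c\<bar> * G * (c2 * exp (- 2 * \<gamma> * t)) + K\<^sup>2 * e ^ 4 * G ^ 3 * (C * exp (- k * t))
            + 2 / G * FH + e\<^sup>2 * G * (C * exp (- k * t)) \<le> Cf * exp (- \<gamma> * t)" .
    qed
    finally show ?thesis .
  qed
  moreover have "0 < max (max T0 T1) 1" by simp
  ultimately show ?thesis using Cf unfolding c_def by blast
qed

end
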